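(* Let $a=(a_1,\dots,a_n)$ be an anisotropy. Let $0<p_0<p<p_1\le\infty$, $s_1<s<s_0$ and $0<q\le\infty$. Then there are continuous embeddings $$B^{s_0,a}_{p_0,p}(\mathbb{R}^n)\hookrightarrow F^{s,a}_{p,q}(\mathbb{R}^n)\hookrightarrow B^{s_1,a}_{p_1,p}(\mathbb{R}^n)$$ provided $s_0-\frac{|a|}{p_0}=s-\frac{|a|}{p}=s_1-\frac{|a|}{p_1}$.
   Context: An anisotropy is a vector $a=(a_1,\dots,a_n)$ of real numbers with $\min(a_1,\dots,a_n)=1$; $|a|=a_1+\dots+a_n$. For $t>0$ let $t^ax=(t^{a_1}x_1,\dots,t^{a_n}x_n)$, and $2^{ka}x=(2^k)^ax$. For $x\ne0$, $|x|_a$ is the unique $t>0$ with $\sum_{i=1}^n x_i^2/t^{2a_i}=1$, and $|0|_a=0$. $\mathcal{F}$ is the Fourier transform on $\mathcal{S}'(\mathbb{R}^n)$. Fix $\psi\in C_0^\infty(\mathbb{R}^n)$ with $\psi(x)=1$ for $|x|_a\le1$ and $\psi(x)=0$ for $|x|_a\ge2$; set $\varphi_0=\psi$ and $\varphi_j(x)=\varphi_0(2^{-ja}x)-\varphi_0(2^{(-j+1)a}x)$ for $j\ge1$. For $s\in\mathbb{R}$, $p,q\in\,]0,\infty]$, $B^{s,a}_{p,q}(\mathbb{R}^n)$ is the set of $f\in\mathcal{S}'(\mathbb{R}^n)$ with finite quasi-norm $\bigl(\sum_{j\ge0}2^{jsq}\|\mathcal{F}^{-1}(\varphi_j\mathcal{F}f)\|_{L_p}^q\bigr)^{1/q}$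 and, for $p<\infty$, $F^{s,a}_{p,q}(\mathbb{R}^n)$ is the set of $f\in\mathcal{S}'(\mathbb{R}^n)$ with finite quasi-norm $\bigl\|\bigl(\sum_{j\ge0}2^{jsq}|\mathcal{F}^{-1}(\varphi_j\mathcal{F}f)(\cdot)|^q\bigr)^{1/q}\bigr\|_{L_p}$ (usual modification for $q=\infty$). *)

theory Defs
  imports "HOL-Probability.Probability"
begin

section \<open>Smooth, Schwartz and test functions on Euclidean space\<close>

definition partial_deriv :: "'n::finite \<Rightarrow> (real^'n \<Rightarrow> complex) \<Rightarrow> real^'n \<Rightarrow> complex" where
  "partial_deriv i f x = frechet_derivative f (at x) (axis i 1)"

text \<open>Iterated partial derivatives are indexed by the list of directions, the head being applied
  last. For smooth functions, lists that are permutations of each other give the same derivative.\<close>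

primrec partial_derivs :: "'n::finite list \<Rightarrow> (real^'n \<Rightarrow> complex) \<Rightarrow> real^'n \<Rightarrow> complex" where
  "partial_derivs [] f = f"
| "partial_derivs (i # is) f = partial_deriv i (partial_derivs is f)"

definition smooth :: "(real^'n::finite \<Rightarrow> complex) \<Rightarrow> bool" where
  "smooth f \<longleftrightarrow> (\<forall>is x. partial_derivs is f differentiable (at x))"

definition test_function :: "(real^'n::finite \<Rightarrow> complex) \<Rightarrow> bool" where
  "test_function f \<longleftrightarrow> smooth f \<and> compact (closure {x. f x \<noteq> 0})"

definition schwartz :: "(real^'n::finite \<Rightarrow> complex) set" where
  "schwartz = {f. smooth f \<and>
     (\<forall>k is. bounded (range (\<lambda>x. (1 + norm x) ^ k * norm (partial_derivs is f x))))}"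

definition schwartz_seminorm ::
  "nat \<Rightarrow> 'n::finite list \<Rightarrow> (real^'n \<Rightarrow> complex) \<Rightarrow> real" where
  "schwartz_seminorm k is f = (SUP x. (1 + norm x) ^ k * norm (partial_derivs is f x))"

section \<open>Tempered distributions\<close>

text \<open>The seminorms make the Schwartz space metrizable, so continuity is sequential continuity.
  Distributions are extensional, i.e. carry no information outside the Schwartz space.\<close>

type_synonym 'n distr = "(real^'n \<Rightarrow> complex) \<Rightarrow> complex"

definition tempered_distributions :: "'n::finite distr set" where
  "tempered_distributions = {T. T \<in> extensional schwartz \<and>
     (\<forall>\<eta>\<in>schwartz. \<forall>\<theta>\<in>schwartz. T (\<lambda>x. \<eta> x + \<theta> x) = T \<eta> + T \<theta>) \<and>
     (\<forall>c. \<forall>\<eta>\<in>schwartz. T (\<lambda>x. c * \<eta> x) = c * T \<eta>) \<and>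
     (\<forall>\<theta> \<eta>. (\<forall>m::nat. \<theta> m \<in> schwartz) \<and> \<eta> \<in> schwartz \<and>
        (\<forall>k is. (\<lambda>m. schwartz_seminorm k is (\<lambda>x. \<theta> m x - \<eta> x)) \<longlonglongrightarrow> 0) \<longrightarrow>
        (\<lambda>m. T (\<theta> m)) \<longlonglongrightarrow> T \<eta>)}"

definition fourier :: "(real^'n::finite \<Rightarrow> complex) \<Rightarrow> real^'n \<Rightarrow> complex" where
  "fourier f \<xi> = (LINT x|lborel. cis (- (x \<bullet> \<xi>)) * f x)"

definition inv_fourier :: "(real^'n::finite \<Rightarrow> complex) \<Rightarrow> real^'n \<Rightarrow> complex" where
  "inv_fourier f x = (LINT \<xi>|lborel. cis (x \<bullet> \<xi>) * f \<xi>) / of_real ((2 * pi) ^ CARD('n))"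

definition fourier_distr :: "'n::finite distr \<Rightarrow> 'n distr" where
  "fourier_distr T = (\<lambda>\<eta>\<in>schwartz. T (fourier \<eta>))"

definition inv_fourier_distr :: "'n::finite distr \<Rightarrow> 'n distr" where
  "inv_fourier_distr T = (\<lambda>\<eta>\<in>schwartz. T (inv_fourier \<eta>))"

definition mult_distr :: "(real^'n::finite \<Rightarrow> complex) \<Rightarrow> 'n distr \<Rightarrow> 'n distr" where
  "mult_distr \<phi> T = (\<lambda>\<eta>\<in>schwartz. T (\<lambda>x. \<phi> x * \<eta> x))"

text \<open>A distribution given by a continuous function is identified with that (unique) function.
  By the Paley--Wiener--Schwartz theorem this applies to every tempered distribution whose Fourier
  transform has compact support, which is the only case used below.\<close>

definition function_of_distr :: "'n::finite distr \<Rightarrow> real^'n \<Rightarrow> complex" where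
  "function_of_distr T = (THE u. continuous_on UNIV u \<and>
     (\<forall>\<eta>\<in>schwartz. integrable lborel (\<lambda>x. u x * \<eta> x) \<and> T \<eta> = (LINT x|lborel. u x * \<eta> x)))"

section \<open>Lebesgue and sequence quasi-norms\<close>

definition ennreal_powr :: "ennreal \<Rightarrow> real \<Rightarrow> ennreal" where \<comment> \<open>for positive exponents\<close>
  "ennreal_powr x r = (if x = \<infinity> then \<infinity> else ennreal (enn2real x powr r))"

text \<open>Both quasi-norms take an exponent in \<open>]0,\<infinity>]\<close> and nonnegative extended-real arguments.\<close>

definition Lp_norm :: "ereal \<Rightarrow> (real^'n::finite \<Rightarrow> ennreal) \<Rightarrow> ennreal" where
  "Lp_norm p g =
     (if p = \<infinity> then esssup lborel g
      else ennreal_powr (\<integral>\<^sup>+x. ennreal_powr (g x) (real_of_ereal p) \<partial>lborel) (1 / real_of_ereal p))"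

definition lq_norm :: "ereal \<Rightarrow> (nat \<Rightarrow> ennreal) \<Rightarrow> ennreal" where
  "lq_norm q c =
     (if q = \<infinity> then (SUP j. c j)
      else ennreal_powr (\<Sum>j. ennreal_powr (c j) (real_of_ereal q)) (1 / real_of_ereal q))"

section \<open>Anisotropic Besov and Lizorkin--Triebel spaces\<close>

definition anisotropy :: "real^'n::finite \<Rightarrow> bool" where
  "anisotropy a \<longleftrightarrow> Min (range (\<lambda>i. a $ i)) = 1"

definition aniso_size :: "real^'n::finite \<Rightarrow> real" where
  "aniso_size a = (\<Sum>i\<in>UNIV. a $ i)"

definition aniso_dil :: "real^'n::finite \<Rightarrow> real \<Rightarrow> real^'n \<Rightarrow> real^'n" where
  "aniso_dil a t x = (\<chi> i. t powr (a $ i) * x $ i)"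

definition aniso_norm :: "real^'n::finite \<Rightarrow> real^'n \<Rightarrow> real" where
  "aniso_norm a x =
     (if x = 0 then 0 else THE t. t > 0 \<and> (\<Sum>i\<in>UNIV. (x $ i)\<^sup>2 / t powr (2 * a $ i)) = 1)"

definition cutoff :: "real^'n::finite \<Rightarrow> (real^'n \<Rightarrow> complex) \<Rightarrow> bool" where
  "cutoff a \<psi> \<longleftrightarrow> test_function \<psi> \<and>
     (\<forall>x. aniso_norm a x \<le> 1 \<longrightarrow> \<psi> x = 1) \<and> (\<forall>x. aniso_norm a x \<ge> 2 \<longrightarrow> \<psi> x = 0)"

definition dyadic_piece ::
  "real^'n::finite \<Rightarrow> (real^'n \<Rightarrow> complex) \<Rightarrow> nat \<Rightarrow> real^'n \<Rightarrow> complex" where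
  "dyadic_piece a \<psi> j x =
     (if j = 0 then \<psi> x
      else \<psi> (aniso_dil a (2 powr (- real j)) x) - \<psi> (aniso_dil a (2 powr (- real j + 1)) x))"

definition freq_block ::
  "real^'n::finite \<Rightarrow> (real^'n \<Rightarrow> complex) \<Rightarrow> nat \<Rightarrow> 'n distr \<Rightarrow> real^'n \<Rightarrow> complex" where
  "freq_block a \<psi> j f =
     function_of_distr (inv_fourier_distr (mult_distr (dyadic_piece a \<psi> j) (fourier_distr f)))"

text \<open>The weight \<open>2\<^bsup>jsq\<^esup>\<close> of the defining series is written inside the \<open>q\<close>-th power as \<open>2\<^bsup>js\<^esup>\<close>,
  which covers \<open>q = \<infinity>\<close> as well.\<close>

definition besov_norm :: "real^'n::finite \<Rightarrow> (real^'n \<Rightarrow> complex) \<Rightarrow>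
    real \<Rightarrow> ereal \<Rightarrow> ereal \<Rightarrow> 'n distr \<Rightarrow> ennreal" where
  "besov_norm a \<psi> s p q f =
     lq_norm q (\<lambda>j. ennreal (2 powr (real j * s)) *
       Lp_norm p (\<lambda>x. ennreal (norm (freq_block a \<psi> j f x))))"

definition besov_space :: "real^'n::finite \<Rightarrow> (real^'n \<Rightarrow> complex) \<Rightarrow>
    real \<Rightarrow> ereal \<Rightarrow> ereal \<Rightarrow> 'n distr set" where
  "besov_space a \<psi> s p q = {f \<in> tempered_distributions. besov_norm a \<psi> s p q f < \<infinity>}"

text \<open>The Lizorkin--Triebel spaces are only meant for \<open>p < \<infinity>\<close>.\<close>

definition triebel_norm :: "real^'n::finite \<Rightarrow> (real^'n \<Rightarrow> complex) \<Rightarrow>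
    real \<Rightarrow> ereal \<Rightarrow> ereal \<Rightarrow> 'n distr \<Rightarrow> ennreal" where
  "triebel_norm a \<psi> s p q f =
     Lp_norm p (\<lambda>x. lq_norm q (\<lambda>j. ennreal (2 powr (real j * s)) *
       ennreal (norm (freq_block a \<psi> j f x))))"

definition triebel_space :: "real^'n::finite \<Rightarrow> (real^'n \<Rightarrow> complex) \<Rightarrow>
    real \<Rightarrow> ereal \<Rightarrow> ereal \<Rightarrow> 'n distr set" where
  "triebel_space a \<psi> s p q = {f \<in> tempered_distributions. triebel_norm a \<psi> s p q f < \<infinity>}"

text \<open>Continuous inclusion of linear spaces with quasi-norms \<open>N\<close> and \<open>M\<close>; the constant is finite
  and independent of the element.\<close>

definition continuously_embedded ::
  "'f set \<Rightarrow> ('f \<Rightarrow> ennreal) \<Rightarrow> 'f set \<Rightarrow> ('f \<Rightarrow> ennreal) \<Rightarrow> bool" where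
  "continuously_embedded X N Y M \<longleftrightarrow>
     X \<subseteq> Y \<and> (\<exists>C::real. \<forall>f\<in>X. M f \<le> ennreal C * N f)"

end

theory Submission
  imports Defs
begin

text \<open>
  By the compactness of the spectrum, each block \<open>f\<^sub>j\<close> of \<open>f\<close> is reproduced by convolution with a
  Schwartz kernel dilated by \<open>2\<^bsup>ja\<^esup>\<close>, and this gives for every \<open>r > 0\<close> that
  \<open>|f\<^sub>j(x)|\<^sup>r \<le> C 2\<^bsup>j|a|\<^esup> \<integral> |f\<^sub>j|\<^sup>r w\<^sub>j(\<cdot> - x)\<close> with a bounded integrable weight \<open>w\<^sub>j\<close>, hence Nikolskii's inequality.

  For the embedding of \<open>F\<close> into \<open>B\<close> (Jawerth), let \<open>b\<^sub>j = 2\<^bsup>js\<^esup>|f\<^sub>j|\<close> and \<open>g = sup\<^sub>j b\<^sub>j\<close>, so that \<open>\<parallel>g\<parallel>\<^sub>p\<close> is at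
  most the \<open>F\<close>-norm. One chooses levels \<open>\<beta>\<^sub>j\<close> such that \<open>g\<close> exceeds \<open>\<beta>\<^sub>j\<close> on a set of measure about \<open>2\<^bsup>-j|a|\<^esup>\<close>
  and \<open>\<Sum>\<^sub>j 2\<^bsup>-j|a|\<^esup> \<beta>\<^sub>j\<^sup>p \<le> C \<parallel>g\<parallel>\<^sub>p\<^sup>p\<close>. The pointwise estimate yields \<open>b\<^sub>j \<le> C \<beta>\<^sub>j\<close> everywhere, so the
  \<open>p\<^sub>1\<close>-norm of \<open>b\<^sub>j\<close> is at most \<open>C \<beta>\<^sub>j 2\<^bsup>-j|a|/p\<^sub>1\<^esup>\<close>, and summing \<open>p\<close>-th powers gives the Besov norm.

  For the embedding of \<open>B\<close> into \<open>F\<close> (Franke), replace \<open>q\<close> by a small \<open>e = p / (R + 1)\<close> and expand the power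
  \<open>(\<Sum>\<^sub>j b\<^sub>j\<^sup>e)\<^bsup>R+1\<^esup>\<close>, which is dominated by the sum over \<open>k \<le> j\<close> of \<open>b\<^sub>j\<^sup>e b\<^sub>k\<^bsup>p-e\<^esup>\<close> with weights growing slowly in
  \<open>j - k\<close>. Each of these products has an integral decaying geometrically in \<open>j - k\<close>, by Nikolskii's
  inequality for one factor and the \<open>p\<^sub>0\<close>-norms of both.
\<close>

section \<open>Calculus of smooth and Schwartz functions\<close>

text \<open>The blocks are defined by a definite description, so no estimate can start before each
  block of a functional on the Schwartz space is shown to be a unique continuous function. The
  candidate for its value at \<open>x\<close> is \<open>f\<close> applied to a translated kernel;
  the obstacle is to move \<open>f\<close> under an integral.

  Since \<open>p\<close> and \<open>p0\<close> may be less than 1, the pointwise estimate must hold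
  for small powers \<open>r\<close>, where no Hoelder inequality is available. Its proof divides by
  a power of a supremum, which has to be finite; this is why polynomial growth of the blocks is
  carried along.

  With \<open>\<rho>\<close> = 2^|a| the equalities between the smoothness exponents turn all bounds
  into powers of \<open>\<rho>\<close>, and the strict inequalities between the integrability
  exponents become geometric decay. In the first embedding \<open>e = p / (R + 1)\<close> makes the
  outer power an integer; it is taken below \<open>p0\<close>, \<open>p - p0\<close> and
  \<open>q\<close>, and replacing \<open>q\<close> by \<open>e\<close> only increases the
  quasi-norm. In the second embedding the levels depend on the number of blocks considered, which is
  harmless because only partial sums have to be bounded.\<close>

lemma vec_basis_sum: "(\<Sum>i\<in>UNIV. (h::real^'n::finite) $ i *\<^sub>R axis i 1) = h"
  using basis_expansion[of h] by (simp add: scalar_mult_eq_scaleR)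

lemma has_derivative_partial:
  assumes "f differentiable (at x)"
  shows "(f has_derivative (\<lambda>h. \<Sum>i\<in>UNIV. (h $ i) *\<^sub>R partial_deriv i f x)) (at x)"
proof -
  let ?D = "frechet_derivative f (at x)"
  have D: "(f has_derivative ?D) (at x)" using assms by (simp add: frechet_derivative_works)
  then interpret bounded_linear ?D by (rule has_derivative_bounded_linear)
  have "?D h = (\<Sum>i\<in>UNIV. (h $ i) *\<^sub>R partial_deriv i f x)" for h
  proof -
    have "?D h = ?D (\<Sum>i\<in>UNIV. h $ i *\<^sub>R axis i 1)" by (simp add: vec_basis_sum)
    also have "\<dots> = (\<Sum>i\<in>UNIV. (h $ i) *\<^sub>R ?D (axis i 1))" by (simp add: sum scaleR)
    finally show ?thesis by (simp add: partial_deriv_def)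
  qed
  then have "?D = (\<lambda>h. \<Sum>i\<in>UNIV. (h $ i) *\<^sub>R partial_deriv i f x)" by blast
  with D show ?thesis by simp
qed

lemma partial_deriv_eqI:
  assumes "(f has_derivative f') (at x)" shows "partial_deriv i f x = f' (axis i 1)"
  using frechet_derivative_at[OF assms] by (simp add: partial_deriv_def)

lemma partial_derivs_append:
  "partial_derivs (is @ js) f = partial_derivs is (partial_derivs js f)"
  by (induction "is") auto

lemma smooth_differentiable: "smooth f \<Longrightarrow> partial_derivs is f differentiable (at x)"
  by (simp add: smooth_def)

lemma smooth_differentiable0: "smooth f \<Longrightarrow> f differentiable (at x)"
  using smooth_differentiable[of f "[]"] by simp

lemma smooth_partial_derivs: "smooth f \<Longrightarrow> smooth (partial_derivs is f)"
  unfolding smooth_def by (metis partial_derivs_append)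

lemma smooth_partial_deriv: "smooth f \<Longrightarrow> smooth (partial_deriv i f)"
  using smooth_partial_derivs[of f "[i]"] by simp

lemma partial_derivs_closed:
  assumes "h \<in> X" "\<And>h i. h \<in> X \<Longrightarrow> partial_deriv i h \<in> X"
  shows "partial_derivs is h \<in> X"
  by (induction "is") (auto intro: assms)

text \<open>All iterated derivatives remain in \<open>X\<close>, so closed forms of higher
  derivatives and a Leibniz formula are avoided.\<close>

lemma smooth_coinduct:
  assumes "h \<in> X" "\<And>h x. h \<in> X \<Longrightarrow> h differentiable (at x)"
    "\<And>h i. h \<in> X \<Longrightarrow> partial_deriv i h \<in> X"
  shows "smooth h"
  unfolding smooth_def using partial_derivs_closed[of h X] assms by blast

lemma smooth_continuous: "smooth f \<Longrightarrow> continuous_on UNIV f"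
  by (meson smooth_differentiable0 differentiable_imp_continuous_within continuous_at_imp_continuous_on)

lemma smooth_borel_measurable: "smooth f \<Longrightarrow> f \<in> borel_measurable borel"
  by (intro borel_measurable_continuous_onI smooth_continuous)

lemma schwartz_iff:
  "f \<in> schwartz \<longleftrightarrow> smooth f \<and>
     (\<forall>k is. \<exists>C. \<forall>x. (1 + norm x) ^ k * norm (partial_derivs is f x) \<le> C)"
proof -
  have "bounded (range (\<lambda>x. (1 + norm x) ^ k * norm (partial_derivs is f x))) \<longleftrightarrow>
      (\<exists>C. \<forall>x. (1 + norm x) ^ k * norm (partial_derivs is f x) \<le> C)" for k "is"
    unfolding bounded_iff by (auto simp: abs_mult)
  then show ?thesis by (simp add: schwartz_def)
qed

lemma schwartz_smooth: "f \<in> schwartz \<Longrightarrow> smooth f"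
  by (simp add: schwartz_iff)

lemma schwartz_boundE:
  assumes "f \<in> schwartz"
  obtains C where "C > 0" "\<And>x. (1 + norm x) ^ k * norm (partial_derivs is f x) \<le> C"
proof -
  obtain C where C: "\<And>x. (1 + norm x) ^ k * norm (partial_derivs is f x) \<le> C"
    using assms unfolding schwartz_iff by blast
  show ?thesis by (rule that[of "\<bar>C\<bar> + 1"]) (auto intro: order_trans[OF C])
qed

lemma schwartz_boundE0:
  assumes "f \<in> schwartz"
  obtains C where "C > 0" "\<And>x. (1 + norm x) ^ k * norm (f x) \<le> C"
  using schwartz_boundE[OF assms, of k "[]"] by auto

text \<open>As \<open>X\<close> absorbs derivatives, decay of its members already controls every
  seminorm. It is applied with \<open>X\<close> the sums of products, and with \<open>X\<close> the
  image of the Fourier transform.\<close>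

lemma schwartz_coinduct:
  assumes h: "h \<in> X" and d: "\<And>h x. h \<in> X \<Longrightarrow> h differentiable (at x)"
    and p: "\<And>h i. h \<in> X \<Longrightarrow> partial_deriv i h \<in> X"
    and b: "\<And>h k. h \<in> X \<Longrightarrow> \<exists>C. \<forall>x. (1 + norm x) ^ k * norm (h x) \<le> C"
  shows "h \<in> schwartz"
  unfolding schwartz_iff
  using smooth_coinduct[OF h d p] partial_derivs_closed[OF h p] b by blast

lemma schwartz_partial_deriv: "f \<in> schwartz \<Longrightarrow> partial_deriv i f \<in> schwartz"
  unfolding schwartz_iff using smooth_partial_deriv[of f i] partial_derivs_append[of _ "[i]" f]
  by (metis partial_derivs.simps)

lemma schwartz_partial_derivs: "f \<in> schwartz \<Longrightarrow> partial_derivs is f \<in> schwartz"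
  by (rule partial_derivs_closed) (auto intro: schwartz_partial_deriv)

lemma partial_derivs_add:
  assumes "smooth f" "smooth g"
  shows "partial_derivs is (\<lambda>x. f x + g x) = (\<lambda>x. partial_derivs is f x + partial_derivs is g x)"
proof (induction "is")
  case (Cons i "is")
  show ?case
  proof (rule ext)
    fix x
    have "((\<lambda>x. partial_derivs is f x + partial_derivs is g x) has_derivative
      (\<lambda>h. (\<Sum>i\<in>UNIV. (h $ i) *\<^sub>R partial_deriv i (partial_derivs is f) x) +
           (\<Sum>i\<in>UNIV. (h $ i) *\<^sub>R partial_deriv i (partial_derivs is g) x))) (at x)"
      by (intro has_derivative_add has_derivative_partial smooth_differentiable assms)
    from partial_deriv_eqI[OF this, of i]
    show "partial_derivs (i # is) (\<lambda>x. f x + g x) x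
        = partial_derivs (i # is) f x + partial_derivs (i # is) g x"
      by (simp add: Cons.IH axis_def if_distrib[of "\<lambda>t. t *\<^sub>R _"] cong: if_cong)
  qed
qed simp

lemma partial_derivs_cmult:
  assumes "smooth f"
  shows "partial_derivs is (\<lambda>x. c * f x) = (\<lambda>x. c * partial_derivs is f x)"
proof (induction "is")
  case (Cons i "is")
  show ?case
  proof (rule ext)
    fix x
    have "((\<lambda>x. c * partial_derivs is f x) has_derivative
      (\<lambda>h. c * (\<Sum>i\<in>UNIV. (h $ i) *\<^sub>R partial_deriv i (partial_derivs is f) x))) (at x)"
      by (intro has_derivative_mult_right has_derivative_partial smooth_differentiable assms)
    from partial_deriv_eqI[OF this, of i]
    show "partial_derivs (i # is) (\<lambda>x. c * f x) x = c * partial_derivs (i # is) f x"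
      by (simp add: Cons.IH axis_def if_distrib[of "\<lambda>t. t *\<^sub>R _"] cong: if_cong)
  qed
qed simp

lemma smooth_add: "smooth f \<Longrightarrow> smooth g \<Longrightarrow> smooth (\<lambda>x. f x + g x)"
  by (simp add: smooth_def[of "\<lambda>x. f x + g x"] partial_derivs_add smooth_differentiable differentiable_add)

lemma smooth_cmult: "smooth f \<Longrightarrow> smooth (\<lambda>x. c * f x)"
  by (simp add: smooth_def[of "\<lambda>x. c * f x"] partial_derivs_cmult smooth_differentiable
      differentiable_mult)

lemma schwartz_add:
  assumes "f \<in> schwartz" "g \<in> schwartz" shows "(\<lambda>x. f x + g x) \<in> schwartz"
proof -
  have "\<exists>C. \<forall>x. (1 + norm x) ^ k * norm (partial_derivs is (\<lambda>x. f x + g x) x) \<le> C" for k "is"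
  proof -
    obtain A where A: "\<And>x. (1 + norm x) ^ k * norm (partial_derivs is f x) \<le> A"
      using schwartz_boundE[OF assms(1)] by blast
    obtain B where B: "\<And>x. (1 + norm x) ^ k * norm (partial_derivs is g x) \<le> B"
      using schwartz_boundE[OF assms(2)] by blast
    have "(1 + norm x) ^ k * norm (partial_derivs is f x + partial_derivs is g x) \<le> A + B" for x
    proof -
      have "(1 + norm x) ^ k * norm (partial_derivs is f x + partial_derivs is g x)
        \<le> (1 + norm x) ^ k * (norm (partial_derivs is f x) + norm (partial_derivs is g x))"
        by (intro mult_left_mono norm_triangle_ineq) auto
      also have "\<dots> \<le> A + B" using A[of x] B[of x] by (simp add: distrib_left)
      finally show ?thesis .
    qed
    then show ?thesis using assms by (auto simp: partial_derivs_add schwartz_smooth)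
  qed
  then show ?thesis using assms by (simp add: schwartz_iff smooth_add)
qed

lemma schwartz_cmult:
  assumes "f \<in> schwartz" shows "(\<lambda>x. c * f x) \<in> schwartz"
proof -
  have "\<exists>C. \<forall>x. (1 + norm x) ^ k * norm (partial_derivs is (\<lambda>x. c * f x) x) \<le> C" for k "is"
  proof -
    obtain A where A: "\<And>x. (1 + norm x) ^ k * norm (partial_derivs is f x) \<le> A"
      using schwartz_boundE[OF assms(1)] by blast
    have "(1 + norm x) ^ k * norm (c * partial_derivs is f x) \<le> norm c * A" for x
      using mult_left_mono[OF A[of x], of "norm c"] by (simp add: norm_mult mult_ac)
    then show ?thesis using assms by (auto simp: partial_derivs_cmult schwartz_smooth)
  qed
  then show ?thesis using assms by (simp add: schwartz_iff smooth_cmult)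
qed

lemma partial_derivs_zero: "partial_derivs is (\<lambda>x. 0) = (\<lambda>x. 0)"
proof (induction "is")
  case (Cons i "is")
  then show ?case
    by (auto intro!: ext simp: partial_deriv_eqI[OF has_derivative_const])
qed simp

lemma schwartz_zero: "(\<lambda>x. 0) \<in> schwartz"
  by (auto simp: schwartz_iff smooth_def partial_derivs_zero)

lemma schwartz_diff:
  assumes "f \<in> schwartz" "g \<in> schwartz" shows "(\<lambda>x. f x - g x) \<in> schwartz"
  using schwartz_add[OF assms(1) schwartz_cmult[OF assms(2), of "-1"]] by simp

lemma partial_derivs_diff:
  assumes "smooth f" "smooth g"
  shows "partial_derivs is (\<lambda>x. f x - g x) = (\<lambda>x. partial_derivs is f x - partial_derivs is g x)"
  using partial_derivs_add[OF assms(1) smooth_cmult[OF assms(2), of "-1"], of "is"]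
  by (simp add: partial_derivs_cmult[OF assms(2), of _ "-1", simplified])

lemma schwartz_sum:
  assumes "\<And>k. k \<in> A \<Longrightarrow> f k \<in> schwartz"
  shows "(\<lambda>x. \<Sum>k\<in>A. f k x) \<in> schwartz"
  using assms by (induction A rule: infinite_finite_induct) (auto intro: schwartz_zero schwartz_add)

lemma partial_derivs_sum:
  assumes "finite A" "\<And>k. k \<in> A \<Longrightarrow> f k \<in> schwartz"
  shows "partial_derivs is (\<lambda>x. \<Sum>k\<in>A. f k x) = (\<lambda>x. \<Sum>k\<in>A. partial_derivs is (f k) x)"
  using assms by (induction A rule: finite_induct)
    (auto simp: partial_derivs_zero partial_derivs_add schwartz_smooth schwartz_sum)

subsection \<open>Affine substitutions and conjugation\<close>

text \<open>A single family covers isotropic scalings, the reflection and the anisotropic dilations;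
  with a shift added, translations as well. The chain rule and the change of variables are thus
  proved once.\<close>

definition diag_map :: "('n \<Rightarrow> real) \<Rightarrow> real^'n::finite \<Rightarrow> real^'n" where
  "diag_map d x = (\<chi> i. d i * x $ i)"

lemma diag_map_nth [simp]: "diag_map d x $ i = d i * x $ i"
  by (simp add: diag_map_def)

lemma bounded_linear_diag_map: "bounded_linear (diag_map d)"
  by (intro linear_conv_bounded_linear[THEN iffD1] linearI) (auto simp: vec_eq_iff algebra_simps)

lemma partial_derivs_affine:
  assumes "smooth f"
  shows "partial_derivs is (\<lambda>x. f (diag_map d x + b)) =
    (\<lambda>x. of_real (\<Prod>i\<leftarrow>is. d i) * partial_derivs is f (diag_map d x + b))"
proof (induction "is")
  case (Cons i "is")
  show ?case
  proof (rule ext)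
    fix x
    have "((\<lambda>x. partial_derivs is f (diag_map d x + b)) has_derivative
      (\<lambda>h. (\<Sum>i\<in>UNIV. ((diag_map d h) $ i) *\<^sub>R partial_deriv i (partial_derivs is f) (diag_map d x + b)))) (at x)"
      by (rule has_derivative_compose[where g = "partial_derivs is f" and f = "\<lambda>x. diag_map d x + b"])
        (auto intro!: derivative_eq_intros bounded_linear_imp_has_derivative bounded_linear_diag_map
          has_derivative_partial smooth_differentiable assms)
    then have "((\<lambda>x. of_real (\<Prod>i\<leftarrow>is. d i) * partial_derivs is f (diag_map d x + b)) has_derivative
      (\<lambda>h. of_real (\<Prod>i\<leftarrow>is. d i) * (\<Sum>i\<in>UNIV. ((diag_map d h) $ i) *\<^sub>R partial_deriv i (partial_derivs is f) (diag_map d x + b)))) (at x)"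
      by (rule has_derivative_mult_right)
    from partial_deriv_eqI[OF this, of i]
    show "partial_derivs (i # is) (\<lambda>x. f (diag_map d x + b)) x =
      of_real (\<Prod>i\<leftarrow>i # is. d i) * partial_derivs (i # is) f (diag_map d x + b)"
      by (simp add: Cons.IH axis_def if_distrib[of "\<lambda>t. t *\<^sub>R _"] if_distrib[of "\<lambda>t. d _ * t"] cong: if_cong)
        (simp add: scaleR_conv_of_real)
  qed
qed simp

lemma smooth_affine:
  assumes "smooth f" shows "smooth (\<lambda>x. f (diag_map d x + b))"
proof -
  have "(\<lambda>x. of_real (\<Prod>i\<leftarrow>is. d i) * partial_derivs is f (diag_map d x + b)) differentiable at x" for "is" x
  proof -
    have "(\<lambda>x. diag_map d x + b) differentiable at x"
      by (intro differentiable_add bounded_linear_imp_differentiable[OF bounded_linear_diag_map] differentiable_const)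
    moreover have "partial_derivs is f differentiable at (diag_map d x + b)"
      by (rule smooth_differentiable[OF assms])
    ultimately have "(partial_derivs is f \<circ> (\<lambda>x. diag_map d x + b)) differentiable at x"
      by (intro differentiable_chain_at)
    then show ?thesis by (intro differentiable_mult) (auto simp: o_def)
  qed
  then show ?thesis by (simp add: smooth_def[of "\<lambda>x. f (diag_map d x + b)"] partial_derivs_affine assms)
qed

lemma diag_map_one [simp]: "diag_map (\<lambda>i. 1) x = x"
  by (simp add: vec_eq_iff)

lemma diag_map_inverse: "(\<And>i. d i \<noteq> 0) \<Longrightarrow> diag_map (\<lambda>i. inverse (d i)) (diag_map d x) = x"
  by (simp add: vec_eq_iff)

text \<open>The inverse diagonal map is bounded, so the weight at \<open>x\<close> is at most a
  constant times the weight at \<open>diag_map d x + b\<close>; the chain rule contributes only the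
  product of the entries of \<open>d\<close> along the list.\<close>

lemma schwartz_affine:
  assumes f: "f \<in> schwartz" and d: "\<And>i. d i \<noteq> 0"
  shows "(\<lambda>x. f (diag_map d x + b)) \<in> schwartz"
proof -
  have "\<exists>C. \<forall>x. (1 + norm x) ^ k * norm (partial_derivs is (\<lambda>x. f (diag_map d x + b)) x) \<le> C" for k "is"
  proof -
    obtain A where A: "A > 0" "\<And>x. (1 + norm x) ^ k * norm (partial_derivs is f x) \<le> A"
      using schwartz_boundE[OF f] by blast
    obtain B where B: "B > 0" "\<And>x. norm (diag_map (\<lambda>i. inverse (d i)) x) \<le> norm x * B"
      using bounded_linear.pos_bounded[OF bounded_linear_diag_map] by blast
    have *: "1 + norm x \<le> ((1 + B) * (1 + norm b)) * (1 + norm (diag_map d x + b))" for x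
    proof -
      have "norm x \<le> norm (diag_map d x) * B"
        using B(2)[of "diag_map d x"] d by (simp add: diag_map_inverse)
      also have "norm (diag_map d x) \<le> norm (diag_map d x + b) + norm b"
        by (metis add_diff_cancel norm_triangle_ineq4)
      finally have "norm x \<le> (norm (diag_map d x + b) + norm b) * B" using B(1) by simp
      moreover define u v where "u = norm (diag_map d x + b)" and "v = norm b"
      ultimately have "norm x \<le> B * u + B * v" by (simp add: algebra_simps)
      moreover have "0 \<le> u" "0 \<le> v" "0 \<le> B * (u * v)" "0 \<le> u * v" "0 \<le> B"
        using B(1) by (auto simp: u_def v_def)
      moreover have "(1 + B) * (1 + v) * (1 + u) = 1 + B + v + B * v + u + B * u + u * v + B * (u * v)"
        by (simp add: algebra_simps)
      ultimately show ?thesis unfolding u_def[symmetric] v_def[symmetric] by linarith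
    qed
    let ?P = "norm (complex_of_real (\<Prod>i\<leftarrow>is. d i))" and ?Q = "(1 + B) * (1 + norm b)"
    have "(1 + norm x) ^ k * (?P * norm (partial_derivs is f (diag_map d x + b))) \<le> ?P * ?Q ^ k * A" for x
    proof -
      have "(1 + norm x) ^ k \<le> (?Q * (1 + norm (diag_map d x + b))) ^ k"
        using * by (intro power_mono) auto
      then have "(1 + norm x) ^ k * (?P * norm (partial_derivs is f (diag_map d x + b)))
         \<le> (?Q * (1 + norm (diag_map d x + b))) ^ k * (?P * norm (partial_derivs is f (diag_map d x + b)))"
        by (intro mult_right_mono) auto
      also have "\<dots> = ?P * ?Q ^ k * ((1 + norm (diag_map d x + b)) ^ k * norm (partial_derivs is f (diag_map d x + b)))"
        by (simp add: power_mult_distrib)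
      also have "\<dots> \<le> ?P * ?Q ^ k * A"
        using B(1) A(2) by (intro mult_left_mono) auto
      finally show ?thesis .
    qed
    then show ?thesis
      by (auto simp: partial_derivs_affine[OF schwartz_smooth[OF f]] norm_mult)
  qed
  then show ?thesis using f by (simp add: schwartz_iff smooth_affine)
qed

lemma schwartz_translate: "f \<in> schwartz \<Longrightarrow> (\<lambda>x. f (x + b)) \<in> schwartz"
  using schwartz_affine[of f "\<lambda>i. 1"] by simp

lemma schwartz_uminus_arg:
  assumes "f \<in> schwartz" shows "(\<lambda>x. f (- x)) \<in> schwartz"
proof -
  have "diag_map (\<lambda>i. -1) x = - x" for x :: "real^'a" by (simp add: vec_eq_iff)
  then show ?thesis using schwartz_affine[OF assms, of "\<lambda>i. -1" 0] by simp
qed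

lemma partial_derivs_translate:
  "smooth f \<Longrightarrow> partial_derivs is (\<lambda>x. f (x + b)) = (\<lambda>x. partial_derivs is f (x + b))"
  using partial_derivs_affine[of f "is" "\<lambda>i. 1"] by (simp add: map_replicate_const)

lemma partial_derivs_cnj:
  assumes "smooth f"
  shows "partial_derivs is (\<lambda>x. cnj (f x)) = (\<lambda>x. cnj (partial_derivs is f x))"
proof (induction "is")
  case (Cons i "is")
  show ?case
  proof (rule ext)
    fix x
    have "((\<lambda>x. cnj (partial_derivs is f x)) has_derivative
      (\<lambda>h. cnj (\<Sum>i\<in>UNIV. (h $ i) *\<^sub>R partial_deriv i (partial_derivs is f) x))) (at x)"
      by (intro has_derivative_cnj has_derivative_partial smooth_differentiable assms)
    from partial_deriv_eqI[OF this, of i]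
    show "partial_derivs (i # is) (\<lambda>x. cnj (f x)) x = cnj (partial_derivs (i # is) f x)"
      by (simp add: Cons.IH axis_def if_distrib[of "\<lambda>t. t *\<^sub>R _"] cong: if_cong)
  qed
qed simp

lemma smooth_cnj:
  assumes f: "smooth f" shows "smooth (\<lambda>x. cnj (f x))"
  unfolding smooth_def[of "\<lambda>x. cnj (f x)"]
  unfolding smooth_def[of "\<lambda>x. cnj (f x)"]
proof (intro allI)
  fix "is" x
  show "partial_derivs is (\<lambda>x. cnj (f x)) differentiable at x"
    unfolding partial_derivs_cnj[OF f]
    using has_derivative_cnj[OF has_derivative_partial[OF smooth_differentiable[OF f]]]
    unfolding differentiable_def by blast
qed

lemma schwartz_cnj: "f \<in> schwartz \<Longrightarrow> (\<lambda>x. cnj (f x)) \<in> schwartz"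
  by (simp add: schwartz_iff smooth_cnj partial_derivs_cnj)

subsection \<open>Products\<close>

text \<open>The product rule turns a product into a sum of two products. Closing under sums makes
  the class stable under differentiation whenever both factors range over stable classes.\<close>

inductive_set product_span :: "(real^'n::finite \<Rightarrow> complex) set \<Rightarrow> (real^'n \<Rightarrow> complex) set \<Rightarrow> (real^'n \<Rightarrow> complex) set"
  for A B where
  prod: "f \<in> A \<Longrightarrow> g \<in> B \<Longrightarrow> (\<lambda>x. f x * g x) \<in> product_span A B"
| add: "f \<in> product_span A B \<Longrightarrow> g \<in> product_span A B \<Longrightarrow> (\<lambda>x. f x + g x) \<in> product_span A B"

lemma product_span_derivative:
  assumes "h \<in> product_span A B" and A: "\<And>f i. f \<in> A \<Longrightarrow> smooth f \<and> partial_deriv i f \<in> A"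
    and B: "\<And>f i. f \<in> B \<Longrightarrow> smooth f \<and> partial_deriv i f \<in> B"
  shows "(\<forall>x. h differentiable (at x)) \<and> partial_deriv i h \<in> product_span A B"
  using assms(1)
proof induction
  case (prod f g)
  have d: "f differentiable (at x)" "g differentiable (at x)" for x
    using prod A B smooth_differentiable0 by blast+
  have "partial_deriv i (\<lambda>x. f x * g x) x = f x * partial_deriv i g x + partial_deriv i f x * g x" for x
    using partial_deriv_eqI[OF has_derivative_mult[OF d[THEN has_derivative_partial]], of i x]
    by (simp add: axis_def if_distrib[of "\<lambda>t. t *\<^sub>R _"] cong: if_cong)
  then have "partial_deriv i (\<lambda>x. f x * g x) = (\<lambda>x. f x * partial_deriv i g x + partial_deriv i f x * g x)"
    by blast
  then show ?case using prod A B d by (auto intro!: product_span.intros differentiable_mult)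
next
  case (add f g)
  then have d: "f differentiable (at x)" "g differentiable (at x)" for x by auto
  have "partial_deriv i (\<lambda>x. f x + g x) x = partial_deriv i f x + partial_deriv i g x" for x
    using partial_deriv_eqI[OF has_derivative_add[OF d[THEN has_derivative_partial]], of i x]
    by (simp add: axis_def if_distrib[of "\<lambda>t. t *\<^sub>R _"] cong: if_cong)
  then have "partial_deriv i (\<lambda>x. f x + g x) = (\<lambda>x. partial_deriv i f x + partial_deriv i g x)"
    by blast
  then show ?case using add d by (auto intro!: product_span.add differentiable_add)
qed

section \<open>Multipliers of the Schwartz space\<close>

definition slowly_increasing :: "(real^'n::finite \<Rightarrow> complex) set" where
  "slowly_increasing = {f. smooth f \<and>
     (\<forall>is. \<exists>k C. \<forall>x. norm (partial_derivs is f x) \<le> C * (1 + norm x) ^ k)}"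

lemma slowly_increasing_partial_deriv:
  "f \<in> slowly_increasing \<Longrightarrow> partial_deriv i f \<in> slowly_increasing"
  unfolding slowly_increasing_def mem_Collect_eq
  using smooth_partial_deriv[of f i] partial_derivs_append[of _ "[i]" f]
  by (metis partial_derivs.simps)

lemma slowly_increasing_smooth: "f \<in> slowly_increasing \<Longrightarrow> smooth f"
  by (simp add: slowly_increasing_def)

text \<open>Growth of order \<open>m\<close> in one factor is paid for by decay of order
  \<open>k + m\<close> in the other. Coordinate functions, and Schwartz functions themselves, are
  the multipliers used below.\<close>

lemma schwartz_mult:
  assumes "f \<in> slowly_increasing" "g \<in> schwartz" shows "(\<lambda>x. f x * g x) \<in> schwartz"
proof (rule schwartz_coinduct[where X = "product_span slowly_increasing schwartz"])
  show "(\<lambda>x. f x * g x) \<in> product_span slowly_increasing schwartz"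
    by (rule product_span.prod) fact+
next
  fix h :: "real^'a \<Rightarrow> complex" and x i
  assume "h \<in> product_span slowly_increasing schwartz"
  then have "(\<forall>x. h differentiable (at x)) \<and> partial_deriv i h \<in> product_span slowly_increasing schwartz"
    by (rule product_span_derivative)
      (auto intro: schwartz_partial_deriv slowly_increasing_partial_deriv schwartz_smooth
        slowly_increasing_smooth)
  then show "h differentiable (at x)" "partial_deriv i h \<in> product_span slowly_increasing schwartz"
    by auto
next
  fix h :: "real^'a \<Rightarrow> complex" and k
  assume "h \<in> product_span slowly_increasing schwartz"
  then show "\<exists>C. \<forall>x. (1 + norm x) ^ k * norm (h x) \<le> C"
  proof induction
    case (prod f g)
    obtain m C where C: "\<And>x. norm (f x) \<le> C * (1 + norm x) ^ m"
      using prod(1) unfolding slowly_increasing_def by simp (metis partial_derivs.simps(1))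
    obtain B where B: "\<And>x. (1 + norm x) ^ (k + m) * norm (g x) \<le> B"
      using schwartz_boundE0[OF prod(2)] by blast
    have C0: "C \<ge> 0" using C[of 0] norm_ge_zero[of "f 0"] by (simp del: norm_ge_zero)
    have "(1 + norm x) ^ k * norm (f x * g x) \<le> C * B" for x
    proof -
      have "(1 + norm x) ^ k * norm (f x * g x) \<le> (1 + norm x) ^ k * (C * (1 + norm x) ^ m * norm (g x))"
        unfolding norm_mult by (intro mult_left_mono mult_right_mono C) auto
      also have "\<dots> = C * ((1 + norm x) ^ (k + m) * norm (g x))" by (simp add: power_add)
      also have "\<dots> \<le> C * B" by (intro mult_left_mono B C0)
      finally show ?thesis .
    qed
    then show ?case by blast
  next
    case (add f g)
    then obtain A B where AB: "\<And>x. (1 + norm x) ^ k * norm (f x) \<le> A" "\<And>x. (1 + norm x) ^ k * norm (g x) \<le> B"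
      by blast
    have "(1 + norm x) ^ k * norm (f x + g x) \<le> A + B" for x
    proof -
      have "(1 + norm x) ^ k * norm (f x + g x) \<le> (1 + norm x) ^ k * (norm (f x) + norm (g x))"
        by (intro mult_left_mono norm_triangle_ineq) auto
      also have "\<dots> \<le> A + B" using AB[of x] by (simp add: distrib_left)
      finally show ?thesis .
    qed
    then show ?case by blast
  qed
qed

lemma schwartz_slowly_increasing:
  assumes "f \<in> schwartz" shows "f \<in> slowly_increasing"
proof -
  have "\<exists>k C. \<forall>x. norm (partial_derivs is f x) \<le> C * (1 + norm x) ^ k" for "is"
  proof -
    obtain C where "\<And>x. (1 + norm x) ^ 0 * norm (partial_derivs is f x) \<le> C"
      using schwartz_boundE[OF assms] by blast
    then have "\<forall>x. norm (partial_derivs is f x) \<le> C * (1 + norm x) ^ 0" by simp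
    then show ?thesis by blast
  qed
  then show ?thesis using assms by (simp add: slowly_increasing_def schwartz_smooth)
qed

lemma slowly_increasing_coordinate: "(\<lambda>x. of_real (x $ i)) \<in> slowly_increasing"
proof -
  let ?f = "\<lambda>x::real^'a. complex_of_real (x $ i)"
  have D: "(?f has_derivative (\<lambda>h. of_real (h $ i))) (at x)" for x
    by (rule bounded_linear_imp_has_derivative[OF
       bounded_linear_compose[OF bounded_linear_of_real bounded_linear_vec_nth]])
  have p: "partial_deriv j ?f = (\<lambda>x. of_real (axis j 1 $ i))" for j
    using partial_deriv_eqI[OF D] by auto
  \<comment> \<open>The last entry of the list is the derivative taken first: it leaves a constant,
    which any further derivative kills.\<close>
  have q: "partial_derivs (is @ [j]) ?f = (\<lambda>x. of_real (if is = [] then axis j 1 $ i else 0))" for "is" j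
  proof (induction "is")
    case Nil
    show ?case by (simp add: p)
  next
    case (Cons k ks)
    have "partial_derivs ((k # ks) @ [j]) ?f = partial_deriv k (partial_derivs (ks @ [j]) ?f)" by simp
    also have "\<dots> = (\<lambda>x. 0)" unfolding Cons.IH
      by (rule ext, rule partial_deriv_eqI[OF has_derivative_const, THEN trans]) simp
    finally show ?case by simp
  qed
  have "partial_derivs is ?f differentiable (at x)" for "is" x
  proof (cases "is = []")
    case True
    then show ?thesis using differentiableI[OF D] by simp
  next
    case False
    then obtain ks j where isj: "is = ks @ [j]" by (cases "is" rule: rev_cases) auto
    then show ?thesis by (simp only: q differentiable_const)
  qed
  then have "smooth ?f" by (simp add: smooth_def)
  moreover have "\<exists>k C. \<forall>x. norm (partial_derivs is ?f x) \<le> C * (1 + norm x) ^ k" for "is"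
  proof (cases "is = []")
    case True
    have "\<forall>x. norm (partial_derivs is ?f x) \<le> 1 * (1 + norm x) ^ 1"
    proof
      fix x
      show "norm (partial_derivs is ?f x) \<le> 1 * (1 + norm x) ^ 1"
        using True component_le_norm_cart[of x i] by simp
    qed
    then show ?thesis by blast
  next
    case False
    then obtain ks j where isj: "is = ks @ [j]" by (cases "is" rule: rev_cases) auto
    have "\<forall>x. norm (partial_derivs is ?f x) \<le> 1 * (1 + norm x) ^ 0"
      unfolding isj q by (simp add: axis_def)
    then show ?thesis by blast
  qed
  ultimately show ?thesis by (simp add: slowly_increasing_def)
qed

text \<open>Every derivative vanishes on the open complement of the compact support, and on the
  support continuity gives the bounds.\<close>

lemma test_function_schwartz:
  assumes "test_function f" shows "f \<in> schwartz"
proof -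
  let ?K = "closure {x. f x \<noteq> 0}"
  have sm: "smooth f" and cK: "compact ?K" using assms by (auto simp: test_function_def)
  have z: "partial_derivs is f x = 0" if "x \<notin> ?K" for "is" x
    using that
  proof (induction "is" arbitrary: x)
    case Nil
    then show ?case using closure_subset[of "{x. f x \<noteq> 0}"] by auto
  next
    case (Cons i "is")
    have "((\<lambda>x. 0) has_derivative (\<lambda>h. 0)) (at x)" by (rule has_derivative_const)
    then have "(partial_derivs is f has_derivative (\<lambda>h. 0)) (at x)"
      by (rule has_derivative_transform_within_open[of _ _ x UNIV "- ?K"])
        (use Cons in \<open>auto simp: open_Compl\<close>)
    then show ?case using partial_deriv_eqI by force
  qed
  have "\<exists>C. \<forall>x. (1 + norm x) ^ k * norm (partial_derivs is f x) \<le> C" for k "is"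
  proof -
    have "continuous_on ?K (\<lambda>x. (1 + norm x) ^ k * norm (partial_derivs is f x))"
      by (intro continuous_intros continuous_on_subset[OF smooth_continuous[OF smooth_partial_derivs[OF sm]]]) auto
    from compact_imp_bounded[OF compact_continuous_image[OF this cK]]
    obtain C where C: "\<And>x. x \<in> ?K \<Longrightarrow> (1 + norm x) ^ k * norm (partial_derivs is f x) \<le> C"
      unfolding bounded_iff by (auto simp: abs_mult)
    have "(1 + norm x) ^ k * norm (partial_derivs is f x) \<le> max 0 C" for x
      using C[of x] z[of x "is"] by (cases "x \<in> ?K") auto
    then show ?thesis by blast
  qed
  then show ?thesis using sm by (simp add: schwartz_iff)
qed

section \<open>The Fourier transform on the Schwartz space\<close>

subsection \<open>Integrability of rapidly decreasing functions\<close>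

lemma mult_le_if_le_divide: "(P::real) > 0 \<Longrightarrow> a \<le> C / P * h \<Longrightarrow> P * a \<le> C * h"
  by (simp add: field_simps)

lemma le_divide_if_mult_le: "(P::real) > 0 \<Longrightarrow> P * a \<le> C \<Longrightarrow> a \<le> C / P"
  by (simp add: field_simps)

lemma dyadic_shell:
  fixes t :: real assumes "t \<ge> 1"
  obtains k :: nat where "2 ^ k \<le> t" "t < 2 ^ Suc k"
proof -
  obtain n where n: "t < 2 ^ n" using real_arch_pow[of 2 t] by auto
  define m where "m = (LEAST n. t < 2 ^ n)"
  have m: "t < 2 ^ m" unfolding m_def using n by (rule LeastI)
  then have "m \<noteq> 0" using assms by (intro notI) simp
  then obtain k where k: "m = Suc k" by (cases m) auto
  have "\<not> t < 2 ^ k" using not_less_Least[of k "\<lambda>n. t < 2 ^ n"] k by (simp add: m_def)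
  then show ?thesis using that[of k] m k by simp
qed

lemma ennreal_le_suminf: "(f k :: ennreal) \<le> (\<Sum>k. f k)"
  using sum_le_suminf[of f "{k}"] by simp

text \<open>On the shell where \<open>1 + norm x\<close> is about 2^k the weight is at most
  2^(-k(n+1)), and the shell lies in a ball of volume comparable to 2^(kn); the shells contribute a
  geometric series of ratio 1/2.\<close>

lemma nn_integral_weight_finite:
  "(\<integral>\<^sup>+x. ennreal (1 / (1 + norm (x::'a::euclidean_space)) ^ Suc DIM('a)) \<partial>lborel) < \<infinity>"
proof -
  let ?n = "DIM('a)" and ?V = "unit_ball_vol (real DIM('a))"
  let ?g = "\<lambda>k x::'a. ennreal (1 / (2 ^ k) ^ Suc ?n) * indicator (ball 0 (2 ^ Suc k)) x"
  have "ennreal (1 / (1 + norm x) ^ Suc ?n) \<le> (\<Sum>k. ?g k x)" for x :: 'a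
  proof -
    obtain k :: nat where k: "2 ^ k \<le> 1 + norm x" "1 + norm x < 2 ^ Suc k"
      using dyadic_shell[of "1 + norm x"] by auto
    have "ennreal (1 / (1 + norm x) ^ Suc ?n) \<le> ennreal (1 / (2 ^ k) ^ Suc ?n)"
      using k by (intro ennreal_leI divide_left_mono power_mono mult_pos_pos zero_less_power)
        (auto intro: add_pos_nonneg)
    also have "\<dots> = ?g k x" using k by (simp add: indicator_def)
    also have "\<dots> \<le> (\<Sum>k. ?g k x)"
      by (rule ennreal_le_suminf)
    finally show ?thesis .
  qed
  then have "(\<integral>\<^sup>+x. ennreal (1 / (1 + norm (x::'a)) ^ Suc ?n) \<partial>lborel) \<le> (\<integral>\<^sup>+x. (\<Sum>k. ?g k x) \<partial>lborel)"
    by (intro nn_integral_mono) auto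
  also have "\<dots> = (\<Sum>k. \<integral>\<^sup>+x. ?g k x \<partial>lborel)"
    by (intro nn_integral_suminf borel_measurable_times_ennreal borel_measurable_indicator) auto
  also have "\<dots> = (\<Sum>k. ennreal (?V * 2 ^ ?n * (1 / 2) ^ k))"
  proof (intro arg_cong[where f = suminf] ext)
    fix k
    have "(\<integral>\<^sup>+x. ?g k x \<partial>lborel) = ennreal (1 / (2 ^ k) ^ Suc ?n) * ennreal (?V * (2 ^ Suc k) ^ ?n)"
      by (simp add: nn_integral_cmult_indicator emeasure_ball)
    also have "\<dots> = ennreal (1 / (2 ^ k) ^ Suc ?n * (?V * (2 ^ Suc k) ^ ?n))"
      by (intro ennreal_mult[symmetric]) auto
    also have "1 / (2 ^ k) ^ Suc ?n * (?V * (2 ^ Suc k) ^ ?n) = ?V * 2 ^ ?n * (1 / 2) ^ k"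
      by (simp add: power_mult_distrib field_simps)
    finally show "(\<integral>\<^sup>+x. ?g k x \<partial>lborel) = ennreal (?V * 2 ^ ?n * (1 / 2) ^ k)" .
  qed
  also have "\<dots> < \<infinity>"
  proof -
    have "summable (\<lambda>k. ?V * 2 ^ ?n * (1 / 2) ^ k)"
      by (intro summable_mult summable_geometric) auto
    then have "(\<Sum>k. ennreal (?V * 2 ^ ?n * (1 / 2) ^ k)) \<noteq> top"
      by (rule ennreal_suminf_neq_top) auto
    then show ?thesis by (simp add: less_top)
  qed
  finally show ?thesis .
qed

lemma integrable_weight:
  "integrable lborel (\<lambda>x::'a::euclidean_space. 1 / (1 + norm x) ^ Suc DIM('a))"
proof (rule integrableI_nonneg)
  show "(\<lambda>x::'a. 1 / (1 + norm x) ^ Suc DIM('a)) \<in> borel_measurable lborel" by measurable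
qed (use nn_integral_weight_finite in auto)

lemma integrable_decay:
  fixes g :: "real^'n::finite \<Rightarrow> 'b::{banach, second_countable_topology}"
  assumes [measurable]: "g \<in> borel_measurable borel"
    and "\<And>x. (1 + norm x) ^ Suc CARD('n) * norm (g x) \<le> C"
  shows "integrable lborel g"
proof (rule Bochner_Integration.integrable_bound[of lborel "\<lambda>x. C * (1 / (1 + norm x) ^ Suc DIM(real^'n))"])
  show "integrable lborel (\<lambda>x::real^'n. C * (1 / (1 + norm x) ^ Suc DIM(real^'n)))"
    by (intro integrable_mult_right integrable_weight)
  show "AE x in lborel. norm (g x) \<le> norm (C * (1 / (1 + norm x) ^ Suc DIM(real^'n)))"
  proof (intro AE_I2)
    fix x :: "real^'n"
    have "norm (g x) \<le> C / (1 + norm x) ^ Suc CARD('n)"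
      using assms(2)[of x] by (subst pos_le_divide_eq) (auto simp: mult.commute add_pos_nonneg)
    also have "\<dots> \<le> \<bar>C / (1 + norm x) ^ Suc CARD('n)\<bar>" by (rule abs_ge_self)
    also have "\<dots> = norm (C * (1 / (1 + norm x) ^ Suc DIM(real^'n)))" by simp
    finally show "norm (g x) \<le> norm (C * (1 / (1 + norm x) ^ Suc DIM(real^'n)))" .
  qed
qed simp

lemma schwartz_measurable [measurable_dest]: "f \<in> schwartz \<Longrightarrow> f \<in> borel_measurable borel"
  by (simp add: schwartz_smooth smooth_borel_measurable)

lemma schwartz_continuous: "f \<in> schwartz \<Longrightarrow> continuous_on UNIV f"
  by (simp add: schwartz_smooth smooth_continuous)

lemma schwartz_weight_integrable:
  assumes "f \<in> schwartz"
  shows "integrable lborel (\<lambda>x. (1 + norm x) ^ k * norm (f x))"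
proof -
  obtain C where C: "\<And>x. (1 + norm x) ^ (Suc CARD('a) + k) * norm (f x) \<le> C"
    using schwartz_boundE0[OF assms] by blast
  have [measurable]: "f \<in> borel_measurable borel" using assms by measurable
  show ?thesis
  proof (rule integrable_decay)
    fix x :: "real^'a"
    show "(1 + norm x) ^ Suc CARD('a) * norm ((1 + norm x) ^ k * norm (f x)) \<le> C"
      using C[of x] by (simp add: power_add abs_mult mult_ac)
  qed measurable
qed

lemma schwartz_integrable: "f \<in> schwartz \<Longrightarrow> integrable lborel f"
proof -
  assume f: "f \<in> schwartz"
  then have [measurable]: "f \<in> borel_measurable borel" by measurable
  show ?thesis
    using schwartz_weight_integrable[OF f, of 0] by (simp add: integrable_norm_iff)
qed

lemma integrable_cis_mult:
  assumes "integrable lborel f"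
  shows "integrable lborel (\<lambda>x. cis (x \<bullet> (\<xi>::real^'n::finite)) * f x)"
    "integrable lborel (\<lambda>x. cis (- (x \<bullet> \<xi>)) * f x)"
  using assms
  by (auto intro!: Bochner_Integration.integrable_bound[OF assms] simp: norm_mult cis_conv_exp)

subsection \<open>Linear change of variables\<close>

lemma lborel_diag_map:
  assumes "\<And>i. d i \<noteq> 0"
  shows "(lborel :: (real^'n::finite) measure) =
    density (distr lborel borel (\<lambda>x. diag_map d x + b)) (\<lambda>_. ennreal (\<Prod>i\<in>UNIV. \<bar>d i\<bar>))"
proof -
  \<comment> \<open>The affine substitution for \<open>lborel\<close> takes its factors indexed by
    basis vectors; this function returns \<open>d i\<close> at \<open>axis i 1\<close>.\<close>
  define c where "c = (\<lambda>j::real^'n. \<Sum>i\<in>UNIV. d i * j $ i)"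
  have c: "c (axis i 1) = d i" for i
    by (simp add: c_def axis_def if_distrib[of "\<lambda>t. d _ * t"] cong: if_cong)
  have B: "(Basis :: (real^'n) set) = range (\<lambda>i. axis i 1)" by (auto simp: Basis_vec_def)
  have inj: "inj (\<lambda>i. axis i 1 :: real^'n)" by (auto simp: inj_on_def axis_eq_axis)
  have T: "b + (\<Sum>j\<in>Basis. (c j * (x \<bullet> j)) *\<^sub>R j) = diag_map d x + b" for x
  proof -
    have "(\<Sum>j\<in>Basis. (c j * (x \<bullet> j)) *\<^sub>R j) = (\<Sum>i\<in>UNIV. (d i * x $ i) *\<^sub>R axis i 1)"
      unfolding B by (subst sum.reindex[OF inj]) (simp add: c inner_axis)
    also have "\<dots> = diag_map d x" using vec_basis_sum[of "diag_map d x"] by simp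
    finally show ?thesis by simp
  qed
  have P: "(\<Prod>j\<in>Basis. \<bar>c j\<bar>) = (\<Prod>i\<in>UNIV. \<bar>d i\<bar>)"
    unfolding B by (subst prod.reindex[OF inj]) (simp add: c)
  have "c j \<noteq> 0" if "j \<in> Basis" for j using that assms unfolding B by (auto simp: c)
  from lborel_affine_euclidean[of c b, OF this] show ?thesis unfolding T P .
qed

lemma nn_integral_diag_map:
  assumes d: "\<And>i. d i \<noteq> 0" and [measurable]: "f \<in> borel_measurable borel"
  shows "(\<integral>\<^sup>+x. f x \<partial>lborel) = ennreal (\<Prod>i\<in>UNIV. \<bar>d i\<bar>) * (\<integral>\<^sup>+x. f (diag_map d x + b) \<partial>lborel)"
proof -
  have [measurable]: "(\<lambda>x. diag_map d x + b) \<in> borel_measurable borel"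
    by (intro borel_measurable_continuous_onI continuous_intros linear_continuous_on bounded_linear_diag_map)
  have "(\<integral>\<^sup>+x. f x \<partial>lborel) = (\<integral>\<^sup>+x. f x \<partial>density (distr lborel borel (\<lambda>x. diag_map d x + b)) (\<lambda>_. ennreal (\<Prod>i\<in>UNIV. \<bar>d i\<bar>)))"
    using lborel_diag_map[of d b] d by simp
  also have "\<dots> = ennreal (\<Prod>i\<in>UNIV. \<bar>d i\<bar>) * (\<integral>\<^sup>+x. f (diag_map d x + b) \<partial>lborel)"
    by (simp add: nn_integral_density nn_integral_distr nn_integral_cmult)
  finally show ?thesis .
qed

lemma integral_diag_map:
  fixes f :: "real^'n::finite \<Rightarrow> 'b::{banach, second_countable_topology}"
  assumes d: "\<And>i. d i \<noteq> 0" and [measurable]: "f \<in> borel_measurable borel"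
  shows "(LINT x|lborel. f x) = (\<Prod>i\<in>UNIV. \<bar>d i\<bar>) *\<^sub>R (LINT x|lborel. f (diag_map d x + b))"
proof -
  have [measurable]: "(\<lambda>x. diag_map d x + b) \<in> borel_measurable borel"
    by (intro borel_measurable_continuous_onI continuous_intros linear_continuous_on bounded_linear_diag_map)
  have "(LINT x|lborel. f x) = (LINT x|density (distr lborel borel (\<lambda>x. diag_map d x + b)) (\<lambda>_. ennreal (\<Prod>i\<in>UNIV. \<bar>d i\<bar>)). f x)"
    using lborel_diag_map[of d b] d by simp
  also have "\<dots> = (\<Prod>i\<in>UNIV. \<bar>d i\<bar>) *\<^sub>R (LINT x|lborel. f (diag_map d x + b))"
    by (subst integral_density) (auto simp: integral_distr prod_nonneg)
  finally show ?thesis .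
qed

lemma integral_translate:
  fixes f :: "real^'n::finite \<Rightarrow> 'b::{banach, second_countable_topology}"
  assumes "f \<in> borel_measurable borel"
  shows "(LINT x|lborel. f (x + b)) = (LINT x|lborel. f x)"
  using integral_diag_map[of "\<lambda>i. 1" f b] assms by simp

lemma integral_uminus:
  fixes f :: "real^'n::finite \<Rightarrow> 'b::{banach, second_countable_topology}"
  assumes "f \<in> borel_measurable borel"
  shows "(LINT x|lborel. f (- x)) = (LINT x|lborel. f x)"
proof -
  have "diag_map (\<lambda>i. -1) x = - x" for x :: "real^'n" by (simp add: vec_eq_iff)
  then show ?thesis using integral_diag_map[of "\<lambda>i. -1" f 0] assms by simp
qed

lemma integrable_diag_map:
  fixes f :: "real^'n::finite \<Rightarrow> 'b::{banach, second_countable_topology}"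
  assumes d: "\<And>i. d i \<noteq> 0" and f: "integrable lborel f"
  shows "integrable lborel (\<lambda>x. f (diag_map d x + b))"
proof (rule integrableI_bounded)
  have [measurable]: "(\<lambda>x. diag_map d x + b) \<in> borel_measurable borel"
    by (intro borel_measurable_continuous_onI continuous_intros linear_continuous_on bounded_linear_diag_map)
  have m [measurable]: "f \<in> borel_measurable borel" using f by auto
  show "(\<lambda>x. f (diag_map d x + b)) \<in> borel_measurable lborel" by measurable
  have "ennreal (\<Prod>i\<in>UNIV. \<bar>d i\<bar>) * (\<integral>\<^sup>+x. norm (f (diag_map d x + b)) \<partial>lborel) < \<infinity>"
    using nn_integral_diag_map[of d "\<lambda>x. norm (f x)" b] d f m by (simp add: integrable_iff_bounded)
  moreover have "(\<Prod>i\<in>UNIV. \<bar>d i\<bar>) \<noteq> 0" "(\<Prod>i\<in>UNIV. \<bar>d i\<bar>) \<ge> 0" using d by (auto intro: prod_nonneg)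
  then have "ennreal (\<Prod>i\<in>UNIV. \<bar>d i\<bar>) \<noteq> 0" by (simp only: ennreal_eq_0_iff)
  ultimately show "(\<integral>\<^sup>+x. norm (f (diag_map d x + b)) \<partial>lborel) < \<infinity>"
    unfolding infinity_ennreal_def ennreal_mult_less_top by (elim disjE conjE) simp_all
qed

subsection \<open>The Fourier transform maps the Schwartz space into itself\<close>

lemma cis_second_order: "norm (cis (a + b) - cis a - \<i> * of_real b * cis a) \<le> b\<^sup>2"
proof -
  have "norm (cis (a + b) - cis a - \<i> * of_real b * cis a) = norm (cis a * (cis b - 1 - \<i> * of_real b))"
    by (simp add: cis_mult[symmetric] algebra_simps)
  also have "\<dots> = norm (iexp b - (\<Sum>k\<le>1. (\<i> * of_real b) ^ k / fact k))"
    by (simp add: norm_mult cis_conv_exp diff_diff_eq)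
  also have "\<dots> \<le> \<bar>b\<bar> ^ Suc 1 / fact (Suc 1)" by (rule iexp_approx1)
  also have "\<dots> \<le> b\<^sup>2" by (simp add: power2_eq_square)
  finally show ?thesis .
qed

lemma schwartz_coordinate_mult: "f \<in> schwartz \<Longrightarrow> (\<lambda>x. - \<i> * of_real (x $ i) * f x) \<in> schwartz"
  using schwartz_cmult[OF schwartz_mult[OF slowly_increasing_coordinate[of i]], of f "- \<i>"]
  by (simp add: mult.assoc)

lemma inner_vec_sum: "(x::real^'n::finite) \<bullet> y = (\<Sum>i\<in>UNIV. x $ i * y $ i)"
  by (simp add: inner_vec_def)

text \<open>The second-order remainder of the exponential is at most the square of
  \<open>x \<bullet> (y - \<xi>)\<close>, so the linearisation error is at most \<open>C\<close>
  times the squared distance, with \<open>C\<close> a weighted integral of \<open>f\<close>. No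
  limit has to be exchanged with an integral.\<close>

lemma fourier_has_derivative:
  assumes f: "f \<in> schwartz"
  shows "(fourier f has_derivative
    (\<lambda>h. \<Sum>i\<in>UNIV. (h $ i) *\<^sub>R fourier (\<lambda>x. - \<i> * of_real (x $ i) * f x) \<xi>)) (at \<xi>)"
proof -
  let ?D = "\<lambda>h::real^'a. \<Sum>i\<in>UNIV. (h $ i) *\<^sub>R fourier (\<lambda>x. - \<i> * of_real (x $ i) * f x) \<xi>"
  have [measurable]: "f \<in> borel_measurable borel" using f by measurable
  note int = integrable_cis_mult(2)[OF schwartz_integrable[OF f]]
    integrable_cis_mult(2)[OF schwartz_integrable[OF schwartz_coordinate_mult[OF f]]]
  have D: "?D h = (LINT x|lborel. - (cis (- (x \<bullet> \<xi>)) * (\<i> * of_real (x \<bullet> h) * f x)))"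
    and Di: "integrable lborel (\<lambda>x. - (cis (- (x \<bullet> \<xi>)) * (\<i> * of_real (x \<bullet> h) * f x)))" for h
  proof -
    have eq: "(\<Sum>i\<in>UNIV. (h $ i) *\<^sub>R (cis (- (x \<bullet> \<xi>)) * (- \<i> * of_real (x $ i) * f x)))
       = - (cis (- (x \<bullet> \<xi>)) * (\<i> * of_real (x \<bullet> h) * f x))" for x
      unfolding inner_vec_sum[of x h]
      by (simp add: scaleR_conv_of_real sum_distrib_left sum_distrib_right sum_negf mult_ac)
    have "?D h = (\<Sum>i\<in>UNIV. LINT x|lborel. (h $ i) *\<^sub>R (cis (- (x \<bullet> \<xi>)) * (- \<i> * of_real (x $ i) * f x)))"
      by (simp add: fourier_def)
    also have "\<dots> = (LINT x|lborel. (\<Sum>i\<in>UNIV. (h $ i) *\<^sub>R (cis (- (x \<bullet> \<xi>)) * (- \<i> * of_real (x $ i) * f x))))"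
      by (intro Bochner_Integration.integral_sum[symmetric] integrable_scaleR_right int)
    finally show "?D h = (LINT x|lborel. - (cis (- (x \<bullet> \<xi>)) * (\<i> * of_real (x \<bullet> h) * f x)))"
      unfolding eq .
    have "integrable lborel (\<lambda>x. \<Sum>i\<in>UNIV. (h $ i) *\<^sub>R (cis (- (x \<bullet> \<xi>)) * (- \<i> * of_real (x $ i) * f x)))"
      by (intro Bochner_Integration.integrable_sum integrable_scaleR_right int)
    then show "integrable lborel (\<lambda>x. - (cis (- (x \<bullet> \<xi>)) * (\<i> * of_real (x \<bullet> h) * f x)))"
      unfolding eq .
  qed
  define C where "C = (LINT x|lborel. (1 + norm x) ^ 2 * norm (f x))"
  have bound: "norm (fourier f y - fourier f \<xi> - ?D (y - \<xi>)) \<le> C * (norm (y - \<xi>))\<^sup>2" for y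
  proof -
    have "fourier f y - fourier f \<xi> - ?D (y - \<xi>) = (LINT x|lborel. cis (- (x \<bullet> y)) * f x - cis (- (x \<bullet> \<xi>)) * f x
       - - (cis (- (x \<bullet> \<xi>)) * (\<i> * of_real (x \<bullet> (y - \<xi>)) * f x)))"
      unfolding D unfolding fourier_def using int(1) Di by simp
    also have "norm \<dots> \<le> (LINT x|lborel. (norm (y - \<xi>))\<^sup>2 * ((1 + norm x) ^ 2 * norm (f x)))"
    proof (rule Bochner_Integration.integral_norm_bound_integral)
      show "integrable lborel (\<lambda>x. cis (- (x \<bullet> y)) * f x - cis (- (x \<bullet> \<xi>)) * f x
       - - (cis (- (x \<bullet> \<xi>)) * (\<i> * of_real (x \<bullet> (y - \<xi>)) * f x)))"
        by (intro Bochner_Integration.integrable_diff int(1) Di)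
      show "integrable lborel (\<lambda>x. (norm (y - \<xi>))\<^sup>2 * ((1 + norm x) ^ 2 * norm (f x)))"
        by (intro integrable_mult_right schwartz_weight_integrable f)
      fix x
      let ?a = "- (x \<bullet> \<xi>)" and ?b = "- (x \<bullet> (y - \<xi>))"
      have "cis (- (x \<bullet> y)) * f x - cis (- (x \<bullet> \<xi>)) * f x
       - - (cis (- (x \<bullet> \<xi>)) * (\<i> * of_real (x \<bullet> (y - \<xi>)) * f x)) =
        (cis (?a + ?b) - cis ?a - \<i> * of_real ?b * cis ?a) * f x"
        by (simp add: inner_diff_right algebra_simps)
      also have "norm \<dots> \<le> ?b\<^sup>2 * norm (f x)"
        unfolding norm_mult by (intro mult_right_mono cis_second_order) auto
      also have "?b\<^sup>2 \<le> (norm x * norm (y - \<xi>))\<^sup>2"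
        using Cauchy_Schwarz_ineq2[of x "y - \<xi>"] by (simp add: abs_le_square_iff[symmetric])
      also have "(norm x * norm (y - \<xi>))\<^sup>2 * norm (f x) \<le> ((1 + norm x) * norm (y - \<xi>))\<^sup>2 * norm (f x)"
        by (intro mult_right_mono power_mono) auto
      finally show "norm (cis (- (x \<bullet> y)) * f x - cis (- (x \<bullet> \<xi>)) * f x
       - - (cis (- (x \<bullet> \<xi>)) * (\<i> * of_real (x \<bullet> (y - \<xi>)) * f x))) \<le> (norm (y - \<xi>))\<^sup>2 * ((1 + norm x) ^ 2 * norm (f x))"
        by (simp add: power_mult_distrib mult_ac mult_right_mono)
    qed
    also have "\<dots> = C * (norm (y - \<xi>))\<^sup>2" by (simp add: C_def)
    finally show ?thesis .
  qed
  show ?thesis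
  proof (rule has_derivativeI_sandwich[of 1])
    show "bounded_linear ?D"
      by (intro bounded_linear_sum bounded_linear_scaleR_const bounded_linear_vec_nth)
    show "((\<lambda>y. C * norm (y - \<xi>)) \<longlongrightarrow> 0) (at \<xi>)"
      by (auto intro!: tendsto_eq_intros)
    fix y assume "y \<noteq> \<xi>"
    then show "norm (fourier f y - fourier f \<xi> - ?D (y - \<xi>)) / norm (y - \<xi>) \<le> C * norm (y - \<xi>)"
      using bound[of y] by (subst pos_divide_le_eq) (auto simp: power2_eq_square mult.assoc)
  qed simp
qed

lemma fourier_partial_deriv:
  assumes "f \<in> schwartz"
  shows "partial_deriv i (fourier f) = fourier (\<lambda>x. - \<i> * of_real (x $ i) * f x)"
proof
  fix \<xi>
  show "partial_deriv i (fourier f) \<xi> = fourier (\<lambda>x. - \<i> * of_real (x $ i) * f x) \<xi>"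
    using partial_deriv_eqI[OF fourier_has_derivative[OF assms, of \<xi>], of i]
    by (simp add: axis_def if_distrib[of "\<lambda>t. t *\<^sub>R _"] cong: if_cong)
qed

lemma fourier_translate:
  assumes "f \<in> borel_measurable borel"
  shows "fourier (\<lambda>x. f (x + b)) \<xi> = cis (b \<bullet> \<xi>) * fourier f \<xi>"
proof -
  have [measurable]: "f \<in> borel_measurable borel" by fact
  have "fourier (\<lambda>x. f (x + b)) \<xi> = (LINT x|lborel. cis (b \<bullet> \<xi>) * (cis (- ((x + b) \<bullet> \<xi>)) * f (x + b)))"
    unfolding fourier_def by (simp add: cis_mult inner_add_left flip: mult.assoc)
  also have "\<dots> = (LINT x|lborel. cis (b \<bullet> \<xi>) * (cis (- (x \<bullet> \<xi>)) * f x))"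
    by (rule integral_translate[of "\<lambda>x. cis (b \<bullet> \<xi>) * (cis (- (x \<bullet> \<xi>)) * f x)"])
      (simp add: cis_conv_exp)
  finally show ?thesis by (simp add: fourier_def)
qed

text \<open>Mean value inequality on the ball of radius \<open>norm h\<close>: as
  \<open>norm h\<close> is at most 1, the weight at the centre exceeds the weight at any point of
  the ball by a factor of at most \<open>2 ^ k\<close>. The bound serves as a majorant of difference
  quotients and measures the oscillation in Riemann sums of translates.\<close>

lemma schwartz_lipschitz:
  assumes f: "f \<in> schwartz"
  obtains C where "C > 0" "\<And>x h. norm h \<le> 1 \<Longrightarrow> (1 + norm x) ^ k * norm (f (x + h) - f x) \<le> C * norm h"
proof -
  have "\<forall>i. \<exists>C. C > 0 \<and> (\<forall>x. (1 + norm x) ^ k * norm (partial_deriv i f x) \<le> C)"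
  proof
    fix i
    show "\<exists>C. C > 0 \<and> (\<forall>x. (1 + norm x) ^ k * norm (partial_deriv i f x) \<le> C)"
      by (rule schwartz_boundE0[OF schwartz_partial_deriv[OF f], of k i]) (intro exI conjI allI)
  qed
  from choice[OF this] obtain B where
    "\<forall>i. B i > 0 \<and> (\<forall>x. (1 + norm x) ^ k * norm (partial_deriv i f x) \<le> B i)" ..
  then have B: "\<And>i. B i > 0" "\<And>i x. (1 + norm x) ^ k * norm (partial_deriv i f x) \<le> B i"
    by simp_all
  define C where "C = 2 ^ k * (\<Sum>i\<in>UNIV. B i)"
  show ?thesis
  proof (rule that[of C])
    show "C > 0" unfolding C_def using B(1) by (intro mult_pos_pos sum_pos) auto
    fix x h :: "real^'a" assume h: "norm h \<le> 1"
    have pos: "(1 + norm x) ^ k > 0" by (simp add: add_pos_nonneg)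
    have "norm (f (x + h) - f x) \<le> C / (1 + norm x) ^ k * norm ((x + h) - x)"
    proof (rule differentiable_bound[where f = f and x = "x + h" and y = x and S = "cball x (norm h)" and
        f' = "\<lambda>z h. \<Sum>i\<in>UNIV. (h $ i) *\<^sub>R partial_deriv i f z"])
      fix z assume z: "z \<in> cball x (norm h)"
      show "(f has_derivative (\<lambda>h. \<Sum>i\<in>UNIV. (h $ i) *\<^sub>R partial_deriv i f z)) (at z within cball x (norm h))"
        by (rule has_derivative_at_withinI[OF has_derivative_partial[OF smooth_differentiable0[OF schwartz_smooth[OF f]]]])
      show "onorm (\<lambda>h. \<Sum>i\<in>UNIV. (h $ i) *\<^sub>R partial_deriv i f z) \<le> C / (1 + norm x) ^ k"
      proof (rule onorm_bound)
        show "0 \<le> C / (1 + norm x) ^ k" using \<open>C > 0\<close> by simp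
        fix v :: "real^'a"
        have "norm x \<le> norm z + norm (x - z)" by (rule norm_triangle_sub)
        moreover have "norm (x - z) \<le> 1" using z h by (simp add: dist_norm)
        ultimately have "norm x \<le> norm z + 1" "0 \<le> norm z" by auto
        then have "1 + norm x \<le> 2 * (1 + norm z)" by argo
        then have le: "(1 + norm x) ^ k \<le> 2 ^ k * (1 + norm z) ^ k"
          unfolding power_mult_distrib[symmetric] by (intro power_mono) auto
        have "(1 + norm x) ^ k * norm (\<Sum>i\<in>UNIV. (v $ i) *\<^sub>R partial_deriv i f z) \<le>
            (1 + norm x) ^ k * (\<Sum>i\<in>UNIV. norm v * norm (partial_deriv i f z))"
          by (intro mult_left_mono sum_norm_le)
            (simp_all add: mult_right_mono[OF component_le_norm_cart])
        also have "\<dots> = norm v * (\<Sum>i\<in>UNIV. (1 + norm x) ^ k * norm (partial_deriv i f z))"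
          by (simp add: sum_distrib_left mult_ac)
        also have "\<dots> \<le> norm v * (\<Sum>i\<in>UNIV. 2 ^ k * B i)"
        proof (intro mult_left_mono sum_mono)
          fix i
          have "(1 + norm x) ^ k * norm (partial_deriv i f z) \<le> 2 ^ k * ((1 + norm z) ^ k * norm (partial_deriv i f z))"
            using mult_right_mono[OF le, of "norm (partial_deriv i f z)"] by (simp add: mult_ac)
          also have "\<dots> \<le> 2 ^ k * B i" using B(2)[of z i] by simp
          finally show "(1 + norm x) ^ k * norm (partial_deriv i f z) \<le> 2 ^ k * B i" .
        qed auto
        also have "norm v * (\<Sum>i\<in>UNIV. 2 ^ k * B i) = C * norm v" unfolding C_def sum_distrib_left[symmetric] by (rule mult.commute)
        finally show "norm (\<Sum>i\<in>UNIV. (v $ i) *\<^sub>R partial_deriv i f z) \<le> C / (1 + norm x) ^ k * norm v"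
          using le_divide_if_mult_le[OF pos] by simp
      qed
    qed (auto simp: dist_norm)
    then show "(1 + norm x) ^ k * norm (f (x + h) - f x) \<le> C * norm h"
      by (intro mult_le_if_le_divide[OF pos]) simp
  qed
qed

lemma difference_quotient_tendsto:
  fixes g :: "real \<Rightarrow> 'a::real_normed_vector"
  assumes "(g has_derivative (\<lambda>s. s *\<^sub>R d)) (at 0)"
  shows "((\<lambda>s. (g s - g 0) /\<^sub>R s) \<longlongrightarrow> d) (at 0)"
proof -
  have "((\<lambda>h. norm (g (0 + h) - g 0 - h *\<^sub>R d) / norm h) \<longlongrightarrow> 0) (at 0)"
    using assms unfolding has_derivative_at by blast
  then have "((\<lambda>h. norm ((g h - g 0) /\<^sub>R h - d)) \<longlongrightarrow> 0) (at 0)"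
  proof (rule Lim_transform_eventually)
    have "norm (g (0 + h) - g 0 - h *\<^sub>R d) / norm h = norm ((g h - g 0) /\<^sub>R h - d)" if "h \<noteq> 0" for h
    proof -
      have "(g h - g 0) /\<^sub>R h - d = (g (0 + h) - g 0 - h *\<^sub>R d) /\<^sub>R h"
        using that by (simp add: scaleR_diff_right)
      then show ?thesis by (simp add: divide_inverse mult.commute)
    qed
    then show "\<forall>\<^sub>F h in at 0. norm (g (0 + h) - g 0 - h *\<^sub>R d) / norm h = norm ((g h - g 0) /\<^sub>R h - d)"
      by (auto simp: eventually_at_filter)
  qed
  then show ?thesis by (simp add: tendsto_norm_zero_iff LIM_zero_iff)
qed

text \<open>Instead of integrating by parts, difference quotients along the axis are transformed.
  Translation becomes multiplication by a character, whose difference quotient at 0 is explicit,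
  while dominated convergence handles the side of \<open>partial_deriv i f\<close>.\<close>

lemma fourier_of_partial_deriv:
  fixes f :: "real^'n::finite \<Rightarrow> complex"
  assumes f: "f \<in> schwartz"
  shows "fourier (partial_deriv i f) \<xi> = \<i> * of_real (\<xi> $ i) * fourier f \<xi>"
proof -
  let ?e = "axis i 1 :: real^'n"
  define t where "t m = inverse (real (Suc m))" for m
  have t0: "t m > 0" "t m \<le> 1" for m by (auto simp: t_def inverse_le_1_iff)
  have tl: "t \<longlonglongrightarrow> 0" unfolding t_def by (rule LIMSEQ_inverse_real_of_nat)
  have tl': "filterlim t (at 0) sequentially"
    unfolding filterlim_at using tl t0 by (auto simp: less_imp_neq[symmetric])
  let ?g = "\<lambda>m x. (f (x + t m *\<^sub>R ?e) - f x) /\<^sub>R t m"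
  have [measurable]: "f \<in> borel_measurable borel" "partial_deriv i f \<in> borel_measurable borel"
    using f schwartz_partial_deriv[OF f] by measurable
  obtain C where C: "C > 0" "\<And>x h. norm h \<le> 1 \<Longrightarrow> (1 + norm x) ^ Suc CARD('n) * norm (f (x + h) - f x) \<le> C * norm h"
    using schwartz_lipschitz[OF f] by blast
  have pt: "(\<lambda>m. ?g m x) \<longlonglongrightarrow> partial_deriv i f x" for x
  proof -
    have "((\<lambda>s. f (x + s *\<^sub>R ?e)) has_derivative (\<lambda>s. s *\<^sub>R partial_deriv i f x)) (at 0)"
    proof -
      have "(f has_derivative (\<lambda>h. \<Sum>j\<in>UNIV. (h $ j) *\<^sub>R partial_deriv j f x)) (at (x + 0 *\<^sub>R ?e))"
        using has_derivative_partial[OF smooth_differentiable0[OF schwartz_smooth[OF f]], of x] by simp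
      moreover have "((\<lambda>s. x + s *\<^sub>R ?e) has_derivative (\<lambda>s. s *\<^sub>R ?e)) (at 0)"
        by (auto intro!: derivative_eq_intros)
      ultimately have "((\<lambda>s. f (x + s *\<^sub>R ?e)) has_derivative (\<lambda>s. \<Sum>j\<in>UNIV. ((s *\<^sub>R ?e) $ j) *\<^sub>R partial_deriv j f x)) (at 0)"
        by (intro has_derivative_compose[where f = "\<lambda>s. x + s *\<^sub>R ?e" and g = f])
      then show ?thesis
        by (simp add: axis_def if_distrib[of "\<lambda>t. t *\<^sub>R _"] if_distrib[of "\<lambda>t. _ * t"] cong: if_cong)
    qed
    from filterlim_compose[OF difference_quotient_tendsto[OF this] tl'] show ?thesis by simp
  qed
  have lim1: "(\<lambda>m. LINT x|lborel. cis (- (x \<bullet> \<xi>)) * ?g m x) \<longlonglongrightarrow> (LINT x|lborel. cis (- (x \<bullet> \<xi>)) * partial_deriv i f x)"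
  proof (rule integral_dominated_convergence)
    show "integrable lborel (\<lambda>x::real^'n. C * (1 / (1 + norm x) ^ Suc DIM(real^'n)))"
      by (intro integrable_mult_right integrable_weight)
    show "AE x in lborel. (\<lambda>m. cis (- (x \<bullet> \<xi>)) * ?g m x) \<longlonglongrightarrow> cis (- (x \<bullet> \<xi>)) * partial_deriv i f x"
      by (intro AE_I2 tendsto_mult tendsto_const pt)
    fix m
    have "norm (cis (- (x \<bullet> \<xi>)) * ?g m x) \<le> C * (1 / (1 + norm x) ^ Suc DIM(real^'n))" for x
    proof -
      have pos: "(1 + norm x) ^ Suc CARD('n) > 0" by (intro zero_less_power add_pos_nonneg) auto
      have "(1 + norm x) ^ Suc CARD('n) * norm (f (x + t m *\<^sub>R ?e) - f x) \<le> C * t m"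
        using C(2)[of "t m *\<^sub>R ?e" x] t0[of m] by simp
      from mult_left_mono[OF this, of "inverse (t m)"] t0[of m]
      have "(1 + norm x) ^ Suc CARD('n) * norm (?g m x) \<le> C" by (simp add: mult_ac)
      from le_divide_if_mult_le[OF pos this] show ?thesis by (simp add: norm_mult)
    qed
    then show "AE x in lborel. norm (cis (- (x \<bullet> \<xi>)) * ?g m x) \<le> C * (1 / (1 + norm x) ^ Suc DIM(real^'n))"
      by (intro AE_I2)
  qed (simp_all add: cis_conv_exp)
  have eq: "(LINT x|lborel. cis (- (x \<bullet> \<xi>)) * ?g m x) = ((cis (t m * \<xi> $ i) - 1) /\<^sub>R t m) * fourier f \<xi>" for m
  proof -
    have "(LINT x|lborel. cis (- (x \<bullet> \<xi>)) * ?g m x) =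
      (LINT x|lborel. (cis (- (x \<bullet> \<xi>)) * f (x + t m *\<^sub>R ?e) - cis (- (x \<bullet> \<xi>)) * f x) /\<^sub>R t m)"
      by (simp add: right_diff_distrib)
    also have "\<dots> = (fourier (\<lambda>x. f (x + t m *\<^sub>R ?e)) \<xi> - fourier f \<xi>) /\<^sub>R t m"
      unfolding fourier_def integral_scaleR_right
      by (subst Bochner_Integration.integral_diff)
        (simp_all only: integrable_cis_mult(2)[OF schwartz_integrable[OF schwartz_translate[OF f]]]
          integrable_cis_mult(2)[OF schwartz_integrable[OF f]])
    also have "\<dots> = ((cis (t m * \<xi> $ i) - 1) /\<^sub>R t m) * fourier f \<xi>"
      by (simp add: fourier_translate inner_axis' left_diff_distrib)
    finally show ?thesis .
  qed
  have "((\<lambda>z. exp (\<i> * (z * of_real (\<xi> $ i)))) has_field_derivative (\<i> * of_real (\<xi> $ i))) (at (of_real 0))"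
    by (auto intro!: derivative_eq_intros)
  from has_vector_derivative_real_field[OF this, of UNIV]
  have "((\<lambda>s. cis (s * \<xi> $ i)) has_derivative (\<lambda>s. s *\<^sub>R (\<i> * of_real (\<xi> $ i)))) (at 0)"
    by (simp add: has_vector_derivative_def cis_conv_exp)
  from difference_quotient_tendsto[OF this]
  have "((\<lambda>s. (cis (s * \<xi> $ i) - 1) /\<^sub>R s) \<longlongrightarrow> \<i> * of_real (\<xi> $ i)) (at 0)"
    by simp
  from filterlim_compose[OF this tl']
  have "(\<lambda>m. ((cis (t m * \<xi> $ i) - 1) /\<^sub>R t m) * fourier f \<xi>) \<longlonglongrightarrow> \<i> * of_real (\<xi> $ i) * fourier f \<xi>"
    by (intro tendsto_mult tendsto_const)
  with lim1 show ?thesis unfolding eq fourier_def[of "partial_deriv i f"] by (rule LIMSEQ_unique)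
qed

text \<open>One power of the weight is gained per derivative: \<open>norm \<xi>\<close> is at most
  the sum of the \<open>\<bar>\<xi> $ i\<bar>\<close>, and each of these factors is absorbed by
  passing to \<open>partial_deriv i f\<close>, to which the induction hypothesis applies.\<close>

lemma fourier_rapid:
  assumes "f \<in> schwartz"
  shows "\<exists>C. \<forall>\<xi>. (1 + norm \<xi>) ^ k * norm (fourier f \<xi>) \<le> C"
  using assms
proof (induction k arbitrary: f)
  case 0
  have "norm (fourier f \<xi>) \<le> (LINT x|lborel. norm (f x))" for \<xi>
    unfolding fourier_def using 0
    by (intro Bochner_Integration.integral_norm_bound_integral integrable_cis_mult schwartz_integrable integrable_norm)
      (auto simp: norm_mult)
  then show ?case by auto
next
  case (Suc k)
  obtain C where C: "\<And>\<xi>. (1 + norm \<xi>) ^ k * norm (fourier f \<xi>) \<le> C" using Suc by blast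
  have "\<forall>i. \<exists>B. \<forall>\<xi>. (1 + norm \<xi>) ^ k * norm (fourier (partial_deriv i f) \<xi>) \<le> B"
    by (intro allI Suc.IH[OF schwartz_partial_deriv[OF Suc.prems]])
  from choice[OF this] obtain B where
    "\<forall>i. \<forall>\<xi>. (1 + norm \<xi>) ^ k * norm (fourier (partial_deriv i f) \<xi>) \<le> B i" ..
  then have B: "\<And>i \<xi>. (1 + norm \<xi>) ^ k * norm (fourier (partial_deriv i f) \<xi>) \<le> B i"
    by simp
  have "(1 + norm \<xi>) ^ Suc k * norm (fourier f \<xi>) \<le> C + (\<Sum>i\<in>UNIV. B i)" for \<xi>
  proof -
    define F where "F = (1 + norm \<xi>) ^ k * norm (fourier f \<xi>)"
    have F: "\<bar>\<xi> $ i\<bar> * F = (1 + norm \<xi>) ^ k * norm (fourier (partial_deriv i f) \<xi>)" for i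
      by (simp add: fourier_of_partial_deriv[OF Suc.prems] norm_mult F_def)
    have "norm \<xi> \<le> (\<Sum>i\<in>UNIV. \<bar>\<xi> $ i\<bar>)" by (rule norm_le_l1_cart)
    then have "(1 + norm \<xi>) * F \<le> (1 + (\<Sum>i\<in>UNIV. \<bar>\<xi> $ i\<bar>)) * F"
      by (intro mult_right_mono) (auto simp: F_def)
    also have "\<dots> = F + (\<Sum>i\<in>UNIV. \<bar>\<xi> $ i\<bar> * F)"
      by (simp add: distrib_right sum_distrib_right)
    also have "\<dots> \<le> C + (\<Sum>i\<in>UNIV. B i)"
      unfolding F by (intro add_mono sum_mono B) (simp add: F_def C)
    finally show ?thesis by (simp add: F_def)
  qed
  then show ?case by blast
qed

lemma fourier_schwartz: "f \<in> schwartz \<Longrightarrow> fourier f \<in> schwartz"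
proof (rule schwartz_coinduct[where X = "fourier ` schwartz"])
  fix h :: "real^'a \<Rightarrow> complex" and x i k
  assume "h \<in> fourier ` schwartz"
  then obtain g where g: "g \<in> schwartz" and h: "h = fourier g" by blast
  show "h differentiable (at x)" unfolding h by (rule differentiableI[OF fourier_has_derivative[OF g]])
  show "partial_deriv i h \<in> fourier ` schwartz"
    unfolding h fourier_partial_deriv[OF g] by (intro imageI schwartz_coordinate_mult g)
  show "\<exists>C. \<forall>x. (1 + norm x) ^ k * norm (h x) \<le> C" unfolding h by (rule fourier_rapid[OF g])
qed simp

lemma inv_fourier_fourier:
  "inv_fourier (f :: real^'n::finite \<Rightarrow> complex) x = fourier f (- x) / of_real ((2 * pi) ^ CARD('n))"
  by (simp add: inv_fourier_def fourier_def inner_commute)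

lemma inv_fourier_schwartz: "f \<in> schwartz \<Longrightarrow> inv_fourier f \<in> schwartz"
proof -
  assume f: "f \<in> schwartz"
  have "(\<lambda>x. (1 / of_real ((2 * pi) ^ CARD('a))) * fourier f (- x)) \<in> schwartz"
    by (intro schwartz_cmult schwartz_uminus_arg fourier_schwartz f)
  moreover have "(\<lambda>x. (1 / of_real ((2 * pi) ^ CARD('a))) * fourier f (- x)) = inv_fourier f"
    by (auto simp: inv_fourier_fourier)
  ultimately show ?thesis by simp
qed

subsection \<open>Fourier inversion up to a constant\<close>

lemma continuous_nonneg_integral_eq_0:
  fixes g :: "real^'n::finite \<Rightarrow> real"
  assumes c: "continuous_on UNIV g" and nn: "\<And>x. g x \<ge> 0" and int: "integrable lborel g"
    and 0: "(LINT x|lborel. g x) = 0"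
  shows "g x = 0"
proof (rule ccontr)
  assume "g x \<noteq> 0"
  have [measurable]: "g \<in> borel_measurable borel" using int by auto
  have "AE x in lborel. g x = 0"
    using integral_nonneg_eq_0_iff_AE[OF int] nn 0 by auto
  then have "{x \<in> space lborel. \<not> g x = 0} \<in> null_sets lborel"
    by (subst (asm) AE_iff_null) auto
  then have "{x. g x \<noteq> 0} \<in> null_sets lebesgue"
    using null_sets_completionI by (simp add: null_sets_completionI)
  then have "negligible {x. g x \<noteq> 0}" by (simp add: negligible_iff_null_sets)
  moreover have "open {x. g x \<noteq> 0}"
    using open_Collect_neq[OF c continuous_on_const[of UNIV 0]] by simp
  ultimately show False using open_not_negligible[of "{x. g x \<noteq> 0}"] \<open>g x \<noteq> 0\<close> by auto
qed

lemma fourier_mult_formula: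
  fixes f g :: "real^'n::finite \<Rightarrow> complex"
  assumes f: "integrable lborel f" and g: "integrable lborel g"
  shows "(LINT x|lborel. f x * fourier g x) = (LINT y|lborel. fourier f y * g y)"
proof -
  have [measurable]: "f \<in> borel_measurable borel" "g \<in> borel_measurable borel" using f g by auto
  let ?h = "\<lambda>x y. f x * (cis (- (y \<bullet> x)) * g y)"
  have "integrable (lborel \<Otimes>\<^sub>M lborel) (case_prod ?h)"
  proof (rule lborel_pair.Fubini_integrable)
    show "case_prod ?h \<in> borel_measurable (lborel \<Otimes>\<^sub>M lborel)"
      unfolding cis_conv_exp by measurable
    show "integrable lborel (\<lambda>x. LINT y|lborel. norm (case_prod ?h (x, y)))"
      using f by (simp add: norm_mult)
    show "AE x in lborel. integrable lborel (\<lambda>y. case_prod ?h (x, y))"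
      by (auto intro!: AE_I2 integrable_mult_right integrable_cis_mult(2)[OF g])
  qed
  from lborel_pair.Fubini_integral[OF this]
  have "(LINT y|lborel. LINT x|lborel. ?h x y) = (LINT x|lborel. LINT y|lborel. ?h x y)" .
  moreover have "(LINT y|lborel. ?h x y) = f x * fourier g x" for x by (simp add: fourier_def)
  moreover have "(LINT x|lborel. ?h x y) = fourier f y * g y" for y
  proof -
    have "(LINT x|lborel. ?h x y) = (LINT x|lborel. (cis (- (x \<bullet> y)) * f x) * g y)"
      by (intro Bochner_Integration.integral_cong refl) (simp add: inner_commute)
    then show ?thesis by (simp add: fourier_def)
  qed
  ultimately show ?thesis by (simp only:)
qed

lemma fourier_reflect:
  assumes "f \<in> borel_measurable borel"
  shows "fourier (\<lambda>x. f (- x)) \<xi> = fourier f (- \<xi>)"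
proof -
  have [measurable]: "f \<in> borel_measurable borel" by fact
  have "(\<lambda>x. cis (- (x \<bullet> - \<xi>)) * f x) \<in> borel_measurable borel" unfolding cis_conv_exp by measurable
  from integral_uminus[OF this] show ?thesis by (simp add: fourier_def)
qed

lemma fourier_modulate:
  "fourier (\<lambda>x. cis (x \<bullet> b) * f x) \<xi> = fourier f (\<xi> - b)"
proof -
  have "cis (- (x \<bullet> \<xi>)) * (cis (x \<bullet> b) * f x) = cis (- (x \<bullet> (\<xi> - b))) * f x" for x
    by (simp add: cis_mult inner_diff_right flip: mult.assoc)
  then show ?thesis unfolding fourier_def by (simp only:)
qed

text \<open>The multiplication formula makes the left-hand side a superposition of translates of
  \<open>fourier \<phi>\<close> weighted by \<open>\<eta>\<close>. Moving a distribution under this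
  integral is what later identifies its block as a function.\<close>

lemma fourier_mult_inv_fourier:
  fixes \<phi> \<eta> :: "real^'n::finite \<Rightarrow> complex"
  assumes p: "\<phi> \<in> schwartz" and e: "\<eta> \<in> schwartz"
  shows "fourier (\<lambda>\<xi>. \<phi> \<xi> * inv_fourier \<eta> \<xi>) y
    = (LINT x|lborel. \<eta> x * (fourier \<phi> (y - x) / of_real ((2 * pi) ^ CARD('n))))"
proof -
  let ?c = "complex_of_real ((2 * pi) ^ CARD('n))"
  have [measurable]: "\<eta> \<in> borel_measurable borel" "\<phi> \<in> borel_measurable borel"
    "fourier \<phi> \<in> borel_measurable borel"
    using e p fourier_schwartz[OF p] by measurable
  have "fourier (\<lambda>\<xi>. \<phi> \<xi> * inv_fourier \<eta> \<xi>) y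
      = (LINT \<xi>|lborel. (cis (- (\<xi> \<bullet> y)) * \<phi> \<xi>) * fourier (\<lambda>x. \<eta> (- x)) \<xi> / ?c)"
    by (simp add: fourier_def[of _ y] inv_fourier_fourier fourier_reflect mult.assoc)
  also have "\<dots> = (LINT \<xi>|lborel. (cis (- (\<xi> \<bullet> y)) * \<phi> \<xi>) * fourier (\<lambda>x. \<eta> (- x)) \<xi>) / ?c"
    by simp
  also have "(LINT \<xi>|lborel. (cis (- (\<xi> \<bullet> y)) * \<phi> \<xi>) * fourier (\<lambda>x. \<eta> (- x)) \<xi>)
     = (LINT x|lborel. fourier (\<lambda>\<xi>. cis (- (\<xi> \<bullet> y)) * \<phi> \<xi>) x * \<eta> (- x))"
    by (rule fourier_mult_formula)
      (simp_all add: integrable_cis_mult schwartz_integrable p e schwartz_uminus_arg)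
  also have "\<dots> = (LINT x|lborel. (\<lambda>x. fourier \<phi> (y - x) * \<eta> x) (- x))"
    using fourier_modulate[of "- y" \<phi>] by (simp add: add.commute)
  also have "\<dots> = (LINT x|lborel. fourier \<phi> (y - x) * \<eta> x)"
    by (rule integral_uminus) measurable
  finally show ?thesis by (simp add: mult.commute)
qed

lemma diag_map_const: "diag_map (\<lambda>i. t) x = t *\<^sub>R x"
  by (simp add: vec_eq_iff)

lemma inv_fourier_fourier_regularized:
  fixes h \<gamma> :: "real^'n::finite \<Rightarrow> complex"
  assumes h: "h \<in> schwartz" and k: "\<gamma> \<in> schwartz"
  shows "h 0 * (of_real ((2 * pi) ^ CARD('n)) * inv_fourier (fourier \<gamma>) x)
    = \<gamma> x * (LINT z|lborel. fourier h z)"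
proof -
  define t where "t m = inverse (real (Suc m))" for m
  have t0: "t m > 0" for m by (auto simp: t_def)
  have tl: "t \<longlonglongrightarrow> 0" unfolding t_def by (rule LIMSEQ_inverse_real_of_nat)
  note Fh = fourier_schwartz[OF h] and Fk = fourier_schwartz[OF k]
  have [measurable]: "h \<in> borel_measurable borel" "\<gamma> \<in> borel_measurable borel"
    "fourier h \<in> borel_measurable borel" "fourier \<gamma> \<in> borel_measurable borel"
    using h k Fh Fk by measurable
  obtain Bh where Bh: "\<And>x. norm (h x) \<le> Bh" using schwartz_boundE0[OF h, of 0] by auto
  obtain Bk where Bk: "\<And>x. norm (\<gamma> x) \<le> Bk" using schwartz_boundE0[OF k, of 0] by auto
  have ht: "(\<lambda>x. h (t m *\<^sub>R x)) \<in> schwartz" for m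
    using schwartz_affine[OF h, of "\<lambda>i. t m" 0] t0[of m] by (simp add: diag_map_const)
  have hc: "isCont h 0" and kc: "isCont \<gamma> x"
    using schwartz_continuous[OF h] schwartz_continuous[OF k]
    by (auto simp: continuous_on_eq_continuous_at)
  have lim1: "(\<lambda>m. LINT \<xi>|lborel. (cis (\<xi> \<bullet> x) * h (t m *\<^sub>R \<xi>)) * fourier \<gamma> \<xi>)
     \<longlonglongrightarrow> (LINT \<xi>|lborel. (cis (\<xi> \<bullet> x) * h 0) * fourier \<gamma> \<xi>)"
  proof (rule integral_dominated_convergence)
    show "integrable lborel (\<lambda>\<xi>. Bh * norm (fourier \<gamma> \<xi>))"
      by (intro integrable_mult_right integrable_norm schwartz_integrable Fk)
    have "(\<lambda>m. h (t m *\<^sub>R \<xi>)) \<longlonglongrightarrow> h 0" for \<xi>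
      by (rule isCont_tendsto_compose[OF hc]) (use tendsto_scaleR[OF tl tendsto_const[of \<xi>]] in simp)
    then show "AE \<xi> in lborel. (\<lambda>m. (cis (\<xi> \<bullet> x) * h (t m *\<^sub>R \<xi>)) * fourier \<gamma> \<xi>)
      \<longlonglongrightarrow> (cis (\<xi> \<bullet> x) * h 0) * fourier \<gamma> \<xi>"
      by (intro AE_I2 tendsto_mult tendsto_const)
    show "AE \<xi> in lborel. norm ((cis (\<xi> \<bullet> x) * h (t m *\<^sub>R \<xi>)) * fourier \<gamma> \<xi>) \<le> Bh * norm (fourier \<gamma> \<xi>)" for m
      using Bh by (auto intro!: AE_I2 mult_right_mono simp: norm_mult)
  qed (unfold cis_conv_exp, measurable)
  have lim2: "(\<lambda>m. LINT z|lborel. fourier h z * \<gamma> (t m *\<^sub>R z + x)) \<longlonglongrightarrow> (LINT z|lborel. fourier h z * \<gamma> x)"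
  proof (rule integral_dominated_convergence)
    show "integrable lborel (\<lambda>z. norm (fourier h z) * Bk)"
      by (intro integrable_mult_left integrable_norm schwartz_integrable Fh)
    have "(\<lambda>m. \<gamma> (t m *\<^sub>R z + x)) \<longlonglongrightarrow> \<gamma> x" for z
      by (rule isCont_tendsto_compose[OF kc])
        (use tendsto_add[OF tendsto_scaleR[OF tl tendsto_const[of z]] tendsto_const[of x]] in simp)
    then show "AE z in lborel. (\<lambda>m. fourier h z * \<gamma> (t m *\<^sub>R z + x)) \<longlonglongrightarrow> fourier h z * \<gamma> x"
      by (intro AE_I2 tendsto_mult tendsto_const)
    show "AE z in lborel. norm (fourier h z * \<gamma> (t m *\<^sub>R z + x)) \<le> norm (fourier h z) * Bk" for m
      using Bk by (auto intro!: AE_I2 mult_left_mono simp: norm_mult)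
  qed measurable
  have eq: "(LINT \<xi>|lborel. (cis (\<xi> \<bullet> x) * h (t m *\<^sub>R \<xi>)) * fourier \<gamma> \<xi>)
      = (LINT z|lborel. fourier h z * \<gamma> (t m *\<^sub>R z + x))" for m
  proof -
    let ?G = "fourier (\<lambda>\<xi>. cis (\<xi> \<bullet> x) * h (t m *\<^sub>R \<xi>))"
    let ?P = "(\<Prod>i\<in>(UNIV::'n set). \<bar>t m\<bar>)"
    have G: "?G = (\<lambda>y. fourier (\<lambda>\<xi>. h (t m *\<^sub>R \<xi>)) (y - x))"
      by (rule ext) (rule fourier_modulate)
    have [measurable]: "fourier (\<lambda>\<xi>. h (t m *\<^sub>R \<xi>)) \<in> borel_measurable borel"
      using fourier_schwartz[OF ht] by measurable
    have "(LINT \<xi>|lborel. (cis (\<xi> \<bullet> x) * h (t m *\<^sub>R \<xi>)) * fourier \<gamma> \<xi>)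
      = (LINT y|lborel. ?G y * \<gamma> y)"
      by (intro fourier_mult_formula integrable_cis_mult(1) schwartz_integrable ht k)
    also have "\<dots> = ?P *\<^sub>R (LINT z|lborel. ?G (diag_map (\<lambda>i. t m) z + x) * \<gamma> (diag_map (\<lambda>i. t m) z + x))"
    proof (rule integral_diag_map)
      show "t m \<noteq> 0" for i :: 'n using t0[of m] by simp
      show "(\<lambda>y. ?G y * \<gamma> y) \<in> borel_measurable borel" unfolding G by measurable
    qed
    also have "\<dots> = (LINT z|lborel. (?P *\<^sub>R fourier (\<lambda>\<xi>. h (t m *\<^sub>R \<xi>)) (t m *\<^sub>R z)) * \<gamma> (t m *\<^sub>R z + x))"
      unfolding G by (simp add: diag_map_const flip: integral_scaleR_right)
    also have "(LINT z|lborel. (?P *\<^sub>R fourier (\<lambda>\<xi>. h (t m *\<^sub>R \<xi>)) (t m *\<^sub>R z)) * \<gamma> (t m *\<^sub>R z + x))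
      = (LINT z|lborel. fourier h z * \<gamma> (t m *\<^sub>R z + x))"
    proof -
    \<comment> \<open>Dilating \<open>h\<close> by \<open>t m\<close> dilates its transform
      inversely, and the Jacobian \<open>?P\<close> of the substitution cancels the factor that
      arises.\<close>
    have X: "(\<lambda>z. ?P *\<^sub>R fourier (\<lambda>\<xi>. h (t m *\<^sub>R \<xi>)) (t m *\<^sub>R z)) = fourier h"
    proof
      fix z
      have "fourier h z = ?P *\<^sub>R (LINT \<xi>|lborel. cis (- ((diag_map (\<lambda>i. t m) \<xi> + 0) \<bullet> z)) * h (diag_map (\<lambda>i. t m) \<xi> + 0))"
        unfolding fourier_def
      proof (rule integral_diag_map)
        show "t m \<noteq> 0" for i :: 'n using t0[of m] by simp
        show "(\<lambda>\<xi>. cis (- (\<xi> \<bullet> z)) * h \<xi>) \<in> borel_measurable borel" unfolding cis_conv_exp by measurable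
      qed
      then show "?P *\<^sub>R fourier (\<lambda>\<xi>. h (t m *\<^sub>R \<xi>)) (t m *\<^sub>R z) = fourier h z"
        by (simp add: diag_map_const fourier_def)
    qed
    from fun_cong[OF X] show ?thesis by (simp only:)
    qed
    finally show ?thesis .
  qed
  have "(LINT \<xi>|lborel. (cis (\<xi> \<bullet> x) * h 0) * fourier \<gamma> \<xi>) = (LINT z|lborel. fourier h z * \<gamma> x)"
    using lim1 lim2 unfolding eq by (rule LIMSEQ_unique)
  moreover have "(LINT \<xi>|lborel. (cis (\<xi> \<bullet> x) * h 0) * fourier \<gamma> \<xi>)
      = h 0 * (of_real ((2 * pi) ^ CARD('n)) * inv_fourier (fourier \<gamma>) x)"
  proof -
    have "(LINT \<xi>|lborel. (cis (\<xi> \<bullet> x) * h 0) * fourier \<gamma> \<xi>) = (LINT \<xi>|lborel. h 0 * (cis (x \<bullet> \<xi>) * fourier \<gamma> \<xi>))"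
      by (intro Bochner_Integration.integral_cong refl) (simp add: inner_commute)
    then show ?thesis by (simp add: inv_fourier_def)
  qed
  ultimately show ?thesis by (simp add: mult.commute)
qed

text \<open>The constant is \<open>1\<close>, but only \<open>\<kappa> \<noteq> 0\<close> is needed: if \<open>\<kappa>\<close> vanished, then the multiplication
  formula would give \<open>\<integral>|\<F>\<gamma>|\<^sup>2 = 0\<close> for all \<open>\<gamma>\<close>.\<close>

lemma fourier_inversion:
  fixes \<theta> :: "real^'n::finite \<Rightarrow> complex"
  assumes th: "\<theta> \<in> schwartz" and th0: "\<theta> 0 \<noteq> 0"
  obtains \<kappa> where "\<kappa> \<noteq> 0"
    "\<And>(\<gamma> :: real^'n \<Rightarrow> complex) x. \<gamma> \<in> schwartz \<Longrightarrow> inv_fourier (fourier \<gamma>) x = \<kappa> * \<gamma> x"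
proof -
  let ?c = "complex_of_real ((2 * pi) ^ CARD('n))"
  define \<kappa> where "\<kappa> = (LINT z|lborel. fourier \<theta> z) / (\<theta> 0 * ?c)"
  have c0: "?c \<noteq> 0" by simp
  have inv: "inv_fourier (fourier \<gamma>) x = \<kappa> * \<gamma> x" if "\<gamma> \<in> schwartz" for \<gamma> :: "real^'n \<Rightarrow> complex" and x
  proof -
    have "\<theta> 0 * (?c * inv_fourier (fourier \<gamma>) x) = \<gamma> x * (LINT z|lborel. fourier \<theta> z)"
      by (rule inv_fourier_fourier_regularized[OF th that])
    then show ?thesis unfolding \<kappa>_def using th0 c0 by (simp add: field_simps del: of_real_power)
  qed
  have "\<kappa> \<noteq> 0"
  proof
    assume "\<kappa> = 0"
    have "(LINT x|lborel. \<gamma> x) = 0" if k: "\<gamma> \<in> schwartz" for \<gamma> :: "real^'n \<Rightarrow> complex"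
    proof -
      \<comment> \<open>The reflected conjugate has the conjugate transform, so the multiplication
        formula produces the squared modulus of \<open>fourier \<gamma>\<close>.\<close>
      let ?b = "\<lambda>x. cnj (\<gamma> (- x))"
      note Fk = fourier_schwartz[OF k]
      have b: "?b \<in> schwartz" by (intro schwartz_cnj schwartz_uminus_arg k)
      have [measurable]: "\<gamma> \<in> borel_measurable borel" using k by measurable
      have Fb: "fourier ?b \<xi> = cnj (fourier \<gamma> \<xi>)" for \<xi>
      proof -
        have "fourier ?b \<xi> = (LINT x|lborel. cis (x \<bullet> \<xi>) * cnj (\<gamma> x))"
          using fourier_reflect[OF schwartz_measurable[OF schwartz_cnj[OF k]], of \<xi>]
          by (simp add: fourier_def)
        also have "\<dots> = (LINT x|lborel. cnj (cis (- (x \<bullet> \<xi>)) * \<gamma> x))" by (simp add: cis_cnj)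
        finally show ?thesis by (simp only: fourier_def Bochner_Integration.integral_cnj)
      qed
      have "fourier (fourier \<gamma>) y = 0" for y
        using inv[OF k, of "- y"] \<open>\<kappa> = 0\<close> c0 by (simp add: inv_fourier_fourier)
      then have "(LINT \<xi>|lborel. fourier \<gamma> \<xi> * fourier ?b \<xi>) = 0"
        using fourier_mult_formula[OF schwartz_integrable[OF Fk] schwartz_integrable[OF b]] by simp
      then have "(LINT \<xi>|lborel. complex_of_real ((norm (fourier \<gamma> \<xi>))\<^sup>2)) = 0"
        by (simp only: Fb complex_norm_square)
      then have "(LINT \<xi>|lborel. (norm (fourier \<gamma> \<xi>))\<^sup>2) = 0"
        by (simp only: integral_complex_of_real of_real_eq_0_iff)
      moreover have "integrable lborel (\<lambda>\<xi>. (norm (fourier \<gamma> \<xi>))\<^sup>2)"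
      proof -
        have "(\<lambda>\<xi>. fourier \<gamma> \<xi> * fourier \<gamma> \<xi>) \<in> schwartz"
          by (intro schwartz_mult schwartz_slowly_increasing Fk)
        from integrable_norm[OF schwartz_integrable[OF this]]
        show ?thesis by (simp add: norm_mult power2_eq_square)
      qed
      moreover have "continuous_on UNIV (\<lambda>\<xi>. (norm (fourier \<gamma> \<xi>))\<^sup>2)"
        by (intro continuous_intros schwartz_continuous Fk)
      ultimately have "(norm (fourier \<gamma> 0))\<^sup>2 = 0"
        by (intro continuous_nonneg_integral_eq_0[where g = "\<lambda>\<xi>. (norm (fourier \<gamma> \<xi>))\<^sup>2"] zero_le_power2)
      then show ?thesis by (simp add: fourier_def)
    qed
    note int0 = this
    \<comment> \<open>Every Schwartz function would have integral 0, being the value at 0 of its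
      transform; the squared modulus of \<open>\<theta>\<close> refutes this because
      \<open>\<theta> 0 \<noteq> 0\<close>.\<close>
    have sq: "(\<lambda>x. \<theta> x * cnj (\<theta> x)) \<in> schwartz"
      by (intro schwartz_mult schwartz_slowly_increasing schwartz_cnj th)
    from int0[OF this] have "(LINT \<xi>|lborel. complex_of_real ((norm (\<theta> \<xi>))\<^sup>2)) = 0"
      by (simp only: complex_norm_square)
    then have "(LINT \<xi>|lborel. (norm (\<theta> \<xi>))\<^sup>2) = 0"
      by (simp only: integral_complex_of_real of_real_eq_0_iff)
    moreover have "integrable lborel (\<lambda>\<xi>. (norm (\<theta> \<xi>))\<^sup>2)"
      using integrable_norm[OF schwartz_integrable[OF sq]] by (simp add: norm_mult power2_eq_square)
    moreover have "continuous_on UNIV (\<lambda>\<xi>. (norm (\<theta> \<xi>))\<^sup>2)"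
      by (intro continuous_intros schwartz_continuous th)
    ultimately have "(norm (\<theta> 0))\<^sup>2 = 0"
      by (intro continuous_nonneg_integral_eq_0[where g = "\<lambda>\<xi>. (norm (\<theta> \<xi>))\<^sup>2"] zero_le_power2)
    then show False using th0 by simp
  qed
  then show ?thesis using that inv by metis
qed

section \<open>Tempered distributions with compactly supported Fourier transform\<close>

lemma tempered_add:
  "f \<in> tempered_distributions \<Longrightarrow> \<eta> \<in> schwartz \<Longrightarrow> \<theta> \<in> schwartz \<Longrightarrow> f (\<lambda>x. \<eta> x + \<theta> x) = f \<eta> + f \<theta>"
  by (simp add: tempered_distributions_def)

lemma tempered_cmult:
  "f \<in> tempered_distributions \<Longrightarrow> \<eta> \<in> schwartz \<Longrightarrow> f (\<lambda>x. c * \<eta> x) = c * f \<eta>"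
  by (simp add: tempered_distributions_def)

lemma tempered_zero: "f \<in> tempered_distributions \<Longrightarrow> f (\<lambda>x. 0) = 0"
  using tempered_cmult[of f "\<lambda>x. 0" 0] schwartz_zero by simp

lemma tempered_diff:
  "f \<in> tempered_distributions \<Longrightarrow> \<eta> \<in> schwartz \<Longrightarrow> \<theta> \<in> schwartz \<Longrightarrow> f (\<lambda>x. \<eta> x - \<theta> x) = f \<eta> - f \<theta>"
  using tempered_add[of f \<eta> "\<lambda>x. (-1) * \<theta> x"] tempered_cmult[of f \<theta> "-1"] schwartz_cmult[of \<theta> "-1"] by simp

lemma tempered_sum:
  assumes "f \<in> tempered_distributions" "finite A" "\<And>k. k \<in> A \<Longrightarrow> g k \<in> schwartz"
  shows "f (\<lambda>x. \<Sum>k\<in>A. c k * g k x) = (\<Sum>k\<in>A. c k * f (g k))"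
  using assms(2,3)
proof (induction A rule: finite_induct)
  case (insert k A)
  have "(\<lambda>x. \<Sum>k\<in>A. c k * g k x) \<in> schwartz"
    by (rule schwartz_sum) (simp add: schwartz_cmult insert.prems)
  then show ?case using insert
    by (simp add: tempered_add[OF assms(1)] tempered_cmult[OF assms(1)] schwartz_cmult)
qed (simp add: tempered_zero[OF assms(1)])

text \<open>If no order sufficed, each \<open>m\<close> would have an offending test function, and
  dividing it by its value under \<open>f\<close> would give a null sequence on which
  \<open>f\<close> equals 1. The bound \<open>B\<close> is a parameter, so that applications need no
  supremum.\<close>

lemma tempered_bound:
  fixes f :: "'n::finite distr"
  assumes f: "f \<in> tempered_distributions"
  obtains N C where "C > 0"
    "\<And>\<eta> B. \<eta> \<in> schwartz \<Longrightarrow>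
      (\<And>is y. length is \<le> N \<Longrightarrow> (1 + norm y) ^ N * norm (partial_derivs is \<eta> y) \<le> B) \<Longrightarrow> norm (f \<eta>) \<le> C * B"
proof -
  have "\<exists>N C. C > 0 \<and> (\<forall>\<eta> B. \<eta> \<in> schwartz \<longrightarrow>
      (\<forall>is y. length is \<le> N \<longrightarrow> (1 + norm y) ^ N * norm (partial_derivs is \<eta> y) \<le> B) \<longrightarrow> norm (f \<eta>) \<le> C * B)"
  proof (rule ccontr)
    assume neg: "\<not> ?thesis"
    have "\<forall>m. \<exists>p. fst p \<in> schwartz \<and>
        (\<forall>is y. length is \<le> m \<longrightarrow> (1 + norm y) ^ m * norm (partial_derivs is (fst p) y) \<le> snd p) \<and>
        \<not> norm (f (fst p)) \<le> real (Suc m) * snd p"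
    proof
      fix m
      have "\<not> (real (Suc m) > 0 \<and> (\<forall>\<eta> B. \<eta> \<in> schwartz \<longrightarrow>
        (\<forall>is y. length is \<le> m \<longrightarrow> (1 + norm y) ^ m * norm (partial_derivs is \<eta> y) \<le> B) \<longrightarrow> norm (f \<eta>) \<le> real (Suc m) * B))"
        using neg[unfolded not_ex, THEN spec, of m, THEN spec, of "real (Suc m)"] .
      then obtain \<eta> B where "\<eta> \<in> schwartz" "\<forall>is y. length is \<le> m \<longrightarrow> (1 + norm y) ^ m * norm (partial_derivs is \<eta> y) \<le> B"
         "\<not> norm (f \<eta>) \<le> real (Suc m) * B" by auto
      then show "\<exists>p. fst p \<in> schwartz \<and>
        (\<forall>is y. length is \<le> m \<longrightarrow> (1 + norm y) ^ m * norm (partial_derivs is (fst p) y) \<le> snd p) \<and>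
        \<not> norm (f (fst p)) \<le> real (Suc m) * snd p"
        by (intro exI[of _ "(\<eta>, B)"]) simp
    qed
    from choice[OF this] obtain P where P: "\<forall>m. fst (P m) \<in> schwartz \<and>
        (\<forall>is y. length is \<le> m \<longrightarrow> (1 + norm y) ^ m * norm (partial_derivs is (fst (P m)) y) \<le> snd (P m)) \<and>
        \<not> norm (f (fst (P m))) \<le> real (Suc m) * snd (P m)" ..
    define e where "e m = fst (P m)" for m
    define B where "B m = snd (P m)" for m
    have e: "e m \<in> schwartz" and eB: "length is \<le> m \<Longrightarrow> (1 + norm y) ^ m * norm (partial_derivs is (e m) y) \<le> B m"
      and fe: "norm (f (e m)) > real (Suc m) * B m" for m "is" y
      using P by (auto simp: e_def B_def not_le)
    have B0: "B m \<ge> 0" for m using eB[of "[]" m 0] norm_ge_zero[of "e m 0"] by (simp del: norm_ge_zero)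
    have f0: "norm (f (e m)) > 0" for m
      using fe[of m] B0[of m] by (smt (verit) mult_nonneg_nonneg of_nat_0_le_iff)
    define \<theta> where "\<theta> m = (\<lambda>x. (1 / f (e m)) * e m x)" for m
    have th: "\<theta> m \<in> schwartz" for m unfolding \<theta>_def by (intro schwartz_cmult e)
    have fth: "f (\<theta> m) = 1" for m
    proof -
      have "f (\<theta> m) = (1 / f (e m)) * f (e m)" unfolding \<theta>_def by (rule tempered_cmult[OF f e])
      then show ?thesis using f0[of m] by simp
    qed
    have semi: "(\<lambda>m. schwartz_seminorm k is (\<lambda>x. \<theta> m x - 0)) \<longlonglongrightarrow> 0" for k "is"
    proof (rule tendsto_sandwich)
      \<comment> \<open>Once \<open>m\<close> reaches both \<open>k\<close> and the length of the
        list, this seminorm is among those controlled by \<open>B m\<close>, and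
        \<open>norm (f (e m))\<close> beats \<open>B m\<close> by the factor
        \<open>Suc m\<close>.\<close>
      have bd: "(1 + norm x) ^ k * norm (partial_derivs is (\<theta> m) x) \<le> inverse (real (Suc m))"
        if m: "m \<ge> max k (length is)" for m x
      proof -
        have "(1 + norm x) ^ k * norm (partial_derivs is (\<theta> m) x) \<le> (1 + norm x) ^ m * norm (partial_derivs is (\<theta> m) x)"
          using m by (intro mult_right_mono power_increasing) auto
        also have "\<dots> = ((1 + norm x) ^ m * norm (partial_derivs is (e m) x)) / norm (f (e m))"
        proof -
          have "partial_derivs is (\<theta> m) = (\<lambda>x. (1 / f (e m)) * partial_derivs is (e m) x)"
            unfolding \<theta>_def by (rule partial_derivs_cmult[OF schwartz_smooth[OF e]])
          then show ?thesis by (simp add: norm_divide)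
        qed
        also have "\<dots> \<le> B m / norm (f (e m))"
          using eB[of "is" m x] m f0[of m] by (intro divide_right_mono) auto
        also have "\<dots> \<le> inverse (real (Suc m))"
          using fe[of m] f0[of m] by (simp add: divide_simps mult.commute)
        finally show ?thesis .
      qed
      show "\<forall>\<^sub>F m in sequentially. schwartz_seminorm k is (\<lambda>x. \<theta> m x - 0) \<le> inverse (real (Suc m))"
        unfolding eventually_sequentially schwartz_seminorm_def
        by (intro exI[of _ "max k (length is)"] allI impI cSUP_least) (simp_all only: diff_zero bd, simp_all)
      have "0 \<le> schwartz_seminorm k is (\<lambda>x. \<theta> m x - 0)" if m: "m \<ge> max k (length is)" for m
      proof -
        have "bdd_above (range (\<lambda>x. (1 + norm x) ^ k * norm (partial_derivs is (\<theta> m) x)))"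
          using bd[OF m] by (intro bdd_aboveI2[of _ _ "inverse (real (Suc m))"]) auto
        from cSUP_upper2[OF this, of 0 0] show ?thesis
          unfolding schwartz_seminorm_def by simp
      qed
      then show "\<forall>\<^sub>F m in sequentially. 0 \<le> schwartz_seminorm k is (\<lambda>x. \<theta> m x - 0)"
        unfolding eventually_sequentially by blast
      show "(\<lambda>m. inverse (real (Suc m))) \<longlonglongrightarrow> 0" by (rule LIMSEQ_inverse_real_of_nat)
    qed simp
    have "(\<lambda>m. f (\<theta> m)) \<longlonglongrightarrow> f (\<lambda>x. 0)"
    proof -
      have C: "\<forall>\<theta> \<eta>. (\<forall>m::nat. \<theta> m \<in> schwartz) \<and> \<eta> \<in> schwartz \<and>
        (\<forall>k is. (\<lambda>m. schwartz_seminorm k is (\<lambda>x. \<theta> m x - \<eta> x)) \<longlonglongrightarrow> 0) \<longrightarrow>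
        (\<lambda>m. f (\<theta> m)) \<longlonglongrightarrow> f \<eta>" using f unfolding tempered_distributions_def by simp
      show ?thesis using C[rule_format, of \<theta> "\<lambda>x. 0"] th semi schwartz_zero by simp
    qed
    then have "(\<lambda>m::nat. 1::complex) \<longlonglongrightarrow> 0" by (simp add: fth tempered_zero[OF f])
    then show False by (simp add: LIMSEQ_const_iff)
  qed
  then obtain N C where "C > 0 \<and> (\<forall>\<eta> B. \<eta> \<in> schwartz \<longrightarrow>
      (\<forall>is y. length is \<le> N \<longrightarrow> (1 + norm y) ^ N * norm (partial_derivs is \<eta> y) \<le> B) \<longrightarrow> norm (f \<eta>) \<le> C * B)"
    by (elim exE)
  then show ?thesis by (intro that[of C N]) simp_all
qed

section \<open>Seminorms of translates of a kernel, uniformly over derivatives of bounded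
  order\<close>

lemma uniform_bound:
  assumes "finite S" "\<And>s. s \<in> S \<Longrightarrow> \<exists>C. \<forall>z. F s z \<le> C * G z" and G: "\<And>z. (G z :: real) \<ge> 0"
  shows "\<exists>C > 0. \<forall>s\<in>S. \<forall>z. F s z \<le> C * G z"
  using assms(1,2)
proof (induction S rule: finite_induct)
  case empty
  then show ?case by (intro exI[of _ 1]) simp
next
  case (insert s S)
  then obtain C where C: "C > 0" "\<forall>s\<in>S. \<forall>z. F s z \<le> C * G z" by auto
  obtain D where D: "\<forall>z. F s z \<le> D * G z" using insert.prems[of s] by auto
  have "F s' z \<le> max C D * G z" if "s' \<in> insert s S" for s' z
  proof -
    have "C * G z \<le> max C D * G z" "D * G z \<le> max C D * G z" by (intro mult_right_mono G; simp)+
    moreover have "F s z \<le> D * G z" using D by simp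
    moreover have "s' \<in> S \<Longrightarrow> F s' z \<le> C * G z" using C by simp
    ultimately show ?thesis using that by (cases "s' = s") auto
  qed
  then show ?case using C(1) by (intro exI[of _ "max C D"]) auto
qed

lemma finite_short_lists: "finite {is :: 'n::finite list. length is \<le> N}"
  using finite_lists_length_le[of "UNIV :: 'n set" N] by simp

lemma weight_triangle: "1 + norm (y::'a::real_normed_vector) \<le> (1 + norm (y - x)) * (1 + norm x)"
proof -
  have "norm y \<le> norm (y - x) + norm x" using norm_triangle_ineq[of "y - x" x] by simp
  moreover have "0 \<le> norm (y - x) * norm x" by simp
  moreover have "(1 + norm (y - x)) * (1 + norm x) = 1 + norm (y - x) + norm x + norm (y - x) * norm x"
    by (simp add: distrib_left distrib_right)
  ultimately show ?thesis by linarith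
qed

lemma weight_triangle_power:
  "(1 + norm (y::'a::real_normed_vector)) ^ N \<le> (1 + norm (y - x)) ^ N * (1 + norm x) ^ N"
  unfolding power_mult_distrib[symmetric] by (intro power_mono weight_triangle) simp

text \<open>Passing from the weight at \<open>y\<close> to that at \<open>y - x\<close> costs the
  weight at \<open>x\<close>. When a functional is applied to the translates, the first estimate
  yields polynomial growth in \<open>x\<close> and the second yields continuity.\<close>

lemma translates_bound:
  fixes K :: "real^'n::finite \<Rightarrow> complex"
  assumes K: "K \<in> schwartz"
  obtains A where "A > 0"
    "\<And>is x y. length is \<le> N \<Longrightarrow> (1 + norm y) ^ N * norm (partial_derivs is K (y - x)) \<le> A * (1 + norm x) ^ N"
    "\<And>is x x' y. length is \<le> N \<Longrightarrow> norm (x - x') \<le> 1 \<Longrightarrow>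
      (1 + norm y) ^ N * norm (partial_derivs is K (y - x') - partial_derivs is K (y - x)) \<le> A * (1 + norm x) ^ N * norm (x - x')"
proof -
  have "\<exists>C>0. \<forall>is\<in>{is :: 'n list. length is \<le> N}. \<forall>z.
     (1 + norm (snd z)) ^ N * norm (partial_derivs is K (snd z - fst z)) \<le> C * (1 + norm (fst z)) ^ N"
  proof (rule uniform_bound[OF finite_short_lists])
    fix "is" :: "'n list"
    obtain C where C: "C > 0" "\<And>x. (1 + norm x) ^ N * norm (partial_derivs is K x) \<le> C"
      using schwartz_boundE[OF K, of N "is"] by metis
    have "(1 + norm y) ^ N * norm (partial_derivs is K (y - x)) \<le> C * (1 + norm x) ^ N" for x y
    proof -
      have "(1 + norm y) ^ N * norm (partial_derivs is K (y - x)) \<le>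
        ((1 + norm (y - x)) ^ N * (1 + norm x) ^ N) * norm (partial_derivs is K (y - x))"
        by (intro mult_right_mono weight_triangle_power) simp
      also have "\<dots> = ((1 + norm (y - x)) ^ N * norm (partial_derivs is K (y - x))) * (1 + norm x) ^ N" by simp
      also have "\<dots> \<le> C * (1 + norm x) ^ N" by (intro mult_right_mono C) simp
      finally show ?thesis .
    qed
    then show "\<exists>C. \<forall>z. (1 + norm (snd z)) ^ N * norm (partial_derivs is K (snd z - fst z)) \<le> C * (1 + norm (fst z)) ^ N"
      by (intro exI[of _ C]) simp
  qed simp
  then obtain A1 where A1: "A1 > 0" "\<And>is x y. length is \<le> N \<Longrightarrow> (1 + norm y) ^ N * norm (partial_derivs is K (y - x)) \<le> A1 * (1 + norm x) ^ N"
    by auto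
  \<comment> \<open>\<open>uniform_bound\<close> admits one unrestricted variable: the triple
    \<open>(x, x', y)\<close> is coded as nested pairs, and the condition on \<open>x - x'\<close>
    becomes a conditional with value 0.\<close>
  have "\<exists>C>0. \<forall>is\<in>{is :: 'n list. length is \<le> N}. \<forall>z.
     (if norm (fst z - fst (snd z)) \<le> 1 then (1 + norm (snd (snd z))) ^ N *
       norm (partial_derivs is K (snd (snd z) - fst (snd z)) - partial_derivs is K (snd (snd z) - fst z)) else 0)
     \<le> C * ((1 + norm (fst z)) ^ N * norm (fst z - fst (snd z)))"
  proof (rule uniform_bound[OF finite_short_lists])
    fix "is" :: "'n list"
    obtain C where C: "C > 0" "\<And>x h. norm h \<le> 1 \<Longrightarrow>
       (1 + norm x) ^ N * norm (partial_derivs is K (x + h) - partial_derivs is K x) \<le> C * norm h"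
      using schwartz_lipschitz[OF schwartz_partial_derivs[OF K, of "is"], of N] by metis
    have "(1 + norm y) ^ N * norm (partial_derivs is K (y - x') - partial_derivs is K (y - x)) \<le> C * ((1 + norm x) ^ N * norm (x - x'))"
      if "norm (x - x') \<le> 1" for x x' y
    proof -
      have "(1 + norm y) ^ N * norm (partial_derivs is K (y - x') - partial_derivs is K (y - x)) \<le>
        ((1 + norm (y - x)) ^ N * (1 + norm x) ^ N) * norm (partial_derivs is K (y - x') - partial_derivs is K (y - x))"
        by (intro mult_right_mono weight_triangle_power) simp
      also have "\<dots> = ((1 + norm (y - x)) ^ N * norm (partial_derivs is K ((y - x) + (x - x')) - partial_derivs is K (y - x))) * (1 + norm x) ^ N" by simp
      also have "\<dots> \<le> (C * norm (x - x')) * (1 + norm x) ^ N" by (intro mult_right_mono C(2) that) simp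
      finally show ?thesis by (simp add: mult_ac)
    qed
    then show "\<exists>C. \<forall>z. (if norm (fst z - fst (snd z)) \<le> 1 then (1 + norm (snd (snd z))) ^ N *
       norm (partial_derivs is K (snd (snd z) - fst (snd z)) - partial_derivs is K (snd (snd z) - fst z)) else 0)
     \<le> C * ((1 + norm (fst z)) ^ N * norm (fst z - fst (snd z)))"
      using C(1) by (intro exI[of _ C]) simp
  qed simp
  then obtain A2 where A2: "A2 > 0" and A2': "\<forall>is\<in>{is :: 'n list. length is \<le> N}. \<forall>z.
     (if norm (fst z - fst (snd z)) \<le> 1 then (1 + norm (snd (snd z))) ^ N *
       norm (partial_derivs is K (snd (snd z) - fst (snd z)) - partial_derivs is K (snd (snd z) - fst z)) else 0)
     \<le> A2 * ((1 + norm (fst z)) ^ N * norm (fst z - fst (snd z)))" by (elim exE conjE)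
  show ?thesis
  proof (rule that[of "A1 + A2"])
    show "A1 + A2 > 0" using A1 A2 by simp
    fix "is" :: "'n list" and x y x' :: "real^'n"
    assume l: "length is \<le> N"
    have "A1 * (1 + norm x) ^ N \<le> (A1 + A2) * (1 + norm x) ^ N" using A2 by (intro mult_right_mono) auto
    with A1(2)[OF l, of y x]
    show "(1 + norm y) ^ N * norm (partial_derivs is K (y - x)) \<le> (A1 + A2) * (1 + norm x) ^ N" by (rule order_trans)
    assume n: "norm (x - x') \<le> 1"
    have "(1 + norm y) ^ N * norm (partial_derivs is K (y - x') - partial_derivs is K (y - x)) \<le> A2 * ((1 + norm x) ^ N * norm (x - x'))"
      using A2'[THEN bspec, of "is", THEN spec, of "(x, x', y)"] l n by simp
    also have "\<dots> \<le> (A1 + A2) * ((1 + norm x) ^ N * norm (x - x'))" using A1(1) by (intro mult_right_mono) auto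
    finally show "(1 + norm y) ^ N * norm (partial_derivs is K (y - x') - partial_derivs is K (y - x)) \<le> (A1 + A2) * (1 + norm x) ^ N * norm (x - x')"
      by (simp add: mult.assoc)
  qed
qed

text \<open>The derivative taken first multiplies \<open>\<phi>\<close> by a coordinate function.
  With \<open>\<phi>\<close> arbitrary, the remaining list meets a formula of the same shape, and
  nothing is differentiated under the integral.\<close>

lemma partial_derivs_fourier_mult_inv:
  fixes \<phi> \<eta> :: "real^'n::finite \<Rightarrow> complex"
  assumes e: "\<eta> \<in> schwartz"
  shows "\<phi> \<in> schwartz \<Longrightarrow> partial_derivs is (fourier (\<lambda>\<xi>. \<phi> \<xi> * inv_fourier \<eta> \<xi>)) y
    = (LINT x|lborel. \<eta> x * (partial_derivs is (fourier \<phi>) (y - x) / of_real ((2 * pi) ^ CARD('n))))"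
proof (induction "is" arbitrary: \<phi> rule: rev_induct)
  case Nil
  then show ?case by (simp add: fourier_mult_inv_fourier[OF _ e])
next
  case (snoc i "is")
  let ?p = "\<lambda>\<xi>::real^'n. - \<i> * of_real (\<xi> $ i) * \<phi> \<xi>"
  have "(\<lambda>\<xi>. \<phi> \<xi> * inv_fourier \<eta> \<xi>) \<in> schwartz"
    by (intro schwartz_mult schwartz_slowly_increasing inv_fourier_schwartz e snoc.prems)
  from fourier_partial_deriv[OF this, of i]
  have 1: "partial_deriv i (fourier (\<lambda>\<xi>. \<phi> \<xi> * inv_fourier \<eta> \<xi>)) = fourier (\<lambda>\<xi>. ?p \<xi> * inv_fourier \<eta> \<xi>)"
    by (simp only: mult.assoc)
  have "partial_derivs (is @ [i]) (fourier (\<lambda>\<xi>. \<phi> \<xi> * inv_fourier \<eta> \<xi>)) y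
      = partial_derivs is (fourier (\<lambda>\<xi>. ?p \<xi> * inv_fourier \<eta> \<xi>)) y"
    by (simp only: partial_derivs_append partial_derivs.simps 1)
  also have "\<dots> = (LINT x|lborel. \<eta> x * (partial_derivs is (fourier ?p) (y - x) / of_real ((2 * pi) ^ CARD('n))))"
    by (rule snoc.IH[OF schwartz_coordinate_mult[OF snoc.prems]])
  finally show ?case
    by (simp only: partial_derivs_append partial_derivs.simps fourier_partial_deriv[OF snoc.prems])
qed

lemma tail_integral_tendsto:
  fixes g :: "real^'n::finite \<Rightarrow> 'b::{banach, second_countable_topology}"
  assumes g: "integrable lborel g"
  defines "B \<equiv> \<lambda>n. cbox (\<chi> i. - real n) (\<chi> i. real n) :: (real^'n) set"
  shows "(\<lambda>n. LINT x|lborel. indicator (- B n) x *\<^sub>R g x) \<longlonglongrightarrow> 0"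
    "(\<lambda>n. LINT x|lborel. indicator (B n) x *\<^sub>R g x) \<longlonglongrightarrow> (LINT x|lborel. g x)"
proof -
  have [measurable]: "g \<in> borel_measurable borel" "\<And>n. B n \<in> sets borel" using g by (auto simp: B_def)
  have mem: "\<forall>\<^sub>F n in sequentially. x \<in> B n" for x
  proof -
    obtain m :: nat where m: "norm x \<le> real m" using real_arch_simple by blast
    have "x \<in> B n" if "n \<ge> m" for n
    proof -
      have "\<bar>x $ i\<bar> \<le> real n" for i using component_le_norm_cart[of x i] m that by linarith
      then show ?thesis unfolding B_def mem_box_cart by (auto simp: abs_le_iff minus_le_iff)
    qed
    then show ?thesis unfolding eventually_sequentially by blast
  qed
  have "(\<lambda>n. LINT x|lborel. indicator (- B n) x *\<^sub>R g x) \<longlonglongrightarrow> (LINT x|(lborel::(real^'n) measure). 0)"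
  proof (rule integral_dominated_convergence[where w = "\<lambda>x. norm (g x)"])
    show "AE x in lborel. (\<lambda>n. indicator (- B n) x *\<^sub>R g x) \<longlonglongrightarrow> 0"
    proof (intro AE_I2 tendsto_eventually)
      fix x show "\<forall>\<^sub>F n in sequentially. indicator (- B n) x *\<^sub>R g x = 0"
        using mem[of x] by eventually_elim simp
    qed
    show "AE x in lborel. norm (indicator (- B n) x *\<^sub>R g x) \<le> norm (g x)" for n
      by (auto simp: indicator_def)
  qed (use g in auto)
  then show "(\<lambda>n. LINT x|lborel. indicator (- B n) x *\<^sub>R g x) \<longlonglongrightarrow> 0" by simp
  show "(\<lambda>n. LINT x|lborel. indicator (B n) x *\<^sub>R g x) \<longlonglongrightarrow> (LINT x|lborel. g x)"
  proof (rule integral_dominated_convergence[where w = "\<lambda>x. norm (g x)"])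
    show "AE x in lborel. (\<lambda>n. indicator (B n) x *\<^sub>R g x) \<longlonglongrightarrow> g x"
    proof (intro AE_I2 tendsto_eventually)
      fix x show "\<forall>\<^sub>F n in sequentially. indicator (B n) x *\<^sub>R g x = g x"
        using mem[of x] by eventually_elim simp
    qed
    show "AE x in lborel. norm (indicator (B n) x *\<^sub>R g x) \<le> norm (g x)" for n
      by (auto simp: indicator_def)
  qed (use g in auto)
qed

text \<open>Passage to the gauge integral, whose tagged divisions provide the Riemann sums.\<close>

lemma indicator_integral_eq_HK:
  fixes g :: "real^'n::finite \<Rightarrow> complex"
  assumes g: "integrable lborel g"
  shows "(LINT x|lborel. indicator (cbox a b) x *\<^sub>R g x) = integral (cbox a b) g"
    "g integrable_on (cbox a b)"
proof -
  have s: "set_integrable lborel (cbox a b) g"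
    unfolding set_integrable_def using g by (intro integrable_mult_indicator) auto
  show "(LINT x|lborel. indicator (cbox a b) x *\<^sub>R g x) = integral (cbox a b) g"
    using set_borel_integral_eq_integral(2)[OF s] by (simp add: set_lebesgue_integral_def)
  show "g integrable_on (cbox a b)" using set_borel_integral_eq_integral(1)[OF s] .
qed

text \<open>The pairing formula is obtained from tagged Riemann sums over a large box: \<open>f\<close> is linear on such
  sums, and a Lipschitz bound on the integrand makes them converge in the seminorm that controls \<open>f\<close>.\<close>

lemma tempered_convolution:
  fixes f :: "'n::finite distr" and \<phi> :: "real^'n \<Rightarrow> complex"
  assumes f: "f \<in> tempered_distributions" and p: "\<phi> \<in> schwartz"
  defines "u \<equiv> \<lambda>x. f (\<lambda>y. fourier \<phi> (y - x) / of_real ((2 * pi) ^ CARD('n)))"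
  shows "continuous_on UNIV u" (is ?cont)
    and "\<exists>N B. \<forall>x. norm (u x) \<le> B * (1 + norm x) ^ N" (is ?growth)
    and "\<And>\<eta>. \<eta> \<in> schwartz \<Longrightarrow> integrable lborel (\<lambda>x. u x * \<eta> x)"
    and "\<And>\<eta>. \<eta> \<in> schwartz \<Longrightarrow> f (fourier (\<lambda>\<xi>. \<phi> \<xi> * inv_fourier \<eta> \<xi>)) = (LINT x|lborel. u x * \<eta> x)"
proof -
  define c where "c = complex_of_real ((2 * pi) ^ CARD('n))"
  define K where "K = (\<lambda>y. (1 / c) * fourier \<phi> y)"
  have K: "K \<in> schwartz" unfolding K_def by (intro schwartz_cmult fourier_schwartz p)
  have KD: "partial_derivs is K y = partial_derivs is (fourier \<phi>) y / c" for "is" y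
    unfolding K_def partial_derivs_cmult[OF schwartz_smooth[OF fourier_schwartz[OF p]]] by simp
  define \<tau> where "\<tau> x = (\<lambda>y. K (y - x))" for x
  have u: "u x = f (\<tau> x)" for x by (simp add: u_def \<tau>_def K_def c_def)
  have tS: "\<tau> x \<in> schwartz" for x unfolding \<tau>_def using schwartz_translate[OF K, of "- x"] by simp
  have tD: "partial_derivs is (\<tau> x) y = partial_derivs is K (y - x)" for "is" x y
    unfolding \<tau>_def using partial_derivs_translate[OF schwartz_smooth[OF K], of "is" "- x"] by simp
  obtain N C where C: "C > 0" and fb: "\<And>\<eta> B. \<eta> \<in> schwartz \<Longrightarrow>
      (\<And>is y. length is \<le> N \<Longrightarrow> (1 + norm y) ^ N * norm (partial_derivs is \<eta> y) \<le> B) \<Longrightarrow> norm (f \<eta>) \<le> C * B"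
    using tempered_bound[OF f] by metis
  obtain A where A: "A > 0" and
    A1: "\<And>is x y. length is \<le> N \<Longrightarrow> (1 + norm y) ^ N * norm (partial_derivs is K (y - x)) \<le> A * (1 + norm x) ^ N" and
    A2: "\<And>is x x' y. length is \<le> N \<Longrightarrow> norm (x - x') \<le> 1 \<Longrightarrow>
      (1 + norm y) ^ N * norm (partial_derivs is K (y - x') - partial_derivs is K (y - x)) \<le> A * (1 + norm x) ^ N * norm (x - x')"
    using translates_bound[OF K, of N] by metis
  have ub: "norm (u x) \<le> C * (A * (1 + norm x) ^ N)" for x
    unfolding u by (rule fb[OF tS]) (simp add: tD A1)
  then show ?growth by (intro exI[of _ N] exI[of _ "C * A"]) (simp add: mult.assoc)
  have ud: "norm (u x' - u x) \<le> C * (A * (1 + norm x) ^ N * norm (x - x'))" if "norm (x - x') \<le> 1" for x x'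
  proof -
    have "u x' - u x = f (\<lambda>y. \<tau> x' y - \<tau> x y)" unfolding u by (rule tempered_diff[OF f tS tS, symmetric])
    also have "norm \<dots> \<le> C * (A * (1 + norm x) ^ N * norm (x - x'))"
      by (rule fb[OF schwartz_diff[OF tS tS]])
        (simp add: partial_derivs_diff[OF schwartz_smooth[OF tS] schwartz_smooth[OF tS]] tD A2 that)
    finally show ?thesis .
  qed
  show cont: ?cont
  proof (rule continuous_at_imp_continuous_on, rule ballI)
    fix x
    have "((\<lambda>x'. u x' - u x) \<longlongrightarrow> 0) (at x)"
    proof (rule Lim_null_comparison)
      show "\<forall>\<^sub>F x' in at x. norm (u x' - u x) \<le> C * (A * (1 + norm x) ^ N * norm (x - x'))"
        unfolding eventually_at
      proof (intro exI[of _ 1] conjI ballI impI)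
        fix x' assume "x' \<noteq> x \<and> dist x' x < 1"
        then show "norm (u x' - u x) \<le> C * (A * (1 + norm x) ^ N * norm (x - x'))"
          by (intro ud) (simp add: dist_norm norm_minus_commute)
      qed simp
      have "((\<lambda>x'. C * (A * (1 + norm x) ^ N * norm (x - x'))) \<longlongrightarrow> C * (A * (1 + norm x) ^ N * norm (x - x))) (at x)"
        by (intro tendsto_intros)
      then show "((\<lambda>x'. C * (A * (1 + norm x) ^ N * norm (x - x'))) \<longlongrightarrow> 0) (at x)" by simp
    qed
    then show "isCont u x" unfolding isCont_def by (rule LIM_zero_cancel)
  qed
  have [measurable]: "u \<in> borel_measurable borel" by (rule borel_measurable_continuous_onI[OF cont])
  have int: "integrable lborel (\<lambda>x. u x * \<eta> x)" if e: "\<eta> \<in> schwartz" for \<eta>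
  proof (rule Bochner_Integration.integrable_bound)
    show "integrable lborel (\<lambda>x. C * A * ((1 + norm x) ^ N * norm (\<eta> x)))"
      by (intro integrable_mult_right schwartz_weight_integrable e)
    have [measurable]: "\<eta> \<in> borel_measurable borel" using e by measurable
    show "(\<lambda>x. u x * \<eta> x) \<in> borel_measurable lborel" by measurable
    show "AE x in lborel. norm (u x * \<eta> x) \<le> norm (C * A * ((1 + norm x) ^ N * norm (\<eta> x)))"
    proof (rule AE_I2)
      fix x
      have "norm (u x * \<eta> x) \<le> C * (A * (1 + norm x) ^ N) * norm (\<eta> x)"
        unfolding norm_mult by (intro mult_right_mono ub) simp
      also have "\<dots> = norm (C * A * ((1 + norm x) ^ N * norm (\<eta> x)))"
        using C A by (simp add: abs_mult)
      finally show "norm (u x * \<eta> x) \<le> norm (C * A * ((1 + norm x) ^ N * norm (\<eta> x)))" .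
    qed
  qed
  then show "\<And>\<eta>. \<eta> \<in> schwartz \<Longrightarrow> integrable lborel (\<lambda>x. u x * \<eta> x)" .
  fix \<eta> :: "real^'n \<Rightarrow> complex"
  assume e: "\<eta> \<in> schwartz"
  have [measurable]: "\<eta> \<in> borel_measurable borel" using e by measurable
  define h where "h = fourier (\<lambda>\<xi>. \<phi> \<xi> * inv_fourier \<eta> \<xi>)"
  have hS: "h \<in> schwartz" unfolding h_def
    by (intro fourier_schwartz schwartz_mult schwartz_slowly_increasing inv_fourier_schwartz e p)
  have hD: "partial_derivs is h y = (LINT x|lborel. \<eta> x * partial_derivs is K (y - x))" for "is" y
    unfolding h_def partial_derivs_fourier_mult_inv[OF e p] KD c_def ..
  define G where "G is y x = \<eta> x * partial_derivs is K (y - x)" for "is" y x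
  have Gc: "continuous_on S (G is y)" for "is" y S
    unfolding G_def
    by (intro continuous_intros continuous_on_compose2[OF schwartz_continuous[OF schwartz_partial_derivs[OF K]]]
        continuous_on_subset[OF schwartz_continuous[OF e]]) auto
  have Gm [measurable]: "G is y \<in> borel_measurable borel" for "is" y
    by (rule borel_measurable_continuous_onI[OF Gc])
  have Gi: "integrable lborel (G is y)" for "is" y
  proof -
    obtain E where E: "\<And>x. norm (partial_derivs is K x) \<le> E"
      using schwartz_boundE0[OF schwartz_partial_derivs[OF K], of 0 "is"] by auto
    show ?thesis
  proof (rule Bochner_Integration.integrable_bound)
    show "integrable lborel (\<lambda>x. norm (\<eta> x) * E)"
      by (intro integrable_mult_left integrable_norm schwartz_integrable e)
    show "AE x in lborel. norm (G is y x) \<le> norm (norm (\<eta> x) * E)"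
    proof (rule AE_I2)
      fix x
      have "norm (G is y x) \<le> norm (\<eta> x) * E" unfolding G_def norm_mult by (intro mult_left_mono E) simp
      also have "\<dots> \<le> norm (norm (\<eta> x) * E)" by simp
      finally show "norm (G is y x) \<le> norm (norm (\<eta> x) * E)" .
    qed
  qed measurable
  qed
  define B where "B n = cbox (\<chi> i. - real n) (\<chi> i. real n :: real^'n)" for n
  have B_sets [measurable]: "B n \<in> sets borel" for n by (auto simp: B_def)
  define W where "W x = (1 + norm x) ^ N * norm (\<eta> x)" for x
  have Wi: "integrable lborel W" unfolding W_def by (rule schwartz_weight_integrable[OF e])
  \<comment> \<open>On a fixed box the Riemann sum error can be made arbitrarily small, so only the
    weighted mass of \<open>\<eta>\<close> outside the box remains; that mass vanishes as the box
    grows.\<close>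
  have key: "norm (f h - (LINT x|lborel. indicator (B n) x *\<^sub>R (u x * \<eta> x)))
      \<le> C * (A * (LINT x|lborel. indicator (- B n) x *\<^sub>R W x))" for n
  proof (rule field_le_epsilon)
    fix \<epsilon> :: real assume \<epsilon>: "\<epsilon> > 0"
    let ?T = "LINT x|lborel. indicator (- B n) x *\<^sub>R W x"
    define V where "V = measure lborel (B n)"
    have V: "V \<ge> 0" by (simp add: V_def)
    \<comment> \<open>Tolerance per unit volume: after multiplication by \<open>C\<close> and the
      volume \<open>V\<close> it stays below \<open>\<epsilon> / 2\<close>. The summand 1 covers
      \<open>V = 0\<close>, which occurs for \<open>n = 0\<close>.\<close>
    define \<omega> where "\<omega> = \<epsilon> / (2 * (C * V + 1))"
    have \<omega>: "\<omega> > 0" unfolding \<omega>_def using C V \<epsilon> by (intro divide_pos_pos) (auto intro!: add_nonneg_pos)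
    obtain \<rho> where \<rho>: "\<And>x. x \<in> B n \<Longrightarrow> norm x \<le> \<rho>"
      using bounded_cbox[of "\<chi> i. - real n" "\<chi> i. real n :: real^'n"] unfolding bounded_iff B_def by auto
    obtain E where E: "E > 0" "\<And>x. norm (\<eta> x) \<le> E" using schwartz_boundE0[OF e, of 0] by auto
    obtain L where L: "L > 0" "\<And>x h. norm h \<le> 1 \<Longrightarrow> (1 + norm x) ^ 0 * norm (\<eta> (x + h) - \<eta> x) \<le> L * norm h"
      using schwartz_lipschitz[OF e, of 0] by metis
    define D where "D = (E + L) * (A * (1 + \<bar>\<rho>\<bar>) ^ N)"
    have D: "D > 0" unfolding D_def using E(1) L(1) A by (intro mult_pos_pos zero_less_power) auto
    have lip: "(1 + norm y) ^ N * norm (G is y x' - G is y x) \<le> D * norm (x - x')"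
      if x: "x \<in> B n" "x' \<in> B n" "norm (x - x') \<le> 1" and l: "length is \<le> N" for "is" x x' y
    proof -
      let ?g = "partial_derivs is K"
      have pw: "A * (1 + norm z) ^ N \<le> A * (1 + \<bar>\<rho>\<bar>) ^ N" if "z \<in> B n" for z
        using \<rho>[OF that] A by (intro mult_left_mono power_mono) auto
      have "G is y x' - G is y x = \<eta> x' * (?g (y - x') - ?g (y - x)) + (\<eta> x' - \<eta> x) * ?g (y - x)"
        by (simp add: G_def algebra_simps)
      then have "(1 + norm y) ^ N * norm (G is y x' - G is y x) \<le>
        (1 + norm y) ^ N * (norm (\<eta> x') * norm (?g (y - x') - ?g (y - x)) + norm (\<eta> x' - \<eta> x) * norm (?g (y - x)))"
        by (intro mult_left_mono) (auto intro!: norm_triangle_le simp: norm_mult)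
      also have "\<dots> = norm (\<eta> x') * ((1 + norm y) ^ N * norm (?g (y - x') - ?g (y - x)))
          + norm (\<eta> x' - \<eta> x) * ((1 + norm y) ^ N * norm (?g (y - x)))"
        by (simp add: algebra_simps)
      also have "\<dots> \<le> E * (A * (1 + \<bar>\<rho>\<bar>) ^ N * norm (x - x')) + (L * norm (x - x')) * (A * (1 + \<bar>\<rho>\<bar>) ^ N)"
      proof (rule add_mono; rule mult_mono)
        show "norm (\<eta> x') \<le> E" by (rule E(2))
        show "(1 + norm y) ^ N * norm (?g (y - x') - ?g (y - x)) \<le> A * (1 + \<bar>\<rho>\<bar>) ^ N * norm (x - x')"
          by (rule order_trans[OF A2[OF l x(3)]]) (intro mult_right_mono pw x(1) norm_ge_zero)
        show "norm (\<eta> x' - \<eta> x) \<le> L * norm (x - x')"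
          using L(2)[of "x' - x" x] x(3) by (simp add: norm_minus_commute)
        show "(1 + norm y) ^ N * norm (?g (y - x)) \<le> A * (1 + \<bar>\<rho>\<bar>) ^ N"
          by (rule order_trans[OF A1[OF l] pw[OF x(1)]])
      qed (use E(1) L(1) A in auto)
      also have "\<dots> = D * norm (x - x')" by (simp add: D_def algebra_simps)
      finally show ?thesis .
    qed
    let ?ue = "\<lambda>x. u x * \<eta> x"
    have hi: "(?ue has_integral integral (B n) ?ue) (B n)"
      unfolding B_def by (intro integrable_integral indicator_integral_eq_HK int e)
    have "\<exists>\<gamma>. gauge \<gamma> \<and> (\<forall>d. d tagged_division_of (B n) \<and> \<gamma> fine d \<longrightarrow>
        norm ((\<Sum>(x, k)\<in>d. measure lborel k *\<^sub>R ?ue x) - integral (B n) ?ue) < \<epsilon> / 2)"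
      using hi[unfolded B_def has_integral, folded B_def, THEN spec, of "\<epsilon> / 2", THEN mp] \<epsilon> by simp
    then obtain \<gamma>1 where \<gamma>1: "gauge \<gamma>1" "\<And>d. d tagged_division_of (B n) \<Longrightarrow> \<gamma>1 fine d \<Longrightarrow>
        norm ((\<Sum>(x, k)\<in>d. measure lborel k *\<^sub>R ?ue x) - integral (B n) ?ue) < \<epsilon> / 2"
      by auto
    define \<delta> where "\<delta> = min 1 (\<omega> / D)"
    have \<delta>: "\<delta> > 0" using \<omega> D by (simp add: \<delta>_def)
    \<comment> \<open>One gauge for two purposes: \<open>\<gamma>1\<close> makes the sum for
      \<open>u x * \<eta> x\<close> accurate, and the balls of radius \<open>\<delta>\<close> keep
      the weighted oscillation of \<open>G\<close> on each cell below \<open>\<omega>\<close>,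
      uniformly in \<open>y\<close> and in the derivatives.\<close>
    define \<gamma> where "\<gamma> x = \<gamma>1 x \<inter> ball x \<delta>" for x
    have "gauge \<gamma>" unfolding \<gamma>_def by (intro gauge_Int \<gamma>1(1) gauge_ball \<delta>)
    then obtain d where d: "d tagged_division_of (B n)" "\<gamma> fine d"
      unfolding B_def by (rule fine_division_exists)
    have fin: "finite d" using d(1) by (rule tagged_division_of_finite)
    have fine1: "\<gamma>1 fine d" using d(2) unfolding \<gamma>_def fine_Int by simp
    have fine2: "k \<subseteq> ball x \<delta>" if "(x, k) \<in> d" for x k
      using fineD[OF d(2) that] by (auto simp: \<gamma>_def)
    \<comment> \<open>The Riemann sum formed from test functions instead of numbers:
      \<open>f \<sigma>\<close> is a Riemann sum of \<open>u x * \<eta> x\<close>, and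
      \<open>\<sigma>\<close> approximates \<open>h\<close>, up to the part outside the box, in the
      seminorms that bound \<open>f\<close>.\<close>
    define \<sigma> where "\<sigma> = (\<lambda>y. \<Sum>t\<in>d. (of_real (measure lborel (snd t)) * \<eta> (fst t)) * \<tau> (fst t) y)"
    have \<sigma>S: "\<sigma> \<in> schwartz" unfolding \<sigma>_def by (intro schwartz_sum schwartz_cmult tS)
    have f\<sigma>: "f \<sigma> = (\<Sum>(x, k)\<in>d. measure lborel k *\<^sub>R ?ue x)"
    proof -
      have "f \<sigma> = (\<Sum>t\<in>d. (of_real (measure lborel (snd t)) * \<eta> (fst t)) * u (fst t))"
        unfolding \<sigma>_def u by (rule tempered_sum[OF f fin tS])
      also have "\<dots> = (\<Sum>(x, k)\<in>d. measure lborel k *\<^sub>R ?ue x)"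
        by (intro sum.cong refl) (simp add: case_prod_beta scaleR_conv_of_real mult_ac)
      finally show ?thesis .
    qed
    have \<sigma>D: "partial_derivs is \<sigma> y = (\<Sum>(x, k)\<in>d. measure lborel k *\<^sub>R G is y x)" for "is" y
    proof -
      have X: "partial_derivs is \<sigma> = (\<lambda>y. \<Sum>t\<in>d. partial_derivs is (\<lambda>y. (of_real (measure lborel (snd t)) * \<eta> (fst t)) * \<tau> (fst t) y) y)"
        unfolding \<sigma>_def by (intro partial_derivs_sum fin schwartz_cmult tS)
      show ?thesis
        unfolding X partial_derivs_cmult[OF schwartz_smooth[OF tS]] tD
        by (intro sum.cong refl) (simp add: case_prod_beta scaleR_conv_of_real G_def mult_ac)
    qed
    have "norm (f (\<lambda>y. h y - \<sigma> y)) \<le> C * (\<omega> * V + A * ?T)"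
    proof (rule fb[OF schwartz_diff[OF hS \<sigma>S]])
      fix "is" :: "'n list" and y :: "real^'n"
      assume l: "length is \<le> N"
      let ?w = "(1 + norm y) ^ N"
      have w: "?w > 0" by (intro zero_less_power add_pos_nonneg) auto
      have split: "partial_derivs is h y = integral (B n) (G is y) + (LINT x|lborel. indicator (- B n) x *\<^sub>R G is y x)"
      proof -
        have "partial_derivs is h y = (LINT x|lborel. indicator (B n) x *\<^sub>R G is y x + indicator (- B n) x *\<^sub>R G is y x)"
          unfolding hD G_def[symmetric]
          by (intro Bochner_Integration.integral_cong refl) (auto simp: indicator_def)
        also have "\<dots> = (LINT x|lborel. indicator (B n) x *\<^sub>R G is y x) + (LINT x|lborel. indicator (- B n) x *\<^sub>R G is y x)"
          by (intro Bochner_Integration.integral_add integrable_mult_indicator Gi) (auto simp: B_def)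
        also have "(LINT x|lborel. indicator (B n) x *\<^sub>R G is y x) = integral (B n) (G is y)"
          unfolding B_def by (rule indicator_integral_eq_HK[OF Gi])
        finally show ?thesis .
      qed
      have "integral (B n) (G is y) = (\<Sum>(x, k)\<in>d. integral k (G is y))"
        using d(1) unfolding B_def by (intro integral_combine_tagged_division_topdown integrable_continuous Gc)
      then have I: "integral (B n) (G is y) - partial_derivs is \<sigma> y = (\<Sum>t\<in>d. integral (snd t) (G is y) - measure lborel (snd t) *\<^sub>R G is y (fst t))"
        unfolding \<sigma>D by (simp add: sum_subtractf case_prod_beta)
      have "norm (integral (B n) (G is y) - partial_derivs is \<sigma> y) \<le> (\<Sum>t\<in>d. \<omega> / ?w * measure lborel (snd t))"
        unfolding I
      proof (rule sum_norm_le)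
        fix t assume "t \<in> d"
        then obtain x k where t: "t = (x, k)" "(x, k) \<in> d" by (cases t) auto
        obtain a b where k: "k = cbox a b" using tagged_division_ofD(4)[OF d(1) t(2)] by auto
        have xk: "x \<in> k" and kB: "k \<subseteq> B n" using tagged_division_ofD(2,3)[OF d(1) t(2)] by auto
        have "((\<lambda>z. G is y z - G is y x) has_integral (integral k (G is y) - measure lborel k *\<^sub>R G is y x)) k"
          unfolding k by (intro has_integral_diff integrable_integral integrable_continuous Gc has_integral_const)
        moreover have "norm (G is y z - G is y x) \<le> \<omega> / ?w" if z: "z \<in> k" for z
        proof -
          have "norm (x - z) < \<delta>" using fine2[OF t(2)] z by (auto simp: dist_norm)
          then have n: "norm (x - z) \<le> 1" "norm (x - z) \<le> \<omega> / D" by (auto simp: \<delta>_def)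
          have "?w * norm (G is y z - G is y x) \<le> D * norm (x - z)"
            using xk z kB by (intro lip n l) auto
          also have "\<dots> \<le> D * (\<omega> / D)" using n D by (intro mult_left_mono) auto
          finally have "?w * norm (G is y z - G is y x) \<le> \<omega>" using D by simp
          then show ?thesis by (rule le_divide_if_mult_le[OF w])
        qed
        ultimately have "norm (integral k (G is y) - measure lborel k *\<^sub>R G is y x) \<le> \<omega> / ?w * measure lborel (cbox a b)"
          using \<omega> w unfolding k by (intro has_integral_bound[where f = "\<lambda>z. G is y z - G is y x"]) auto
        then show "norm (integral (snd t) (G is y) - measure lborel (snd t) *\<^sub>R G is y (fst t)) \<le> \<omega> / ?w * measure lborel (snd t)"
          by (simp add: t k)
      qed
      also have "\<dots> = \<omega> / ?w * V"
        using additive_content_tagged_division[of d, OF d(1)[unfolded B_def]]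
        unfolding V_def B_def sum_distrib_left[symmetric] by (simp add: case_prod_beta)
      finally have 1: "?w * norm (integral (B n) (G is y) - partial_derivs is \<sigma> y) \<le> \<omega> * V"
        by (rule mult_le_if_le_divide[OF w])
      have "norm (LINT x|lborel. indicator (- B n) x *\<^sub>R G is y x) \<le> (LINT x|lborel. A / ?w * (indicator (- B n) x *\<^sub>R W x))"
      proof (rule Bochner_Integration.integral_norm_bound_integral)
        show "integrable lborel (\<lambda>x. indicator (- B n) x *\<^sub>R G is y x)"
          by (intro integrable_mult_indicator Gi) (auto simp: B_def)
        show "integrable lborel (\<lambda>x. A / ?w * (indicator (- B n) x *\<^sub>R W x))"
          by (intro integrable_mult_right integrable_mult_indicator Wi) (auto simp: B_def)
        fix x
        have "norm (partial_derivs is K (y - x)) \<le> A * (1 + norm x) ^ N / ?w"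
          by (rule le_divide_if_mult_le[OF w A1[OF l]])
        then have "norm (G is y x) \<le> norm (\<eta> x) * (A * (1 + norm x) ^ N / ?w)"
          unfolding G_def norm_mult by (intro mult_left_mono) auto
        also have "\<dots> = A / ?w * W x" by (simp add: W_def)
        finally show "norm (indicator (- B n) x *\<^sub>R G is y x) \<le> A / ?w * (indicator (- B n) x *\<^sub>R W x)"
          by (simp add: indicator_def)
      qed
      also have "\<dots> = A / ?w * ?T" by simp
      finally have 2: "?w * norm (LINT x|lborel. indicator (- B n) x *\<^sub>R G is y x) \<le> A * ?T"
        by (rule mult_le_if_le_divide[OF w])
      have "partial_derivs is (\<lambda>y. h y - \<sigma> y) y =
         (integral (B n) (G is y) - partial_derivs is \<sigma> y) + (LINT x|lborel. indicator (- B n) x *\<^sub>R G is y x)"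
        unfolding partial_derivs_diff[OF schwartz_smooth[OF hS] schwartz_smooth[OF \<sigma>S]] split by simp
      then have "?w * norm (partial_derivs is (\<lambda>y. h y - \<sigma> y) y) \<le>
         ?w * (norm (integral (B n) (G is y) - partial_derivs is \<sigma> y) + norm (LINT x|lborel. indicator (- B n) x *\<^sub>R G is y x))"
        using w by (intro mult_left_mono) (auto intro: norm_triangle_ineq)
      also have "\<dots> \<le> \<omega> * V + A * ?T" using 1 2 by (simp add: distrib_left)
      finally show "?w * norm (partial_derivs is (\<lambda>y. h y - \<sigma> y) y) \<le> \<omega> * V + A * ?T" .
    qed
    then have "norm (f h - f \<sigma>) \<le> C * (\<omega> * V + A * ?T)"
      by (simp only: tempered_diff[OF f hS \<sigma>S])
    moreover have "norm (f \<sigma> - integral (B n) ?ue) < \<epsilon> / 2" unfolding f\<sigma> by (rule \<gamma>1(2)[OF d(1) fine1])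
    moreover have "C * (\<omega> * V + A * ?T) \<le> \<epsilon> / 2 + C * (A * ?T)"
    proof -
      have "C * V * \<omega> = (\<epsilon> / 2) * (C * V / (C * V + 1))" by (simp add: \<omega>_def)
      also have "\<dots> \<le> (\<epsilon> / 2) * 1" using C V \<epsilon> by (intro mult_left_mono) (auto simp: divide_le_eq_1 add_nonneg_pos)
      finally show ?thesis by (simp add: distrib_left mult_ac)
    qed
    moreover have "norm (f h - integral (B n) ?ue) \<le> norm (f h - f \<sigma>) + norm (f \<sigma> - integral (B n) ?ue)"
      by norm
    ultimately have "norm (f h - integral (B n) ?ue) \<le> C * (A * ?T) + \<epsilon>" by linarith
    then show "norm (f h - (LINT x|lborel. indicator (B n) x *\<^sub>R ?ue x)) \<le> C * (A * ?T) + \<epsilon>"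
      unfolding B_def indicator_integral_eq_HK(1)[OF int[OF e]] .
  qed
  have "(\<lambda>n. f h - (LINT x|lborel. indicator (B n) x *\<^sub>R (u x * \<eta> x))) \<longlonglongrightarrow> 0"
  proof (rule Lim_null_comparison)
    show "\<forall>\<^sub>F n in sequentially. norm (f h - (LINT x|lborel. indicator (B n) x *\<^sub>R (u x * \<eta> x)))
      \<le> C * (A * (LINT x|lborel. indicator (- B n) x *\<^sub>R W x))" by (intro always_eventually allI key)
    have "(\<lambda>n. C * (A * (LINT x|lborel. indicator (- B n) x *\<^sub>R W x))) \<longlonglongrightarrow> C * (A * 0)"
      unfolding B_def by (intro tendsto_mult tendsto_const tail_integral_tendsto(1) Wi)
    then show "(\<lambda>n. C * (A * (LINT x|lborel. indicator (- B n) x *\<^sub>R W x))) \<longlonglongrightarrow> 0" by simp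
  qed
  moreover have "(\<lambda>n. f h - (LINT x|lborel. indicator (B n) x *\<^sub>R (u x * \<eta> x))) \<longlonglongrightarrow> f h - (LINT x|lborel. u x * \<eta> x)"
    unfolding B_def by (intro tendsto_diff tendsto_const tail_integral_tendsto(2) int e)
  ultimately have "f h - (LINT x|lborel. u x * \<eta> x) = 0" by (rule LIMSEQ_unique[symmetric])
  then show "f (fourier (\<lambda>\<xi>. \<phi> \<xi> * inv_fourier \<eta> \<xi>)) = (LINT x|lborel. u x * \<eta> x)" by (simp add: h_def)
qed

section \<open>Blocks as uniquely determined continuous functions\<close>

lemma test_function_support:
  assumes "test_function f"
  obtains R where "R > 0" "\<And>x. f x \<noteq> 0 \<Longrightarrow> norm x \<le> R"
proof -
  have "bounded (closure {x. f x \<noteq> 0})" using assms by (simp add: test_function_def compact_imp_bounded)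
  then obtain R where R: "R > 0" "\<forall>x\<in>closure {x. f x \<noteq> 0}. norm x \<le> R" unfolding bounded_pos by blast
  show ?thesis
  proof (rule that[OF R(1)])
    fix x assume "f x \<noteq> 0"
    then have "x \<in> closure {x. f x \<noteq> 0}" using closure_subset[of "{x. f x \<noteq> 0}"] by auto
    then show "norm x \<le> R" using R(2) by simp
  qed
qed

text \<open>Near a point \<open>x0\<close> with \<open>w x0 \<noteq> 0\<close> the real part of
  \<open>cnj (w x0) * w x\<close> is positive; testing with the squared modulus of a copy of
  \<open>\<theta>\<close> squeezed into that neighbourhood yields a continuous nonnegative function
  of integral 0 that is positive at \<open>x0\<close>. The cutoff \<open>\<psi>\<close> itself later
  takes the role of \<open>\<theta>\<close>, so no bump function is constructed.\<close>

lemma continuous_null_distribution: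
  fixes w \<theta> :: "real^'n::finite \<Rightarrow> complex"
  assumes t: "test_function \<theta>" and t0: "\<theta> 0 \<noteq> 0" and c: "continuous_on UNIV w"
    and z: "\<And>\<eta>. \<eta> \<in> schwartz \<Longrightarrow> integrable lborel (\<lambda>x. w x * \<eta> x) \<and> (LINT x|lborel. w x * \<eta> x) = 0"
  shows "w x0 = 0"
proof (rule ccontr)
  assume w0: "w x0 \<noteq> 0"
  define W where "W x = Re (cnj (w x0) * w x)" for x
  have Wc: "continuous_on UNIV W" unfolding W_def by (intro continuous_intros c)
  have W0: "W x0 > 0" using w0 unfolding W_def by (simp add: complex_mult_cnj mult.commute[of "cnj _"] cmod_power2[symmetric])
  have "open {x. W x > 0}" by (intro open_Collect_less continuous_on_const Wc)
  then obtain \<delta> where \<delta>: "\<delta> > 0" "\<And>x. dist x x0 < \<delta> \<Longrightarrow> W x > 0"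
    using W0 unfolding open_dist by (metis mem_Collect_eq)
  obtain R where R: "R > 0" "\<And>x. \<theta> x \<noteq> 0 \<Longrightarrow> norm x \<le> R" using test_function_support[OF t] by metis
  note tS = test_function_schwartz[OF t]
  \<comment> \<open>The dilation shrinks the support, of radius at most \<open>R\<close>, to radius
    \<open>\<delta> / 2\<close>.\<close>
  define r where "r = 2 * R / \<delta>"
  have r: "r > 0" using R \<delta> by (simp add: r_def)
  define \<eta> where "\<eta> = (\<lambda>x. \<theta> (r *\<^sub>R (x - x0)) * cnj (\<theta> (r *\<^sub>R (x - x0))))"
  have \<eta>_eq: "\<eta> x = of_real ((norm (\<theta> (r *\<^sub>R (x - x0))))\<^sup>2)" for x
    unfolding \<eta>_def complex_norm_square ..
  have "(\<lambda>x. \<theta> (r *\<^sub>R (x - x0))) \<in> schwartz"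
    using schwartz_affine[OF tS, of "\<lambda>i. r" "- (r *\<^sub>R x0)"] r by (simp add: diag_map_const scaleR_diff_right)
  then have \<eta>: "\<eta> \<in> schwartz"
    unfolding \<eta>_def by (intro schwartz_mult schwartz_slowly_increasing schwartz_cnj)
  define g where "g x = Re (cnj (w x0) * (w x * \<eta> x))" for x
  have g_eq: "g x = W x * (norm (\<theta> (r *\<^sub>R (x - x0))))\<^sup>2" for x
  proof -
    have R: "Re (z * of_real t) = Re z * t" for z t by simp
    show ?thesis unfolding g_def W_def \<eta>_eq mult.assoc[symmetric] by (rule R)
  qed
  have int: "integrable lborel (\<lambda>x. cnj (w x0) * (w x * \<eta> x))"
    by (intro integrable_mult_right) (use z[OF \<eta>] in auto)
  have "g x0 = 0"
  proof (rule continuous_nonneg_integral_eq_0)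
    show "continuous_on UNIV g" unfolding g_def by (intro continuous_intros c schwartz_continuous \<eta>)
    show "integrable lborel g" unfolding g_def by (intro integrable_Re int)
    have "(LINT x|lborel. g x) = Re (LINT x|lborel. cnj (w x0) * (w x * \<eta> x))"
      unfolding g_def by (rule integral_Re[OF int])
    also have "\<dots> = 0" using z[OF \<eta>] by simp
    finally show "(LINT x|lborel. g x) = 0" .
    fix x
    show "0 \<le> g x"
    proof (cases "\<theta> (r *\<^sub>R (x - x0)) = 0")
      case False
      then have "r * norm (x - x0) \<le> R" using R(2)[of "r *\<^sub>R (x - x0)"] r by simp
      then have "norm (x - x0) \<le> \<delta> / 2" using R(1) \<delta>(1) by (simp add: r_def field_simps)
      then have "dist x x0 < \<delta>" using \<delta>(1) by (simp add: dist_norm)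
      then show ?thesis using \<delta>(2)[of x] by (simp add: g_eq)
    qed (simp add: g_eq)
  qed
  then show False using W0 t0 by (simp add: g_eq)
qed

lemma function_of_distr_eqI:
  fixes u \<theta> :: "real^'n::finite \<Rightarrow> complex"
  assumes t: "test_function \<theta>" "\<theta> 0 \<noteq> 0" and c: "continuous_on UNIV u"
    and u: "\<And>\<eta>. \<eta> \<in> schwartz \<Longrightarrow> integrable lborel (\<lambda>x. u x * \<eta> x)"
       "\<And>\<eta>. \<eta> \<in> schwartz \<Longrightarrow> T \<eta> = (LINT x|lborel. u x * \<eta> x)"
  shows "function_of_distr T = u"
  unfolding function_of_distr_def
proof (rule the_equality)
  fix v
  assume v: "continuous_on UNIV v \<and> (\<forall>\<eta>\<in>schwartz. integrable lborel (\<lambda>x. v x * \<eta> x) \<and> T \<eta> = (LINT x|lborel. v x * \<eta> x))"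
  have "v x - u x = 0" for x
  proof (rule continuous_null_distribution[OF t])
    show "continuous_on UNIV (\<lambda>x. v x - u x)" using v c by (intro continuous_on_diff) auto
    fix \<eta> :: "real^'n \<Rightarrow> complex" assume e: "\<eta> \<in> schwartz"
    have i: "integrable lborel (\<lambda>x. v x * \<eta> x)" "T \<eta> = (LINT x|lborel. v x * \<eta> x)" using v e by auto
    show "integrable lborel (\<lambda>x. (v x - u x) * \<eta> x) \<and> (LINT x|lborel. (v x - u x) * \<eta> x) = 0"
      using i u[OF e] by (simp add: left_diff_distrib)
  qed
  then show "v = u" by auto
qed (use c u in auto)

text \<open>Unfolding the transposed operations, the distribution tested with \<open>\<eta>\<close>
  is \<open>f\<close> applied to \<open>fourier (\<lambda>\<xi>. \<phi> \<xi> * inv_fourier \<eta>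
  \<xi>)\<close>, with \<open>\<phi>\<close> the dyadic piece. The convolution formula represents it
  by a continuous function, and uniqueness evaluates the definite description.\<close>

lemma freq_block_eq:
  fixes f :: "'n::finite distr" and \<theta> :: "real^'n \<Rightarrow> complex"
  assumes t: "test_function \<theta>" "\<theta> 0 \<noteq> 0" and f: "f \<in> tempered_distributions"
    and p: "dyadic_piece a \<psi> j \<in> schwartz"
  shows "freq_block a \<psi> j f
    = (\<lambda>x. f (\<lambda>y. fourier (dyadic_piece a \<psi> j) (y - x) / of_real ((2 * pi) ^ CARD('n))))"
  unfolding freq_block_def
proof (rule function_of_distr_eqI[OF t])
  fix \<eta> :: "real^'n \<Rightarrow> complex" assume e: "\<eta> \<in> schwartz"
  have 1: "inv_fourier \<eta> \<in> schwartz" by (rule inv_fourier_schwartz[OF e])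
  have 2: "(\<lambda>x. dyadic_piece a \<psi> j x * inv_fourier \<eta> x) \<in> schwartz"
    by (intro schwartz_mult schwartz_slowly_increasing 1 p)
  have "inv_fourier_distr (mult_distr (dyadic_piece a \<psi> j) (fourier_distr f)) \<eta>
     = f (fourier (\<lambda>x. dyadic_piece a \<psi> j x * inv_fourier \<eta> x))"
    using e 1 2 by (simp add: inv_fourier_distr_def mult_distr_def fourier_distr_def)
  then show "inv_fourier_distr (mult_distr (dyadic_piece a \<psi> j) (fourier_distr f)) \<eta> =
    (LINT x|lborel. f (\<lambda>y. fourier (dyadic_piece a \<psi> j) (y - x) / of_real ((2 * pi) ^ CARD('n))) * \<eta> x)"
    using tempered_convolution(4)[OF f p e] by simp
qed (rule tempered_convolution[OF f p])+

text \<open>The pairing formula is tested with the translate of \<open>fourier \<gamma>\<close> to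
  \<open>x0\<close>. Its inverse transform is \<open>\<kappa>\<close> times a character times
  \<open>\<gamma>\<close>, and \<open>\<gamma>\<close> is invisible next to \<open>\<phi>\<close>;
  so \<open>f\<close> is applied to a multiple of the kernel that defines \<open>u x0\<close>.
  Dividing by the multiple uses \<open>\<kappa> \<noteq> 0\<close>.\<close>

lemma reproducing_formula:
  fixes f :: "'n::finite distr" and \<phi> \<gamma> :: "real^'n \<Rightarrow> complex"
  assumes f: "f \<in> tempered_distributions" and p: "\<phi> \<in> schwartz" and g: "\<gamma> \<in> schwartz"
    and pg: "\<And>\<xi>. \<phi> \<xi> * \<gamma> \<xi> = \<phi> \<xi>"
    and k0: "\<kappa> \<noteq> 0" and k: "\<And>x. inv_fourier (fourier \<gamma>) x = \<kappa> * \<gamma> x"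
  defines "u \<equiv> \<lambda>x. f (\<lambda>y. fourier \<phi> (y - x) / of_real ((2 * pi) ^ CARD('n)))"
  shows "u x0 = (1 / (\<kappa> * of_real ((2 * pi) ^ CARD('n)))) * (LINT x|lborel. u x * fourier \<gamma> (x - x0))"
proof -
  define c where "c = complex_of_real ((2 * pi) ^ CARD('n))"
  have c: "c \<noteq> 0" by (simp add: c_def)
  note Fg = fourier_schwartz[OF g] and Fp = fourier_schwartz[OF p]
  have e: "(\<lambda>x. fourier \<gamma> (x - x0)) \<in> schwartz"
    using schwartz_translate[OF Fg, of "- x0"] by simp
  have "\<phi> \<xi> * inv_fourier (\<lambda>x. fourier \<gamma> (x - x0)) \<xi> = \<kappa> * (cis (\<xi> \<bullet> x0) * \<phi> \<xi>)" for \<xi>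
  proof -
    have "inv_fourier (\<lambda>x. fourier \<gamma> (x - x0)) \<xi> = cis (\<xi> \<bullet> x0) * inv_fourier (fourier \<gamma>) \<xi>"
      using fourier_translate[OF schwartz_measurable[OF Fg], of "- x0" "- \<xi>"]
      by (simp add: inv_fourier_fourier inner_commute)
    then have "\<phi> \<xi> * inv_fourier (\<lambda>x. fourier \<gamma> (x - x0)) \<xi> = \<kappa> * (cis (\<xi> \<bullet> x0) * (\<phi> \<xi> * \<gamma> \<xi>))"
      by (simp add: k)
    then show ?thesis by (simp add: pg)
  qed
  then have "fourier (\<lambda>\<xi>. \<phi> \<xi> * inv_fourier (\<lambda>x. fourier \<gamma> (x - x0)) \<xi>) y = (\<kappa> * c) * (fourier \<phi> (y - x0) / c)" for y
  proof -
    assume *: "\<And>\<xi>. \<phi> \<xi> * inv_fourier (\<lambda>x. fourier \<gamma> (x - x0)) \<xi> = \<kappa> * (cis (\<xi> \<bullet> x0) * \<phi> \<xi>)"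
    have "fourier (\<lambda>\<xi>. \<phi> \<xi> * inv_fourier (\<lambda>x. fourier \<gamma> (x - x0)) \<xi>) y = \<kappa> * fourier (\<lambda>\<xi>. cis (\<xi> \<bullet> x0) * \<phi> \<xi>) y"
      unfolding * unfolding fourier_def by (simp add: mult.left_commute[of _ \<kappa>])
    then show ?thesis using c by (simp add: fourier_modulate)
  qed
  then have "f (fourier (\<lambda>\<xi>. \<phi> \<xi> * inv_fourier (\<lambda>x. fourier \<gamma> (x - x0)) \<xi>)) = f (\<lambda>y. (\<kappa> * c) * (fourier \<phi> (y - x0) / c))"
    by presburger
  also have "\<dots> = (\<kappa> * c) * u x0"
  proof -
    have "(\<lambda>y. (1 / c) * fourier \<phi> (y + (- x0))) \<in> schwartz"
      by (intro schwartz_cmult schwartz_translate Fp)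
    then have "(\<lambda>y. fourier \<phi> (y - x0) / c) \<in> schwartz" by simp
    from tempered_cmult[OF f this, of "\<kappa> * c"] show ?thesis by (simp only: u_def c_def)
  qed
  finally have "(\<kappa> * c) * u x0 = (LINT x|lborel. u x * fourier \<gamma> (x - x0))"
    using tempered_convolution(4)[OF f p e] unfolding u_def by simp
  then show ?thesis using c k0 unfolding c_def[symmetric] by (simp add: field_simps)
qed

subsection \<open>Anisotropic dilations\<close>

lemma anisotropy_ge_1: "anisotropy a \<Longrightarrow> a $ i \<ge> 1"
  unfolding anisotropy_def by (metis Min_le UNIV_I finite finite_imageI image_eqI)

lemma aniso_size_pos: "anisotropy a \<Longrightarrow> aniso_size a > 0"
  unfolding aniso_size_def using anisotropy_ge_1[of a] by (intro sum_pos) (auto intro: less_le_trans[of 0 1])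

text \<open>The defining sum \<open>F t\<close> is strictly decreasing, which makes the description
  unique. It is at most 1 at \<open>t = 1\<close>, and at least 1 at
  \<open>t = \<bar>x $ i\<bar>\<close> for a nonzero coordinate since \<open>a $ i \<ge> 1\<close>;
  the intermediate value theorem yields a root that is at most 1. Hence every cutoff equals 1 on the
  Euclidean unit ball.\<close>

lemma aniso_norm_le_1:
  assumes a: "anisotropy a" and x: "norm x \<le> 1"
  shows "aniso_norm a x \<le> 1"
proof (cases "x = 0")
  case False
  define F where "F t = (\<Sum>i\<in>UNIV. (x $ i)\<^sup>2 / t powr (2 * a $ i))" for t
  obtain i where i: "x $ i \<noteq> 0" using False by (auto simp: vec_eq_iff)
  have xi: "\<bar>x $ i\<bar> \<le> 1" using component_le_norm_cart[of x i] x by linarith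
  have dec: "F t < F s" if "0 < s" "s < t" for s t
    unfolding F_def
  proof (rule sum_strict_mono_ex1)
    have le: "s powr (2 * a $ k) < t powr (2 * a $ k)" "0 < s powr (2 * a $ k)" for k
      using that anisotropy_ge_1[OF a, of k] by (auto intro!: powr_less_mono2)
    show "\<forall>k\<in>UNIV. (x $ k)\<^sup>2 / t powr (2 * a $ k) \<le> (x $ k)\<^sup>2 / s powr (2 * a $ k)"
      using le by (intro ballI divide_left_mono) (auto simp: less_imp_le intro!: mult_pos_pos less_trans[OF le(2) le(1)])
    show "\<exists>k\<in>UNIV. (x $ k)\<^sup>2 / t powr (2 * a $ k) < (x $ k)\<^sup>2 / s powr (2 * a $ k)"
      using le[of i] i by (intro bexI[of _ i] divide_strict_left_mono) (auto intro!: mult_pos_pos less_trans[OF le(2) le(1)])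
  qed simp
  have "F 1 \<le> 1"
  proof -
    have "F 1 = (norm x)\<^sup>2" by (simp add: F_def norm_vec_def L2_set_def sum_nonneg)
    then show ?thesis using x by (simp add: power_le_one)
  qed
  moreover have "1 \<le> F \<bar>x $ i\<bar>"
  proof -
    have "\<bar>x $ i\<bar> powr (2 * a $ i) \<le> \<bar>x $ i\<bar> powr 2"
      using xi i anisotropy_ge_1[OF a, of i] by (intro powr_mono') auto
    then have "\<bar>x $ i\<bar> powr (2 * a $ i) \<le> (x $ i)\<^sup>2" using i by simp
    then have "1 \<le> (x $ i)\<^sup>2 / \<bar>x $ i\<bar> powr (2 * a $ i)" using i by (simp add: le_divide_eq_1)
    also have "\<dots> \<le> F \<bar>x $ i\<bar>" unfolding F_def
      by (rule member_le_sum) auto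
    finally show ?thesis .
  qed
  moreover have "continuous_on {\<bar>x $ i\<bar>..1} F"
    unfolding F_def using i by (intro continuous_intros) auto
  ultimately obtain t where t: "\<bar>x $ i\<bar> \<le> t" "t \<le> 1" "F t = 1"
    using IVT2'[of F 1 1 "\<bar>x $ i\<bar>"] xi by auto
  have tp: "t > 0" using t(1) i by linarith
  have "aniso_norm a x = (THE t. t > 0 \<and> F t = 1)" using False by (simp add: aniso_norm_def F_def)
  also have "\<dots> = t"
  proof (rule the_equality)
    fix s assume s: "s > 0 \<and> F s = 1"
    show "s = t"
    proof (rule ccontr)
      assume "s \<noteq> t"
      then consider "s < t" | "t < s" by linarith
      then show False using dec[of s t] dec[of t s] s t tp by cases auto
    qed
  qed (use t tp in auto)
  finally show ?thesis using t(2) by simp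
qed (simp add: aniso_norm_def)

lemma aniso_dil_diag_map: "aniso_dil a t = diag_map (\<lambda>i. t powr (a $ i))"
  by (rule ext) (simp add: aniso_dil_def diag_map_def)

text \<open>Acts on frequencies and positions alike: it carries the support of the
  \<open>j\<close>-th piece into a fixed ball, and a block read in the dilated variable is
  reproduced by a kernel without \<open>j\<close>. Being diagonal it is self-adjoint, so it passes
  through the inner product in the exponential.\<close>

definition dyadic_dil :: "real^'n::finite \<Rightarrow> nat \<Rightarrow> real^'n \<Rightarrow> real^'n" where
  "dyadic_dil a j = diag_map (\<lambda>i. 2 powr (- (real j * a $ i)))"

lemma dyadic_dil_aniso: "aniso_dil a (2 powr (- real j)) = dyadic_dil a j"
  unfolding aniso_dil_diag_map dyadic_dil_def by (simp add: powr_powr)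

lemma norm_diag_map_mono:
  assumes "\<And>i. \<bar>d i\<bar> \<le> \<bar>e i\<bar>" shows "norm (diag_map d x) \<le> norm (diag_map e x)"
  by (rule norm_le_componentwise_cart) (simp add: abs_mult mult_right_mono assms)

lemma dyadic_piece_schwartz:
  assumes "test_function \<psi>" shows "dyadic_piece a \<psi> j \<in> schwartz"
proof -
  note p = test_function_schwartz[OF assms]
  have d: "(\<lambda>x. \<psi> (aniso_dil a t x)) \<in> schwartz" if "t > 0" for t
    using schwartz_affine[OF p, of "\<lambda>i. t powr (a $ i)" 0] that by (simp add: aniso_dil_diag_map)
  show ?thesis
  proof (cases "j = 0")
    case True
    then have "dyadic_piece a \<psi> j = \<psi>" by (auto simp: dyadic_piece_def)
    then show ?thesis using p by simp
  next
    case False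
    then have "dyadic_piece a \<psi> j = (\<lambda>x. \<psi> (aniso_dil a (2 powr (- real j)) x) - \<psi> (aniso_dil a (2 powr (- real j + 1)) x))"
      by (auto simp: dyadic_piece_def)
    then show ?thesis by (simp add: schwartz_diff d)
  qed
qed

text \<open>As the entries of \<open>a\<close> are at least 1, the dilation by 2^(-j) contracts at
  least as strongly as that by 2^(-j+1), so both terms of the difference lead to the ball of radius
  \<open>R\<close>.\<close>

lemma dyadic_piece_support:
  assumes a: "anisotropy a" and R: "\<And>x. \<psi> x \<noteq> 0 \<Longrightarrow> norm x \<le> R"
    and x: "dyadic_piece a \<psi> j x \<noteq> 0"
  shows "norm (dyadic_dil a j x) \<le> R"
proof (cases "j = 0")
  case True
  then have "dyadic_dil a j x = x" by (simp add: dyadic_dil_def)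
  then show ?thesis using True x R[of x] by (simp add: dyadic_piece_def)
next
  case False
  then have "\<psi> (dyadic_dil a j x) \<noteq> 0 \<or> \<psi> (aniso_dil a (2 powr (- real j + 1)) x) \<noteq> 0"
    using x by (auto simp: dyadic_piece_def dyadic_dil_aniso)
  then show ?thesis
  proof
    assume "\<psi> (aniso_dil a (2 powr (- real j + 1)) x) \<noteq> 0"
    then have "norm (aniso_dil a (2 powr (- real j + 1)) x) \<le> R" by (rule R)
    moreover have "norm (dyadic_dil a j x) \<le> norm (aniso_dil a (2 powr (- real j + 1)) x)"
      unfolding dyadic_dil_def aniso_dil_diag_map
    proof (rule norm_diag_map_mono)
      fix i
      have "- (real j * a $ i) \<le> (- real j + 1) * a $ i" using anisotropy_ge_1[OF a, of i] by (simp add: algebra_simps)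
      then show "\<bar>2 powr (- (real j * a $ i))\<bar> \<le> \<bar>(2 powr (- real j + 1)) powr (a $ i)\<bar>"
        by (simp add: powr_powr)
    qed
    ultimately show ?thesis by linarith
  qed (rule R)
qed

lemma dyadic_dil_det: "(\<Prod>i\<in>UNIV. \<bar>2 powr (- (real j * a $ i))\<bar>) = 2 powr (- (real j * aniso_size a))"
  by (simp add: aniso_size_def sum_distrib_left sum_negf powr_sum flip: powr_sum)

lemma fourier_diag_map:
  fixes g :: "real^'n::finite \<Rightarrow> complex"
  assumes d: "\<And>i. d i \<noteq> 0" and [measurable]: "g \<in> borel_measurable borel"
  shows "fourier g \<xi> = of_real (\<Prod>i\<in>UNIV. \<bar>d i\<bar>) * fourier (\<lambda>x. g (diag_map d x)) (diag_map d \<xi>)"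
proof -
  have "fourier g \<xi> = (\<Prod>i\<in>UNIV. \<bar>d i\<bar>) *\<^sub>R (LINT x|lborel. cis (- ((diag_map d x + 0) \<bullet> \<xi>)) * g (diag_map d x + 0))"
    unfolding fourier_def
  proof (rule integral_diag_map[OF d])
    show "(\<lambda>x. cis (- (x \<bullet> \<xi>)) * g x) \<in> borel_measurable borel" unfolding cis_conv_exp by measurable
  qed
  moreover have "diag_map d x \<bullet> \<xi> = x \<bullet> diag_map d \<xi>" for x by (simp add: inner_vec_sum mult_ac)
  ultimately show ?thesis by (simp add: fourier_def scaleR_conv_of_real)
qed

text \<open>One kernel \<open>M\<close> for all \<open>j\<close> and \<open>f\<close> is what makes
  the later constants uniform. Dilating \<open>\<gamma>\<close> by 2^(-ja) gives a function equal to
  1 on the support of the \<open>j\<close>-th piece; after substituting the dilated variable, the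
  Jacobian turns the transform of this function back into that of \<open>\<gamma>\<close>.\<close>

lemma block_reproducing:
  fixes a :: "real^'n::finite" and \<psi> :: "real^'n \<Rightarrow> complex"
  assumes a: "anisotropy a" and \<psi>: "cutoff a \<psi>"
  shows "\<exists>M\<in>schwartz. \<forall>f\<in>tempered_distributions. \<forall>j x0. freq_block a \<psi> j f (dyadic_dil a j x0)
       = (LINT x|lborel. freq_block a \<psi> j f (dyadic_dil a j x) * M (x - x0))"
proof -
  have t: "test_function \<psi>" using \<psi> by (simp add: cutoff_def)
  have one: "\<psi> x = 1" if "norm x \<le> 1" for x
    using \<psi> aniso_norm_le_1[OF a that] by (simp add: cutoff_def)
  have t0: "\<psi> 0 \<noteq> 0" using one[of 0] by simp
  obtain R where R: "R > 0" "\<And>x. \<psi> x \<noteq> 0 \<Longrightarrow> norm x \<le> R" using test_function_support[OF t] by metis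
  define c where "c = complex_of_real ((2 * pi) ^ CARD('n))"
  obtain \<kappa> where k0: "\<kappa> \<noteq> 0" and k: "\<And>(\<gamma> :: real^'n \<Rightarrow> complex) x. \<gamma> \<in> schwartz \<Longrightarrow> inv_fourier (fourier \<gamma>) x = \<kappa> * \<gamma> x"
    using fourier_inversion[OF test_function_schwartz[OF t] t0] by metis
  \<comment> \<open>\<open>\<psi>\<close> equals 1 on the Euclidean unit ball, so stretching it by
    \<open>R\<close> yields 1 on the ball that contains the dilated supports of all pieces.\<close>
  define \<gamma> where "\<gamma> x = \<psi> (inverse R *\<^sub>R x)" for x
  have gS: "\<gamma> \<in> schwartz"
    using schwartz_affine[OF test_function_schwartz[OF t], of "\<lambda>i. inverse R" 0] R(1) unfolding \<gamma>_def by (simp add: diag_map_const)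
  have g1: "\<gamma> x = 1" if "norm x \<le> R" for x
    unfolding \<gamma>_def using that R(1) by (intro one) (simp add: field_simps)
  define M where "M z = (1 / (\<kappa> * c)) * fourier \<gamma> z" for z
  show ?thesis
  proof (intro bexI[of _ M] ballI allI)
    show "M \<in> schwartz" unfolding M_def by (intro schwartz_cmult fourier_schwartz gS)
    fix f :: "'n distr" and j x0
    assume f: "f \<in> tempered_distributions"
    define d where "d i = 2 powr (- (real j * a $ i))" for i :: 'n
    have d: "d i \<noteq> 0" for i by (simp add: d_def)
    have "d = (\<lambda>i. 2 powr (- (real j * a $ i)))" by (rule ext) (simp add: d_def)
    then have dd: "dyadic_dil a j = diag_map d" by (simp add: dyadic_dil_def)
    define P where "P = (\<Prod>i\<in>UNIV. \<bar>d i\<bar>)"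
    define \<phi> where "\<phi> = dyadic_piece a \<psi> j"
    have pS: "\<phi> \<in> schwartz" unfolding \<phi>_def by (rule dyadic_piece_schwartz[OF t])
    define u where "u = freq_block a \<psi> j f"
    have u: "u = (\<lambda>x. f (\<lambda>y. fourier \<phi> (y - x) / of_real ((2 * pi) ^ CARD('n))))"
      unfolding u_def \<phi>_def by (rule freq_block_eq[OF t t0 f pS[unfolded \<phi>_def]])
    have uc: "continuous_on UNIV u" unfolding u by (rule tempered_convolution(1)[OF f pS])
    have [measurable]: "u \<in> borel_measurable borel" by (rule borel_measurable_continuous_onI[OF uc])
    let ?g = "\<lambda>x. \<gamma> (diag_map d x)"
    have g'S: "?g \<in> schwartz" using schwartz_affine[OF gS, of d 0] d by simp
    have [measurable]: "fourier ?g \<in> borel_measurable borel" using fourier_schwartz[OF g'S] by measurable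
    have pg: "\<phi> \<xi> * ?g \<xi> = \<phi> \<xi>" for \<xi>
      using dyadic_piece_support[where \<psi> = \<psi> and j = j and x = \<xi>, OF a R(2)] g1[of "diag_map d \<xi>"] unfolding \<phi>_def dd
      by (cases "dyadic_piece a \<psi> j \<xi> = 0") auto
    have "u (diag_map d x0) = (1 / (\<kappa> * c)) * (LINT x|lborel. u x * fourier ?g (x - diag_map d x0))"
      using reproducing_formula[OF f pS g'S pg k0 k[OF g'S], of "diag_map d x0"] unfolding u c_def .
    also have "(LINT x|lborel. u x * fourier ?g (x - diag_map d x0)) =
      P *\<^sub>R (LINT x|lborel. u (diag_map d x + 0) * fourier ?g ((diag_map d x + 0) - diag_map d x0))"
      unfolding P_def by (rule integral_diag_map[OF d]) measurable
    also have "\<dots> = (LINT x|lborel. u (diag_map d x) * (of_real P * fourier ?g (diag_map d (x - x0))))"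
      unfolding integral_scaleR_right[symmetric]
      by (intro Bochner_Integration.integral_cong refl)
        (simp add: linear_diff[OF bounded_linear.linear[OF bounded_linear_diag_map]] scaleR_conv_of_real mult_ac)
    also have "\<dots> = (LINT x|lborel. u (diag_map d x) * fourier \<gamma> (x - x0))"
      unfolding P_def fourier_diag_map[OF d schwartz_measurable[OF gS], symmetric] ..
    finally show "freq_block a \<psi> j f (dyadic_dil a j x0)
       = (LINT x|lborel. freq_block a \<psi> j f (dyadic_dil a j x) * M (x - x0))"
      unfolding u_def[symmetric] dd M_def by (simp add: mult.left_commute)
  qed
qed

text \<open>Continuity supplies measurability; polynomial growth makes a weighted supremum finite at
  the start of the pointwise estimate.\<close>

lemma freq_block_continuous_growth:
  fixes a :: "real^'n::finite" and \<psi> :: "real^'n \<Rightarrow> complex"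
  assumes a: "anisotropy a" and \<psi>: "cutoff a \<psi>" and f: "f \<in> tempered_distributions"
  shows "continuous_on UNIV (freq_block a \<psi> j f)"
    and "\<exists>N B. \<forall>x. norm (freq_block a \<psi> j f x) \<le> B * (1 + norm x) ^ N"
proof -
  have t: "test_function \<psi>" using \<psi> by (simp add: cutoff_def)
  have t0: "\<psi> 0 \<noteq> 0" using \<psi> aniso_norm_le_1[OF a, of 0] by (simp add: cutoff_def)
  note eq = freq_block_eq[OF t t0 f dyadic_piece_schwartz[OF t]]
  show "continuous_on UNIV (freq_block a \<psi> j f)"
    unfolding eq by (rule tempered_convolution(1)[OF f dyadic_piece_schwartz[OF t]])
  show "\<exists>N B. \<forall>x. norm (freq_block a \<psi> j f x) \<le> B * (1 + norm x) ^ N"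
    unfolding eq by (rule tempered_convolution(2)[OF f dyadic_piece_schwartz[OF t]])
qed

section \<open>A pointwise estimate for band-limited functions\<close>

lemma nn_integral_translate:
  assumes "f \<in> borel_measurable borel"
  shows "(\<integral>\<^sup>+z. f (z - x) \<partial>lborel) = (\<integral>\<^sup>+z. f (z :: real^'n::finite) \<partial>lborel)"
  using nn_integral_diag_map[of "\<lambda>i. 1" f "- x"] assms by simp

lemma weight_integralE:
  obtains V :: real where "V \<ge> 0"
    "\<And>x::real^'n::finite. (\<integral>\<^sup>+z. ennreal (1 / (1 + norm (z - x)) ^ Suc CARD('n)) \<partial>lborel) = ennreal V"
proof -
  define V where "V = (LINT z|lborel. 1 / (1 + norm (z::real^'n)) ^ Suc CARD('n))"
  have Vi: "integrable lborel (\<lambda>z::real^'n. 1 / (1 + norm z) ^ Suc CARD('n))"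
    using integrable_weight[where 'a = "real^'n"] by simp
  show ?thesis
  proof (rule that[of V])
    show "V \<ge> 0" unfolding V_def by (intro integral_nonneg_AE AE_I2) auto
    fix x :: "real^'n"
    have "(\<integral>\<^sup>+z. ennreal (1 / (1 + norm (z - x)) ^ Suc CARD('n)) \<partial>lborel) = (\<integral>\<^sup>+z. ennreal (1 / (1 + norm (z :: real^'n)) ^ Suc CARD('n)) \<partial>lborel)"
      by (rule nn_integral_translate) measurable
    also have "\<dots> = ennreal V" unfolding V_def by (rule nn_integral_eq_integral[OF Vi]) auto
    finally show "(\<integral>\<^sup>+z. ennreal (1 / (1 + norm (z - x)) ^ Suc CARD('n)) \<partial>lborel) = ennreal V" .
  qed
qed

lemma divide_mult_cancel_pos: "(P::real) > 0 \<Longrightarrow> a / P * P = a"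
  by simp

text \<open>Let \<open>S\<close> be the supremum of \<open>A\<close> divided by the weight, finite
  by the last bound on \<open>A\<close>. Inside the convolution inequality the quotient is split
  into its powers \<open>1 - r\<close> and \<open>r\<close>, and the first is bounded by
  \<open>S\<close>: this gives \<open>S \<le> C * S powr (1 - r) * j\<close>, and the power of
  \<open>S\<close> is divided out.\<close>

lemma local_estimate_finite:
  fixes A :: "real^'n::finite \<Rightarrow> real" and M :: "real^'n \<Rightarrow> complex"
  assumes A0: "\<And>y. A y \<ge> 0" and Am [measurable]: "A \<in> borel_measurable borel"
    and H: "\<And>y. ennreal (A y) \<le> (\<integral>\<^sup>+z. ennreal (A z * norm (M (z - y))) \<partial>lborel)"
    and C: "C > 0" "\<And>z. (1 + norm z) ^ K * norm (M z) \<le> C"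
    and b: "\<And>y. A y \<le> b * (1 + norm (y - x)) ^ K"
    and r: "0 < r" "r \<le> 1"
  shows "ennreal (A x powr r) \<le> ennreal C * (\<integral>\<^sup>+z. ennreal ((A z / (1 + norm (z - x)) ^ K) powr r) \<partial>lborel)"
proof -
  define J where "J = (\<integral>\<^sup>+z. ennreal ((A z / (1 + norm (z - x)) ^ K) powr r) \<partial>lborel)"
  have w0: "(1 + norm z) ^ K > 0" for z :: "real^'n" by (intro zero_less_power add_pos_nonneg) auto
  define q where "q y = A y / (1 + norm (y - x)) ^ K" for y
  have q0: "q y \<ge> 0" for y unfolding q_def using A0[of y] w0[of "y - x"] by simp
  have "q y \<le> b" for y unfolding q_def using b[of y] w0[of "y - x"] by (simp add: pos_divide_le_eq)
  then have bdd: "bdd_above (range q)" by (intro bdd_aboveI2)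
  define S where "S = (SUP y. q y)"
  have qS: "q y \<le> S" for y unfolding S_def by (rule cSUP_upper[OF _ bdd]) simp
  have S0: "S \<ge> 0" using q0[of 0] qS[of 0] by linarith
  have qx: "q x = A x" by (simp add: q_def)
  show ?thesis
  proof (cases "J = top \<or> S = 0")
    case True
    then show ?thesis
    proof
      assume "S = 0"
      then have "A x = 0" using qS[of x] q0[of x] qx by simp
      then show ?thesis by simp
    qed (use C(1) in \<open>simp add: J_def ennreal_mult_top\<close>)
  next
    case False
    then have S: "S > 0" using S0 by simp
    obtain j where j: "J = ennreal j" "j \<ge> 0" using False by (cases J) auto
    \<comment> \<open>The weight at \<open>z - x\<close> is split between \<open>z - y\<close>,
      where the kernel decays, and \<open>y - x\<close>, which cancels against the weight in
      \<open>q y\<close>.\<close>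
    have qM: "A z * norm (M (z - y)) \<le> (1 + norm (y - x)) ^ K * (C * (S powr (1 - r) * q z powr r))" for y z
    proof -
      have le: "(1 + norm (z - x)) ^ K \<le> (1 + norm (z - y)) ^ K * (1 + norm (y - x)) ^ K"
        using weight_triangle_power[of "z - x" K "y - x"] by simp
      have "q z \<le> S powr (1 - r) * q z powr r"
      proof (cases "q z = 0")
        case False
        then have qz: "q z > 0" using q0[of z] by simp
        have "q z = q z powr (1 - r) * q z powr r" using qz by (simp flip: powr_add)
        also have "\<dots> \<le> S powr (1 - r) * q z powr r"
          using r qz qS[of z] by (intro mult_right_mono powr_mono2) auto
        finally show ?thesis .
      qed simp
      moreover have "A z * norm (M (z - y)) \<le> (1 + norm (y - x)) ^ K * (C * q z)"
      proof -
        have "A z * norm (M (z - y)) = q z * ((1 + norm (z - x)) ^ K * norm (M (z - y)))"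
          unfolding mult.assoc[symmetric] q_def divide_mult_cancel_pos[OF w0] ..
        also have "\<dots> \<le> q z * (((1 + norm (z - y)) ^ K * (1 + norm (y - x)) ^ K) * norm (M (z - y)))"
          by (intro mult_left_mono mult_right_mono le q0) simp
        also have "\<dots> = q z * (1 + norm (y - x)) ^ K * ((1 + norm (z - y)) ^ K * norm (M (z - y)))" by simp
        also have "\<dots> \<le> q z * (1 + norm (y - x)) ^ K * C"
          by (intro mult_left_mono C(2) mult_nonneg_nonneg q0) simp
        finally show ?thesis by (simp add: mult_ac)
      qed
      moreover have "(1 + norm (y - x)) ^ K * (C * q z) \<le> (1 + norm (y - x)) ^ K * (C * (S powr (1 - r) * q z powr r))"
        using C(1) calculation(1) by (intro mult_left_mono) auto
      ultimately show ?thesis by linarith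
    qed
    have qb: "q y \<le> C * S powr (1 - r) * j" for y
    proof -
      let ?w = "(1 + norm (y - x)) ^ K"
      have [measurable]: "q \<in> borel_measurable borel" unfolding q_def by measurable
      have "ennreal (A y) \<le> (\<integral>\<^sup>+z. ennreal (A z * norm (M (z - y))) \<partial>lborel)" by (rule H)
      also have "\<dots> \<le> (\<integral>\<^sup>+z. ennreal (?w * C * S powr (1 - r)) * ennreal (q z powr r) \<partial>lborel)"
      proof (rule nn_integral_mono)
        fix z
        have "ennreal (A z * norm (M (z - y))) \<le> ennreal (?w * C * S powr (1 - r) * q z powr r)"
          using qM[of z y] by (intro ennreal_leI) (simp add: mult.assoc)
        also have "\<dots> = ennreal (?w * C * S powr (1 - r)) * ennreal (q z powr r)"
          using w0[of "y - x"] C(1) by (intro ennreal_mult) auto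
        finally show "ennreal (A z * norm (M (z - y))) \<le> ennreal (?w * C * S powr (1 - r)) * ennreal (q z powr r)" .
      qed
      also have "\<dots> = ennreal (?w * C * S powr (1 - r)) * J"
        unfolding J_def q_def[symmetric] by (rule nn_integral_cmult) measurable
      also have "\<dots> = ennreal (?w * C * S powr (1 - r) * j)"
        unfolding j(1) using w0[of "y - x"] C(1) j(2) by (intro ennreal_mult[symmetric]) auto
      finally have "A y \<le> ?w * C * S powr (1 - r) * j"
        using w0[of "y - x"] C(1) j(2) by (subst (asm) ennreal_le_iff) auto
      then show ?thesis unfolding q_def using w0[of "y - x"] by (simp add: pos_divide_le_eq mult_ac)
    qed
    have "S \<le> C * S powr (1 - r) * j" unfolding S_def using qb[unfolded S_def] by (intro cSUP_least) auto
    then have "S powr r * S powr (1 - r) \<le> (C * j) * S powr (1 - r)" using S by (simp add: mult_ac flip: powr_add)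
    then have Sr: "S powr r \<le> C * j" using S by (simp add: mult_le_cancel_right)
    have "A x powr r \<le> S powr r" using qS[of x] A0[of x] r unfolding qx by (intro powr_mono2) auto
    then have "A x powr r \<le> C * j" using Sr by simp
    then have "ennreal (A x powr r) \<le> ennreal C * J" unfolding j(1) using C(1) j(2) by (simp add: ennreal_leI flip: ennreal_mult)
    then show ?thesis by (simp add: J_def)
  qed
qed

text \<open>The first application of the finite estimate uses a weight that depends on the growth of \<open>A\<close>;
  it only serves to show that the supremum with the fixed weight is finite.\<close>

lemma local_estimate_small:
  fixes A :: "real^'n::finite \<Rightarrow> real" and M :: "real^'n \<Rightarrow> complex"
  assumes A0: "\<And>y. A y \<ge> 0" and Am [measurable]: "A \<in> borel_measurable borel"
    and H: "\<And>y. ennreal (A y) \<le> (\<integral>\<^sup>+z. ennreal (A z * norm (M (z - y))) \<partial>lborel)"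
    and M: "M \<in> schwartz"
    and C: "C > 0" "\<And>z. (1 + norm z) ^ k * norm (M z) \<le> C"
    and growth: "\<And>y. A y \<le> b * (1 + norm y) ^ N"
    and r: "0 < r" "r \<le> 1"
  shows "ennreal (A x powr r) \<le> ennreal C * (\<integral>\<^sup>+z. ennreal ((A z / (1 + norm (z - x)) ^ k) powr r) \<partial>lborel)"
    (is "_ \<le> _ * ?J x")
proof (cases "?J x = top")
  case False
  define K where "K = max N k"
  obtain D where D: "D > 0" "\<And>z. (1 + norm z) ^ K * norm (M z) \<le> D" using schwartz_boundE0[OF M, of K] by metis
  have w0: "(1 + norm z) ^ k > 0" for z :: "real^'n" by (intro zero_less_power add_pos_nonneg) auto
  have b0: "b \<ge> 0" using growth[of 0] A0[of 0] by simp
  have 1: "ennreal (A y powr r) \<le> ennreal D * ?J y" for y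
  proof -
    have "A z \<le> (b * (1 + norm y) ^ N) * (1 + norm (z - y)) ^ K" for z
    proof -
      have "A z \<le> b * (1 + norm z) ^ N" by (rule growth)
      also have "\<dots> \<le> b * ((1 + norm (z - y)) ^ N * (1 + norm y) ^ N)"
        by (intro mult_left_mono weight_triangle_power b0)
      also have "\<dots> \<le> b * ((1 + norm (z - y)) ^ K * (1 + norm y) ^ N)"
        by (intro mult_left_mono mult_right_mono b0 power_increasing) (auto simp: K_def)
      finally show ?thesis by (simp add: mult_ac)
    qed
    from local_estimate_finite[OF A0 Am H D this r]
    have "ennreal (A y powr r) \<le> ennreal D * (\<integral>\<^sup>+z. ennreal ((A z / (1 + norm (z - y)) ^ K) powr r) \<partial>lborel)" .
    also have "\<dots> \<le> ennreal D * ?J y"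
    proof (intro mult_left_mono nn_integral_mono ennreal_leI powr_mono2)
      fix z
      show "A z / (1 + norm (z - y)) ^ K \<le> A z / (1 + norm (z - y)) ^ k"
        using w0[of "z - y"] A0 by (intro divide_left_mono power_increasing mult_pos_pos zero_less_power add_pos_nonneg) (auto simp: K_def)
    qed (use r A0 in auto)
    finally show ?thesis .
  qed
  obtain j where j: "?J x = ennreal j" "j \<ge> 0" using False by (cases "?J x") auto
  \<comment> \<open>Moving the base point from \<open>x\<close> to \<open>y\<close> costs only the
    weight of exponent \<open>k\<close>; with the first estimate this bounds \<open>A\<close> by a
    finite multiple of that weight. That \<open>D\<close> depends on the growth of \<open>A\<close>
    does no harm, as only finiteness is retained.\<close>
  have shift: "?J y \<le> ennreal (((1 + norm (y - x)) ^ k) powr r) * ?J x" for y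
  proof -
    have "?J y \<le> (\<integral>\<^sup>+z. ennreal (((1 + norm (y - x)) ^ k) powr r) * ennreal ((A z / (1 + norm (z - x)) ^ k) powr r) \<partial>lborel)"
    proof (rule nn_integral_mono)
      fix z
      have "A z / (1 + norm (z - y)) ^ k \<le> (1 + norm (y - x)) ^ k * (A z / (1 + norm (z - x)) ^ k)"
      proof -
        have le: "(1 + norm (z - x)) ^ k \<le> (1 + norm (z - y)) ^ k * (1 + norm (y - x)) ^ k"
          using weight_triangle_power[of "z - x" k "y - x"] by simp
        have "A z * (1 + norm (z - x)) ^ k \<le> A z * ((1 + norm (z - y)) ^ k * (1 + norm (y - x)) ^ k)"
          by (intro mult_left_mono le A0)
        then show ?thesis using w0[of "z - y"] w0[of "z - x"] by (simp add: divide_simps mult_ac)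
      qed
      then have "(A z / (1 + norm (z - y)) ^ k) powr r \<le> ((1 + norm (y - x)) ^ k * (A z / (1 + norm (z - x)) ^ k)) powr r"
        using r A0 by (intro powr_mono2) auto
      also have "\<dots> = ((1 + norm (y - x)) ^ k) powr r * (A z / (1 + norm (z - x)) ^ k) powr r"
        by (rule powr_mult)
      finally show "ennreal ((A z / (1 + norm (z - y)) ^ k) powr r) \<le>
         ennreal (((1 + norm (y - x)) ^ k) powr r) * ennreal ((A z / (1 + norm (z - x)) ^ k) powr r)"
        by (simp add: ennreal_leI flip: ennreal_mult)
    qed
    also have "\<dots> = ennreal (((1 + norm (y - x)) ^ k) powr r) * ?J x"
      by (rule nn_integral_cmult) measurable
    finally show ?thesis .
  qed
  have "A y \<le> (D * j) powr (1 / r) * (1 + norm (y - x)) ^ k" for y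
  proof -
    have "ennreal (A y powr r) \<le> ennreal D * (ennreal (((1 + norm (y - x)) ^ k) powr r) * ennreal j)"
      using order_trans[OF 1[of y] mult_left_mono[OF shift[of y]]] j(1) by simp
    also have "\<dots> = ennreal ((D * j) * ((1 + norm (y - x)) ^ k) powr r)"
      using D(1) j(2) by (simp add: mult_ac flip: ennreal_mult)
    finally have "A y powr r \<le> (D * j) * ((1 + norm (y - x)) ^ k) powr r"
      using D(1) j(2) by (subst (asm) ennreal_le_iff) auto
    then have "(A y powr r) powr (1 / r) \<le> ((D * j) * ((1 + norm (y - x)) ^ k) powr r) powr (1 / r)"
      using r by (intro powr_mono2) auto
    also have "\<dots> = (D * j) powr (1 / r) * (((1 + norm (y - x)) ^ k) powr r) powr (1 / r)"
      by (intro powr_mult)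
    finally show ?thesis using r A0[of y] w0[of "y - x"] by (simp add: powr_powr)
  qed
  from local_estimate_finite[OF A0 Am H C this r] show ?thesis .
qed (use C in \<open>simp add: ennreal_mult_top\<close>)

text \<open>For \<open>r \<le> 1\<close> the weight exponent \<open>k\<close> is taken so large that
  \<open>k * r\<close> is at least the exponent of the integrable weight. For \<open>r > 1\<close>
  the case \<open>r = 1\<close> is upgraded by a level:
  \<open>A z \<le> l + l powr (1 - r) * A z powr r\<close>, with \<open>l\<close> a small multiple
  of \<open>A x\<close> so that the first term can be absorbed. The constant depends neither on
  \<open>A\<close> nor on its growth.\<close>

lemma local_estimate:
  fixes M :: "real^'n::finite \<Rightarrow> complex"
  assumes M: "M \<in> schwartz" and r: "r > 0"
  shows "\<exists>C>0. \<forall>A b N x. (\<forall>y. A y \<ge> 0) \<longrightarrow> A \<in> borel_measurable borel \<longrightarrow>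
      (\<forall>y. ennreal (A y) \<le> (\<integral>\<^sup>+z. ennreal (A z * norm (M (z - y))) \<partial>lborel)) \<longrightarrow>
      (\<forall>y. A y \<le> b * (1 + norm y) ^ N) \<longrightarrow>
      ennreal (A x powr r) \<le> ennreal C * (\<integral>\<^sup>+z. ennreal (A z powr r * (1 / (1 + norm (z - x)) ^ Suc CARD('n))) \<partial>lborel)"
proof -
  have small: "\<exists>C>0. \<forall>A b N x. (\<forall>y. A y \<ge> 0) \<longrightarrow> A \<in> borel_measurable borel \<longrightarrow>
      (\<forall>y. ennreal (A y) \<le> (\<integral>\<^sup>+z. ennreal (A z * norm (M (z - y))) \<partial>lborel)) \<longrightarrow>
      (\<forall>y. A y \<le> b * (1 + norm y) ^ N) \<longrightarrow>
      ennreal (A x powr r) \<le> ennreal C * (\<integral>\<^sup>+z. ennreal (A z powr r * (1 / (1 + norm (z - x)) ^ Suc CARD('n))) \<partial>lborel)"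
    if r: "0 < r" "r \<le> 1" for r
  proof -
    obtain k :: nat where k: "real (Suc CARD('n)) / r \<le> real k" using real_arch_simple by blast
    obtain C where C: "C > 0" "\<And>z. (1 + norm z) ^ k * norm (M z) \<le> C" using schwartz_boundE0[OF M, of k] by metis
    have w: "(a / (1 + norm z) ^ k) powr r \<le> a powr r * (1 / (1 + norm z) ^ Suc CARD('n))" if "a \<ge> 0" for a and z :: "real^'n"
    proof -
      have p: "1 + norm z > 0" by (intro add_pos_nonneg) auto
      have "(1 + norm z) ^ Suc CARD('n) = (1 + norm z) powr real (Suc CARD('n))" using p by (intro powr_realpow[symmetric])
      also have "\<dots> \<le> (1 + norm z) powr (real k * r)"
        using k r by (intro powr_mono) (auto simp: pos_divide_le_eq)
      also have "\<dots> = ((1 + norm z) ^ k) powr r" using p by (simp add: powr_powr flip: powr_realpow)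
      finally have le: "(1 + norm z) ^ Suc CARD('n) \<le> ((1 + norm z) ^ k) powr r" .
      have "(a / (1 + norm z) ^ k) powr r = a powr r * (1 / ((1 + norm z) ^ k) powr r)"
        using that p by (simp add: powr_divide)
      also have "\<dots> \<le> a powr r * (1 / (1 + norm z) ^ Suc CARD('n))"
        using p by (intro mult_left_mono divide_left_mono le mult_pos_pos) auto
      finally show ?thesis .
    qed
    show ?thesis
    proof (intro exI[of _ C] conjI allI impI C(1))
      fix A :: "real^'n \<Rightarrow> real" and b N x
      assume A: "\<forall>y. A y \<ge> 0" "A \<in> borel_measurable borel"
        "\<forall>y. ennreal (A y) \<le> (\<integral>\<^sup>+z. ennreal (A z * norm (M (z - y))) \<partial>lborel)"
        "\<forall>y. A y \<le> b * (1 + norm y) ^ N"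
      have "ennreal (A x powr r) \<le> ennreal C * (\<integral>\<^sup>+z. ennreal ((A z / (1 + norm (z - x)) ^ k) powr r) \<partial>lborel)"
        by (rule local_estimate_small[OF _ A(2) _ M C _ r, of b N]) (use A in auto)
      also have "\<dots> \<le> ennreal C * (\<integral>\<^sup>+z. ennreal (A z powr r * (1 / (1 + norm (z - x)) ^ Suc CARD('n))) \<partial>lborel)"
        by (intro mult_left_mono nn_integral_mono ennreal_leI w) (use A in auto)
      finally show "ennreal (A x powr r) \<le> ennreal C * (\<integral>\<^sup>+z. ennreal (A z powr r * (1 / (1 + norm (z - x)) ^ Suc CARD('n))) \<partial>lborel)" .
    qed
  qed
  show ?thesis
  proof (cases "r \<le> 1")
    case True
    show ?thesis by (rule small[OF r True])
  next
    case False
    have "0 < (1::real)" "(1::real) \<le> 1" by simp_all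
    from small[OF this] obtain C where C: "C > 0" and C': "\<forall>A b N x. (\<forall>y. A y \<ge> 0) \<longrightarrow> A \<in> borel_measurable borel \<longrightarrow>
      (\<forall>y. ennreal (A y) \<le> (\<integral>\<^sup>+z. ennreal (A z * norm (M (z - y))) \<partial>lborel)) \<longrightarrow>
      (\<forall>y. A y \<le> b * (1 + norm y) ^ N) \<longrightarrow>
      ennreal (A x powr 1) \<le> ennreal C * (\<integral>\<^sup>+z. ennreal (A z powr 1 * (1 / (1 + norm (z - x)) ^ Suc CARD('n))) \<partial>lborel)"
      by (elim exE conjE)
    obtain V :: real where V0: "V \<ge> 0" and V: "\<And>x::real^'n. (\<integral>\<^sup>+z. ennreal (1 / (1 + norm (z - x)) ^ Suc CARD('n)) \<partial>lborel) = ennreal V"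
      using weight_integralE[where 'n = 'n] by metis
    define E where "E = 2 * C * (2 * C * (V + 1)) powr (r - 1)"
    have E: "E > 0" unfolding E_def using C V0 by (intro mult_pos_pos) (auto intro!: mult_pos_pos)
    show ?thesis
    proof (intro exI[of _ E] conjI allI impI E)
      fix A :: "real^'n \<Rightarrow> real" and b N x
      assume A': "\<forall>y. A y \<ge> 0" "A \<in> borel_measurable borel"
        "\<forall>y. ennreal (A y) \<le> (\<integral>\<^sup>+z. ennreal (A z * norm (M (z - y))) \<partial>lborel)"
        "\<forall>y. A y \<le> b * (1 + norm y) ^ N"
      note A = A'(1)[rule_format] A'(2) A'(3)[rule_format] A'(4)[rule_format]
      have [measurable]: "A \<in> borel_measurable borel" by (rule A)
      define J where "J = (\<integral>\<^sup>+z. ennreal (A z powr r * (1 / (1 + norm (z - x)) ^ Suc CARD('n))) \<partial>lborel)"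
      have "ennreal (A x powr r) \<le> ennreal E * J"
      proof (cases "A x = 0 \<or> J = top")
        case True
        then show ?thesis using E by (auto simp: ennreal_mult_top)
      next
        case F: False
        then have Ax: "A x > 0" using A(1)[of x] by simp
        obtain j where j: "J = ennreal j" "j \<ge> 0" using F by (cases J) auto
        \<comment> \<open>With this level the constant term contributes \<open>C * V * l\<close>, at
          most half of \<open>A x\<close>; the summand 1 keeps the denominator positive.\<close>
        define l where "l = A x / (2 * C * (V + 1))"
        have l: "l > 0" unfolding l_def using Ax C V0 by (intro divide_pos_pos mult_pos_pos) auto
        have pt: "A z \<le> l + l powr (1 - r) * A z powr r" for z
        proof (cases "A z \<le> l")
          case True
          then show ?thesis by (intro order_trans[OF True]) simp
        next
          case gt: False
          have "A z = A z powr (1 - r) * A z powr r" using gt l by (simp flip: powr_add)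
          also have "\<dots> \<le> l powr (1 - r) * A z powr r"
            using gt l False by (intro mult_right_mono powr_mono2') auto
          finally show ?thesis using l by linarith
        qed
        let ?W = "\<lambda>z. 1 / (1 + norm (z - x)) ^ Suc CARD('n)"
        have "ennreal (A x) \<le> ennreal C * (\<integral>\<^sup>+z. ennreal (A z powr 1 * ?W z) \<partial>lborel)"
          using C'[rule_format, of A b N x] A by simp
        also have "(\<integral>\<^sup>+z. ennreal (A z powr 1 * ?W z) \<partial>lborel)
           \<le> (\<integral>\<^sup>+z. ennreal l * ennreal (?W z) + ennreal (l powr (1 - r)) * ennreal (A z powr r * ?W z) \<partial>lborel)"
        proof (rule nn_integral_mono)
          fix z
          have "A z powr 1 * ?W z \<le> (l + l powr (1 - r) * A z powr r) * ?W z"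
            using pt[of z] A(1)[of z] by (intro mult_right_mono) auto
          then have "ennreal (A z powr 1 * ?W z) \<le> ennreal (l * ?W z + l powr (1 - r) * (A z powr r * ?W z))"
            by (intro ennreal_leI) (simp only: distrib_right mult.assoc)
          also have "\<dots> = ennreal l * ennreal (?W z) + ennreal (l powr (1 - r)) * ennreal (A z powr r * ?W z)"
            using l by (simp only: ennreal_mult'[symmetric] ennreal_plus[symmetric] less_imp_le powr_ge_zero
               mult_nonneg_nonneg zero_le_divide_1_iff zero_le_power add_nonneg_nonneg norm_ge_zero zero_le_one)
          finally show "ennreal (A z powr 1 * ?W z) \<le> ennreal l * ennreal (?W z) + ennreal (l powr (1 - r)) * ennreal (A z powr r * ?W z)" .
        qed
        also have "\<dots> = ennreal l * ennreal V + ennreal (l powr (1 - r)) * J"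
          unfolding J_def V[of x, symmetric] by (simp add: nn_integral_add nn_integral_cmult)
        also have "\<dots> = ennreal (l * V + l powr (1 - r) * j)"
          using l V0 j by (simp add: ennreal_mult' ennreal_plus)
        finally have "ennreal (A x) \<le> ennreal C * ennreal (l * V + l powr (1 - r) * j)" by (simp add: mult_left_mono)
        also have "\<dots> = ennreal (C * (l * V + l powr (1 - r) * j))" using C by (simp add: ennreal_mult')
        finally have "A x \<le> C * (l * V + l powr (1 - r) * j)"
          using C l V0 j by (subst (asm) ennreal_le_iff) auto
        also have "C * (l * V + l powr (1 - r) * j) = C * V * l + C * (l powr (1 - r) * j)" by (simp add: algebra_simps)
        also have "C * V * l \<le> A x / 2"
        proof -
          have "C * V * l = A x / 2 * (V / (V + 1))" using C V0 by (simp add: l_def)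
          also have "\<dots> \<le> A x / 2 * 1" using Ax V0 by (intro mult_left_mono) auto
          finally show ?thesis by simp
        qed
        finally have "A x \<le> 2 * C * (l powr (1 - r) * j)" by simp
        then have "A x * l powr (r - 1) \<le> (2 * C * (l powr (1 - r) * j)) * l powr (r - 1)"
          by (intro mult_right_mono) auto
        also have "\<dots> = 2 * C * j * (l powr (1 - r) * l powr (r - 1))" by simp
        also have "l powr (1 - r) * l powr (r - 1) = 1" using l by (simp flip: powr_add)
        finally have le: "A x * l powr (r - 1) \<le> 2 * C * j" by simp
        define Q where "Q = 2 * C * (V + 1)"
        have Axl: "A x = l * Q" using C V0 by (simp add: l_def Q_def)
        have "A x powr r = A x * A x powr (r - 1)" using Ax by (simp add: powr_mult_base)
        also have "A x powr (r - 1) = l powr (r - 1) * Q powr (r - 1)" unfolding Axl by (rule powr_mult)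
        also have "A x * (l powr (r - 1) * Q powr (r - 1)) = A x * l powr (r - 1) * (2 * C * (V + 1)) powr (r - 1)"
          by (simp add: Q_def)
        also have "\<dots> \<le> (2 * C * j) * (2 * C * (V + 1)) powr (r - 1)" by (intro mult_right_mono le) simp
        also have "\<dots> = E * j" by (simp add: E_def)
        finally have "A x powr r \<le> E * j" .
        then show ?thesis unfolding j(1) using E j(2) by (simp add: ennreal_leI flip: ennreal_mult)
      qed
      then show "ennreal (A x powr r) \<le> ennreal E * (\<integral>\<^sup>+z. ennreal (A z powr r * (1 / (1 + norm (z - x)) ^ Suc CARD('n))) \<partial>lborel)"
        unfolding J_def .
    qed
  qed
qed

text \<open>The constant \<open>\<mu>\<close> is integrated against the weight, for \<open>h\<close>
  the weight is bounded by 1, and undoing the dilation produces the factor 2^(j|a|). With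
  \<open>\<mu> = 0\<close> this is Nikolskii's inequality into the sup-norm; a positive
  \<open>\<mu>\<close> accommodates a block that exceeds a level only on a small set.\<close>

lemma block_estimate:
  fixes a :: "real^'n::finite" and \<psi> :: "real^'n \<Rightarrow> complex"
  assumes a: "anisotropy a" and \<psi>: "cutoff a \<psi>" and r: "r > 0"
  shows "\<exists>C>0. \<forall>f\<in>tempered_distributions. \<forall>j x \<mu>. \<forall>h\<in>borel_measurable borel.
      (\<forall>y. ennreal (norm (freq_block a \<psi> j f y) powr r) \<le> \<mu> + h y) \<longrightarrow>
      ennreal (norm (freq_block a \<psi> j f x) powr r)
        \<le> ennreal C * (\<mu> + ennreal (2 powr (real j * aniso_size a)) * (\<integral>\<^sup>+y. h y \<partial>lborel))"
proof -
  obtain M where M1: "M \<in> schwartz" and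
    M2: "\<forall>f\<in>tempered_distributions. \<forall>j x0. freq_block a \<psi> j f (dyadic_dil a j x0)
       = (LINT x|lborel. freq_block a \<psi> j f (dyadic_dil a j x) * M (x - x0))"
    using block_reproducing[OF a \<psi>] by (elim bexE)
  obtain C where C: "C > 0" and C': "\<forall>A b N x. (\<forall>y. A y \<ge> 0) \<longrightarrow> A \<in> borel_measurable borel \<longrightarrow>
      (\<forall>y. ennreal (A y) \<le> (\<integral>\<^sup>+z. ennreal (A z * norm (M (z - y))) \<partial>lborel)) \<longrightarrow>
      (\<forall>y. A y \<le> b * (1 + norm y) ^ N) \<longrightarrow>
      ennreal (A x powr r) \<le> ennreal C * (\<integral>\<^sup>+z. ennreal (A z powr r * (1 / (1 + norm (z - x)) ^ Suc CARD('n))) \<partial>lborel)"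
    using local_estimate[OF M1 r] by (elim exE conjE)
  obtain V :: real where V0: "V \<ge> 0" and V: "\<And>x::real^'n. (\<integral>\<^sup>+z. ennreal (1 / (1 + norm (z - x)) ^ Suc CARD('n)) \<partial>lborel) = ennreal V"
    using weight_integralE[where 'n = 'n] by metis
  show ?thesis
  proof (intro exI[of _ "C * (V + 1)"] conjI ballI allI impI)
    show "C * (V + 1) > 0" using C V0 by simp
    fix f :: "'n distr" and j x \<mu> and h :: "real^'n \<Rightarrow> ennreal"
    assume f: "f \<in> tempered_distributions" and hm [measurable]: "h \<in> borel_measurable borel"
      and h': "\<forall>y. ennreal (norm (freq_block a \<psi> j f y) powr r) \<le> \<mu> + h y"
    note h = h'[rule_format]
    define u where "u = freq_block a \<psi> j f"
    define d where "d i = 2 powr (- (real j * a $ i))" for i :: 'n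
    have d: "d i > 0" for i by (simp add: d_def)
    have "d = (\<lambda>i. 2 powr (- (real j * a $ i)))" by (rule ext) (simp add: d_def)
    then have dd: "dyadic_dil a j = diag_map d" by (simp add: dyadic_dil_def)
    have det: "(\<Prod>i\<in>UNIV. \<bar>d i\<bar>) = 2 powr (- (real j * aniso_size a))"
      unfolding d_def by (rule dyadic_dil_det)
    have uc: "continuous_on UNIV u" unfolding u_def by (rule freq_block_continuous_growth[OF a \<psi> f])
    obtain N b where ub: "\<And>x. norm (u x) \<le> b * (1 + norm x) ^ N"
      using freq_block_continuous_growth(2)[OF a \<psi> f, of j] unfolding u_def by metis
    have b0: "b \<ge> 0" using order_trans[OF norm_ge_zero ub[of 0]] by simp
    have vc: "continuous_on UNIV (\<lambda>z. u (diag_map d z))"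
      by (rule continuous_on_compose2[OF uc linear_continuous_on[OF bounded_linear_diag_map]]) simp
    have [measurable]: "(\<lambda>z. u (diag_map d z)) \<in> borel_measurable borel"
      by (rule borel_measurable_continuous_onI[OF vc])
    have [measurable]: "(\<lambda>z. diag_map d z) \<in> borel_measurable borel"
      by (rule borel_measurable_continuous_onI[OF linear_continuous_on[OF bounded_linear_diag_map]])
    define A where "A z = norm (u (diag_map d z))" for z
    define x0 where "x0 = diag_map (\<lambda>i. inverse (d i)) x"
    have x0: "diag_map d x0 = x" unfolding x0_def vec_eq_iff using d by (simp add: less_imp_neq[symmetric])
    have "ennreal (A x0 powr r) \<le> ennreal C * (\<integral>\<^sup>+z. ennreal (A z powr r * (1 / (1 + norm (z - x0)) ^ Suc CARD('n))) \<partial>lborel)"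
    proof (rule C'[rule_format, of A b N x0])
      show "A \<in> borel_measurable borel" unfolding A_def by measurable
      fix y :: "real^'n"
      show "A y \<ge> 0" by (simp add: A_def)
      have "A y \<le> b * (1 + norm (diag_map d y)) ^ N" unfolding A_def by (rule ub)
      also have "norm (diag_map d y) \<le> norm (diag_map (\<lambda>i. 1) y)"
      proof (rule norm_diag_map_mono)
        fix i
        have "d i \<le> 2 powr 0" unfolding d_def using anisotropy_ge_1[OF a, of i] by (intro powr_mono) auto
        then show "\<bar>d i\<bar> \<le> \<bar>1\<bar>" using d[of i] by simp
      qed
      then have "b * (1 + norm (diag_map d y)) ^ N \<le> b * (1 + norm y) ^ N"
        by (intro mult_left_mono power_mono b0) auto
      finally show "A y \<le> b * (1 + norm y) ^ N" .
      show "ennreal (A y) \<le> (\<integral>\<^sup>+z. ennreal (A z * norm (M (z - y))) \<partial>lborel)"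
      proof -
        have [measurable]: "M \<in> borel_measurable borel" using M1 by measurable
        have eq: "u (diag_map d y) = (LINT z|lborel. u (diag_map d z) * M (z - y))"
          using M2[rule_format, OF f, of j y] unfolding u_def dd .
        show ?thesis
        proof (cases "integrable lborel (\<lambda>z. u (diag_map d z) * M (z - y))")
          case True
          from integral_norm_bound_ennreal[OF True] show ?thesis
            unfolding A_def eq[symmetric] by (simp add: norm_mult)
        next
          case False
          \<comment> \<open>The Bochner integral of a function that is not integrable is 0 by
            convention, so the block vanishes here and the bound is trivial.\<close>
          then have "u (diag_map d y) = 0" unfolding eq by (rule not_integrable_integral_eq)
          then show ?thesis by (simp add: A_def)
        qed
      qed
    qed
    also have "(\<integral>\<^sup>+z. ennreal (A z powr r * (1 / (1 + norm (z - x0)) ^ Suc CARD('n))) \<partial>lborel)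
      \<le> (\<integral>\<^sup>+z. \<mu> * ennreal (1 / (1 + norm (z - x0)) ^ Suc CARD('n)) + h (diag_map d z) \<partial>lborel)"
    proof (rule nn_integral_mono)
      fix z
      let ?w = "1 / (1 + norm (z - x0)) ^ Suc CARD('n)"
      have w1: "ennreal ?w \<le> 1"
      proof -
        have "1 \<le> (1 + norm (z - x0)) ^ Suc CARD('n)" by (intro one_le_power) simp
        then show ?thesis by (simp add: ennreal_le_1 divide_le_eq_1)
      qed
      have "ennreal (A z powr r * ?w) = ennreal (A z powr r) * ennreal ?w" by (rule ennreal_mult'') simp
      also have "\<dots> \<le> (\<mu> + h (diag_map d z)) * ennreal ?w"
        unfolding A_def u_def by (intro mult_right_mono h) simp
      also have "\<dots> = \<mu> * ennreal ?w + h (diag_map d z) * ennreal ?w" by (simp add: distrib_right)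
      also have "\<dots> \<le> \<mu> * ennreal ?w + h (diag_map d z) * 1"
        by (intro add_left_mono mult_left_mono w1) simp
      finally show "ennreal (A z powr r * ?w) \<le> \<mu> * ennreal ?w + h (diag_map d z)" by simp
    qed
    also have "\<dots> = \<mu> * ennreal V + (\<integral>\<^sup>+z. h (diag_map d z) \<partial>lborel)"
      unfolding V[of x0, symmetric] by (simp add: nn_integral_add nn_integral_cmult)
    also have "(\<integral>\<^sup>+z. h (diag_map d z) \<partial>lborel) = ennreal (2 powr (real j * aniso_size a)) * (\<integral>\<^sup>+y. h y \<partial>lborel)"
    proof -
      have "(\<integral>\<^sup>+y. h y \<partial>lborel) = ennreal (2 powr (- (real j * aniso_size a))) * (\<integral>\<^sup>+z. h (diag_map d z) \<partial>lborel)"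
        using nn_integral_diag_map[of d h 0] d hm unfolding det by (simp add: less_imp_neq[symmetric])
      then have "ennreal (2 powr (real j * aniso_size a)) * (\<integral>\<^sup>+y. h y \<partial>lborel) =
        (ennreal (2 powr (real j * aniso_size a)) * ennreal (2 powr (- (real j * aniso_size a)))) * (\<integral>\<^sup>+z. h (diag_map d z) \<partial>lborel)"
        by (simp add: mult.assoc)
      also have "ennreal (2 powr (real j * aniso_size a)) * ennreal (2 powr (- (real j * aniso_size a))) = 1"
        by (simp flip: ennreal_mult powr_add)
      finally show ?thesis by simp
    qed
    finally have "ennreal (A x0 powr r) \<le> ennreal C * (\<mu> * ennreal V + ennreal (2 powr (real j * aniso_size a)) * (\<integral>\<^sup>+y. h y \<partial>lborel))"
      by (simp add: mult_left_mono)
    also have "\<dots> \<le> ennreal C * (\<mu> * ennreal (V + 1) + (ennreal (2 powr (real j * aniso_size a)) * (\<integral>\<^sup>+y. h y \<partial>lborel)) * ennreal (V + 1))"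
    proof (rule mult_left_mono[OF add_mono])
      show "\<mu> * ennreal V \<le> \<mu> * ennreal (V + 1)" by (rule mult_left_mono[OF ennreal_leI]) auto
      have "(ennreal (2 powr (real j * aniso_size a)) * (\<integral>\<^sup>+y. h y \<partial>lborel)) * 1 \<le> (ennreal (2 powr (real j * aniso_size a)) * (\<integral>\<^sup>+y. h y \<partial>lborel)) * ennreal (V + 1)"
        using V0 by (intro mult_left_mono) (auto simp: ennreal_ge_1)
      then show "(ennreal (2 powr (real j * aniso_size a)) * (\<integral>\<^sup>+y. h y \<partial>lborel)) \<le> (ennreal (2 powr (real j * aniso_size a)) * (\<integral>\<^sup>+y. h y \<partial>lborel)) * ennreal (V + 1)"
        by simp
    qed auto
    also have "\<dots> = ennreal (C * (V + 1)) * (\<mu> + ennreal (2 powr (real j * aniso_size a)) * (\<integral>\<^sup>+y. h y \<partial>lborel))"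
    proof -
      have "ennreal (C * (V + 1)) = ennreal C * ennreal (V + 1)" using C V0 by (intro ennreal_mult) auto
      moreover have "c * (m * v + X * v) = (c * v) * (m + X)" for c m v X :: ennreal
        by (simp add: distrib_left distrib_right mult_ac)
      ultimately show ?thesis by simp
    qed
    finally show "ennreal (norm (freq_block a \<psi> j f x) powr r)
        \<le> ennreal (C * (V + 1)) * (\<mu> + ennreal (2 powr (real j * aniso_size a)) * (\<integral>\<^sup>+y. h y \<partial>lborel))"
      by (simp add: A_def x0 u_def)
  qed
qed

section \<open>Level sequences\<close>

lemma sum_geometric_int_le:
  fixes \<theta> :: real and F :: "int set"
  assumes F: "finite F" and \<theta>: "0 \<le> \<theta>" "\<theta> < 1"
  shows "(\<Sum>k\<in>F. \<theta> ^ nat \<bar>k\<bar>) \<le> 2 / (1 - \<theta>)"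
proof -
  have half: "(\<Sum>k\<in>A. \<theta> ^ nat \<bar>k\<bar>) \<le> 1 / (1 - \<theta>)" if A: "finite A" "inj_on (\<lambda>k. nat \<bar>k\<bar>) A" for A :: "int set"
  proof -
    have "(\<Sum>k\<in>A. \<theta> ^ nat \<bar>k\<bar>) = (\<Sum>n\<in>(\<lambda>k. nat \<bar>k\<bar>) ` A. \<theta> ^ n)"
      using sum.reindex[OF A(2), of "\<lambda>n. \<theta> ^ n"] by (simp add: o_def)
    also have "\<dots> \<le> (\<Sum>n. \<theta> ^ n)"
      using \<theta> A(1) by (intro sum_le_suminf summable_geometric) auto
    also have "\<dots> = 1 / (1 - \<theta>)" using \<theta> by (intro suminf_geometric) auto
    finally show ?thesis .
  qed
  have "F = (F \<inter> {0..}) \<union> (F \<inter> {..<0})" by auto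
  then have "(\<Sum>k\<in>F. \<theta> ^ nat \<bar>k\<bar>) = (\<Sum>k\<in>(F \<inter> {0..}) \<union> (F \<inter> {..<0}). \<theta> ^ nat \<bar>k\<bar>)" by simp
  also have "\<dots> = (\<Sum>k\<in>F \<inter> {0..}. \<theta> ^ nat \<bar>k\<bar>) + (\<Sum>k\<in>F \<inter> {..<0}. \<theta> ^ nat \<bar>k\<bar>)"
    using F by (intro sum.union_disjoint) auto
  also have "\<dots> \<le> 1 / (1 - \<theta>) + 1 / (1 - \<theta>)"
    using F by (intro add_mono half) (auto simp: inj_on_def)
  finally show ?thesis by simp
qed

text \<open>For \<open>r < m\<close> it equals \<open>t powr m\<close> below 1 and
  \<open>t powr r\<close> above. Unlike the indicator of \<open>t > 1\<close>, it reacts to every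
  change of scale: for \<open>0 < r < m\<close> and positive \<open>t\<close>, multiplying the
  argument by \<open>\<kappa> > 1\<close> multiplies the value by a factor between
  \<open>\<kappa> powr r\<close> and \<open>\<kappa> powr m\<close>.\<close>

definition level_fun :: "real \<Rightarrow> real \<Rightarrow> real \<Rightarrow> real" where
  "level_fun r m t = min (t powr r) (t powr m)"

lemma level_fun_nonneg [simp]: "level_fun r m t \<ge> 0"
  by (simp add: level_fun_def)

lemma level_fun_mono: "0 \<le> r \<Longrightarrow> 0 \<le> m \<Longrightarrow> 0 \<le> s \<Longrightarrow> s \<le> t \<Longrightarrow> level_fun r m s \<le> level_fun r m t"
  unfolding level_fun_def by (intro min.mono powr_mono2)

lemma level_fun_le_powr:
  assumes "r \<le> p" "p \<le> m" "t \<ge> 0" shows "level_fun r m t \<le> t powr p"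
proof (cases "t \<ge> 1")
  case True
  then have "t powr r \<le> t powr p" using assms by (intro powr_mono) auto
  then show ?thesis by (simp add: level_fun_def)
next
  case False
  then have "t powr m \<le> t powr p" using assms by (intro powr_mono') auto
  then show ?thesis by (simp add: level_fun_def)
qed

lemma level_fun_measurable [measurable]: "level_fun r m \<in> borel_measurable borel"
  unfolding level_fun_def by measurable

text \<open>Put \<open>y = log \<kappa> g - k j\<close>. As \<open>r < p < m\<close>, the
  \<open>j\<close>-th term is at most \<open>g powr p\<close> times
  \<open>\<kappa> powr (- c * \<bar>y\<bar>)\<close>: it decays geometrically on either side of the
  scale of \<open>g\<close>. Injectivity of \<open>k\<close> then leaves a two-sided geometric
  series, uniformly in \<open>g\<close>.\<close>

lemma level_fun_sum:
  assumes r: "r < p" "p < m" and \<kappa>: "\<kappa> > (1::real)"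
  shows "\<exists>C>0. \<forall>(k :: nat \<Rightarrow> int) g n. inj k \<longrightarrow> g > 0 \<longrightarrow>
    (\<Sum>j<n. (\<kappa> powr real_of_int (k j)) powr p * level_fun r m (g / \<kappa> powr real_of_int (k j))) \<le> C * g powr p"
proof -
  define c where "c = min (m - p) (p - r)"
  have c: "c > 0" using r by (simp add: c_def)
  define \<theta> where "\<theta> = \<kappa> powr (- c)"
  have \<theta>: "0 < \<theta>" "\<theta> < 1" using \<kappa> c by (auto simp: \<theta>_def powr_less_one)
  define C where "C = \<kappa> powr c * (2 / (1 - \<theta>))"
  have C: "C > 0" unfolding C_def using \<kappa> \<theta> by simp
  show ?thesis
  proof (intro exI[of _ C] conjI allI impI C)
    fix k :: "nat \<Rightarrow> int" and g :: real and n
    assume k: "inj k" and g: "g > 0"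
    define k0 where "k0 = \<lfloor>log \<kappa> g\<rfloor>"
    have single: "(\<kappa> powr real_of_int i) powr p * level_fun r m (g / \<kappa> powr real_of_int i) \<le> g powr p * (\<kappa> powr c * \<theta> ^ nat \<bar>i - k0\<bar>)" for i
    proof -
      define y where "y = log \<kappa> g - real_of_int i"
      define t where "t = g / \<kappa> powr real_of_int i"
      have t: "t = \<kappa> powr y" unfolding t_def y_def using g \<kappa> by (simp add: powr_diff)
      have gt: "g = t * \<kappa> powr real_of_int i" using \<kappa> by (simp add: t_def)
      have split: "\<kappa> powr (y * p + - c * \<bar>y\<bar>) = t powr p * \<kappa> powr (- c * \<bar>y\<bar>)"
        by (simp only: t powr_powr powr_add)
      have lf: "level_fun r m t \<le> t powr p * \<kappa> powr (- c * \<bar>y\<bar>)"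
      proof (cases "y \<ge> 0")
        case True
        have "level_fun r m t \<le> t powr r" by (simp add: level_fun_def)
        also have "t powr r = \<kappa> powr (y * r)" by (simp add: t powr_powr)
        also have "\<dots> \<le> \<kappa> powr (y * p + - c * \<bar>y\<bar>)"
        proof (rule powr_mono)
          have "y * c \<le> y * (p - r)" using True by (intro mult_left_mono) (auto simp: c_def)
          then show "y * r \<le> y * p + - c * \<bar>y\<bar>" using True by (simp add: algebra_simps)
        qed (use \<kappa> in simp)
        finally show ?thesis unfolding split .
      next
        case False
        have "level_fun r m t \<le> t powr m" by (simp add: level_fun_def)
        also have "t powr m = \<kappa> powr (y * m)" by (simp add: t powr_powr)
        also have "\<dots> \<le> \<kappa> powr (y * p + - c * \<bar>y\<bar>)"
        proof (rule powr_mono)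
          have "- y * c \<le> - y * (m - p)" using False by (intro mult_left_mono) (auto simp: c_def)
          then show "y * m \<le> y * p + - c * \<bar>y\<bar>" using False by (simp add: algebra_simps)
        qed (use \<kappa> in simp)
        finally show ?thesis unfolding split .
      qed
      \<comment> \<open>Replacing the real number \<open>log \<kappa> g\<close> by its integer part
        costs at most 1 in the distance, hence the factor \<open>\<kappa> powr c\<close>.\<close>
      have "real_of_int \<bar>i - k0\<bar> - 1 \<le> \<bar>y\<bar>" unfolding y_def k0_def by linarith
      then have "c * (real_of_int \<bar>i - k0\<bar> - 1) \<le> c * \<bar>y\<bar>" using c by (intro mult_left_mono) auto
      then have "\<kappa> powr (- c * \<bar>y\<bar>) \<le> \<kappa> powr (c + (- c) * real (nat \<bar>i - k0\<bar>))"
        using \<kappa> by (intro powr_mono) (auto simp: algebra_simps)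
      also have "\<dots> = \<kappa> powr c * \<theta> ^ nat \<bar>i - k0\<bar>"
        using \<kappa> by (simp only: powr_add \<theta>_def powr_realpow[symmetric] powr_gt_zero powr_powr)
      finally have "t powr p * \<kappa> powr (- c * \<bar>y\<bar>) \<le> t powr p * (\<kappa> powr c * \<theta> ^ nat \<bar>i - k0\<bar>)"
        by (intro mult_left_mono) auto
      with lf have "level_fun r m t \<le> t powr p * (\<kappa> powr c * \<theta> ^ nat \<bar>i - k0\<bar>)" by linarith
      then have "(\<kappa> powr real_of_int i) powr p * level_fun r m t \<le> (\<kappa> powr real_of_int i) powr p * (t powr p * (\<kappa> powr c * \<theta> ^ nat \<bar>i - k0\<bar>))"
        by (intro mult_left_mono) auto
      also have "\<dots> = g powr p * (\<kappa> powr c * \<theta> ^ nat \<bar>i - k0\<bar>)" unfolding gt powr_mult by (simp only: mult_ac)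
      finally show ?thesis unfolding t_def .
    qed
    have "(\<Sum>j<n. (\<kappa> powr real_of_int (k j)) powr p * level_fun r m (g / \<kappa> powr real_of_int (k j)))
       \<le> (\<Sum>j<n. g powr p * (\<kappa> powr c * \<theta> ^ nat \<bar>k j - k0\<bar>))" by (intro sum_mono single)
    also have "\<dots> = g powr p * (\<kappa> powr c * (\<Sum>j<n. \<theta> ^ nat \<bar>k j - k0\<bar>))" by (simp only: sum_distrib_left)
    also have "(\<Sum>j<n. \<theta> ^ nat \<bar>k j - k0\<bar>) = (\<Sum>i\<in>(\<lambda>j. k j - k0) ` {..<n}. \<theta> ^ nat \<bar>i\<bar>)"
      using k by (subst sum.reindex) (auto simp: inj_on_def)
    also have "g powr p * (\<kappa> powr c * (\<Sum>i\<in>(\<lambda>j. k j - k0) ` {..<n}. \<theta> ^ nat \<bar>i\<bar>)) \<le> g powr p * (\<kappa> powr c * (2 / (1 - \<theta>)))"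
      using \<theta> by (intro mult_left_mono sum_geometric_int_le) auto
    finally show "(\<Sum>j<n. (\<kappa> powr real_of_int (k j)) powr p * level_fun r m (g / \<kappa> powr real_of_int (k j))) \<le> C * g powr p"
      by (simp add: C_def mult_ac)
  qed
qed

lemma int_threshold:
  fixes S :: "int set"
  assumes "hi \<in> S" "\<And>k. k \<le> lo \<Longrightarrow> k \<notin> S"
  obtains k where "k \<in> S" "k - 1 \<notin> S"
proof -
  have "lo < hi" using assms by (meson not_less)
  then have ex: "\<exists>n::nat. lo + int n \<in> S" using assms(1) by (intro exI[of _ "nat (hi - lo)"]) simp
  define n where "n = (LEAST n::nat. lo + int n \<in> S)"
  have n: "lo + int n \<in> S" unfolding n_def using ex by (rule LeastI_ex)
  then have "n \<noteq> 0" using assms(2)[of lo] by (intro notI) simp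
  then obtain n' where n': "n = Suc n'" by (cases n) auto
  have "lo + int n' \<notin> S" using not_less_Least[of n' "\<lambda>n. lo + int n \<in> S"] n' by (simp add: n_def)
  then show ?thesis using that[of "lo + int n"] n n' by simp
qed

text \<open>The levels \<open>\<beta> j\<close> play the role of the values \<open>g\<^sup>*(\<rho>\<^bsup>-j\<^esup>)\<close> of the decreasing rearrangement. Measuring
  the level sets with \<open>level_fun\<close> instead of an indicator function forces \<open>\<beta>\<close> to grow
  geometrically, and this makes the final sum converge without recourse to Hardy's inequality.\<close>

lemma level_sequence:
  fixes M :: "'a measure"
  assumes r: "0 < r" "r < p" "p < m" and \<rho>: "\<rho> > (1::real)"
  shows "\<exists>C>0. \<forall>g\<in>borel_measurable M. (\<forall>x. g x \<ge> 0) \<longrightarrow> (\<integral>\<^sup>+x. ennreal (g x powr p) \<partial>M) < \<infinity> \<longrightarrow> (\<forall>\<epsilon>>0.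
    \<exists>\<beta>::nat \<Rightarrow> real. (\<forall>j. \<beta> j > 0) \<and>
      (\<forall>j. (\<integral>\<^sup>+x. ennreal (level_fun r m (g x / \<beta> j)) \<partial>M) \<le> ennreal (\<rho> powr - real j)) \<and>
      (\<Sum>j. ennreal (\<rho> powr - real j * \<beta> j powr p)) \<le> ennreal C * (\<integral>\<^sup>+x. ennreal (g x powr p) \<partial>M) + ennreal \<epsilon>)"
proof -
  \<comment> \<open>One step in the scale of powers of \<open>\<kappa>\<close> changes the integral
    \<open>N\<close> by a factor of at most \<open>\<kappa> powr m = \<rho>\<close>, so a threshold
    in this scale is precise up to one factor \<open>\<rho>\<close>.\<close>
  define \<kappa> where "\<kappa> = \<rho> powr (1 / m)"
  have m0: "m > 0" using r by simp
  have p0: "p > 0" using r by simp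
  have \<kappa>: "\<kappa> > 1" unfolding \<kappa>_def using \<rho> m0 by (intro gr_one_powr) auto
  have \<kappa>m: "\<kappa> powr (- m) = \<rho> powr (-1)" unfolding \<kappa>_def using m0 by (simp add: powr_powr)
  obtain D where D: "D > 0" "\<forall>(k :: nat \<Rightarrow> int) g n. inj k \<longrightarrow> g > 0 \<longrightarrow>
    (\<Sum>j<n. (\<kappa> powr real_of_int (k j)) powr p * level_fun r m (g / \<kappa> powr real_of_int (k j))) \<le> D * g powr p"
    using level_fun_sum[OF r(2,3) \<kappa>] by (elim exE conjE)
  show ?thesis
  proof (intro exI[of _ "\<rho> * D"] conjI ballI allI impI)
    show "\<rho> * D > 0" using \<rho> D by simp
    fix g :: "'a \<Rightarrow> real" and \<epsilon> :: real
    assume gm [measurable]: "g \<in> borel_measurable M" and g0': "\<forall>x. g x \<ge> 0"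
      and gi: "(\<integral>\<^sup>+x. ennreal (g x powr p) \<partial>M) < \<infinity>" and \<epsilon>: "\<epsilon> > 0"
    note g0 = g0'[rule_format]
    define I where "I = (\<integral>\<^sup>+x. ennreal (g x powr p) \<partial>M)"
    define N where "N l = (\<integral>\<^sup>+x. ennreal (level_fun r m (g x / l)) \<partial>M)" for l
    have Nanti: "N l' \<le> N l" if "0 < l" "l \<le> l'" for l l'
      unfolding N_def using that r g0 by (intro nn_integral_mono ennreal_leI level_fun_mono divide_left_mono) auto
    have Nup: "N l \<le> ennreal (l powr (- p)) * I" if "l > 0" for l
    proof -
      have "N l \<le> (\<integral>\<^sup>+x. ennreal (l powr (- p)) * ennreal (g x powr p) \<partial>M)" unfolding N_def
      proof (rule nn_integral_mono)
        fix x
        have "level_fun r m (g x / l) \<le> (g x / l) powr p" using r g0 that by (intro level_fun_le_powr) auto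
        also have "\<dots> = l powr (- p) * g x powr p" using that g0 by (simp add: powr_divide powr_minus_divide)
        finally show "ennreal (level_fun r m (g x / l)) \<le> ennreal (l powr (- p)) * ennreal (g x powr p)"
          by (simp add: ennreal_leI flip: ennreal_mult)
      qed
      also have "\<dots> = ennreal (l powr (- p)) * I" unfolding I_def by (rule nn_integral_cmult) measurable
      finally show ?thesis .
    qed
    show "\<exists>\<beta>::nat \<Rightarrow> real. (\<forall>j. \<beta> j > 0) \<and>
      (\<forall>j. (\<integral>\<^sup>+x. ennreal (level_fun r m (g x / \<beta> j)) \<partial>M) \<le> ennreal (\<rho> powr - real j)) \<and>
      (\<Sum>j. ennreal (\<rho> powr - real j * \<beta> j powr p)) \<le> ennreal (\<rho> * D) * (\<integral>\<^sup>+x. ennreal (g x powr p) \<partial>M) + ennreal \<epsilon>"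
    proof (cases "I = 0")
      case True
      \<comment> \<open>When \<open>g\<close> vanishes almost everywhere no level can be read off
        from it; a constant positive level is used, sized so that the series sums to
        \<open>\<epsilon>\<close>. This is where the summand \<open>\<epsilon>\<close> of the
        conclusion comes from.\<close>
      define \<eta> where "\<eta> = (\<epsilon> * (1 - 1 / \<rho>)) powr (1 / p)"
      have e0: "\<epsilon> * (1 - 1 / \<rho>) > 0" using \<epsilon> \<rho> by simp
      have \<eta>: "\<eta> > 0" "\<eta> powr p = \<epsilon> * (1 - 1 / \<rho>)" unfolding \<eta>_def using e0 p0 \<rho> \<epsilon> by (simp_all add: powr_powr)
      have s: "(\<lambda>j. \<rho> powr - real j * \<eta> powr p) sums \<epsilon>"
      proof -
        have "(\<lambda>j. (1 / \<rho>) ^ j) sums (1 / (1 - 1 / \<rho>))" using \<rho> by (intro geometric_sums) auto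
        note sums_mult2[OF this, of "\<eta> powr p"]
        moreover have "1 / (1 - 1 / \<rho>) * \<eta> powr p = \<epsilon>" using \<rho> unfolding \<eta>(2) by simp
        ultimately have "(\<lambda>j. (1 / \<rho>) ^ j * \<eta> powr p) sums \<epsilon>" by simp
        moreover have "\<rho> powr - real j = (1 / \<rho>) ^ j" for j
          using \<rho> by (simp add: powr_minus_divide powr_realpow power_one_over)
        ultimately show ?thesis by simp
      qed
      have "(\<Sum>j. ennreal (\<rho> powr - real j * \<eta> powr p)) = ennreal \<epsilon>"
        using sums_unique[OF s] sums_summable[OF s] by (subst suminf_ennreal2) auto
      moreover have "N \<eta> = 0" using Nup[OF \<eta>(1)] True by simp
      ultimately show ?thesis
        using \<eta>(1) by (intro exI[of _ "\<lambda>j. \<eta>"]) (simp add: N_def)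
    next
      case False
      obtain i where i: "I = ennreal i" "i > 0"
        using gi False unfolding I_def[symmetric] by (cases I) (auto simp: less_le)
      have "N 1 \<noteq> 0"
      proof
        assume "N 1 = 0"
        then have "AE x in M. ennreal (level_fun r m (g x)) = 0"
          unfolding N_def by (subst (asm) nn_integral_0_iff_AE) auto
        then have "AE x in M. ennreal (g x powr p) = 0"
        proof eventually_elim
          case (elim x)
          then have "level_fun r m (g x) = 0" by (simp add: ennreal_eq_0_iff antisym)
          then have "g x = 0" by (auto simp: level_fun_def min_def split: if_splits)
          then show ?case by simp
        qed
        then have "I = 0" unfolding I_def by (subst nn_integral_0_iff_AE) auto
        then show False using False by simp
      qed
      moreover have "N 1 < \<infinity>" using Nup[of 1] gi unfolding I_def[symmetric] by (auto intro: le_less_trans)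
      ultimately obtain n1 where n1: "N 1 = ennreal n1" "n1 > 0" by (cases "N 1") (auto simp: less_le)
      \<comment> \<open>\<open>N\<close> tends to infinity as the level tends to 0, because
        \<open>N 1 > 0\<close> and \<open>level_fun\<close> grows at least like the power
        \<open>r\<close>; hence small levels violate the requirement and a threshold exists.\<close>
      have Nlow: "ennreal (l powr (- r)) * N 1 \<le> N l" if l: "0 < l" "l \<le> 1" for l
      proof -
        have "ennreal (l powr (- r)) * N 1 = (\<integral>\<^sup>+x. ennreal (l powr (- r)) * ennreal (level_fun r m (g x / 1)) \<partial>M)"
          unfolding N_def by (rule nn_integral_cmult[symmetric]) measurable
        also have "\<dots> \<le> N l" unfolding N_def
        proof (rule nn_integral_mono)
          fix x
          have "l powr (- r) * level_fun r m (g x) \<le> level_fun r m (g x / l)"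
          proof -
            have "l powr (- r) * level_fun r m (g x) \<le> l powr (- r) * g x powr r"
              by (intro mult_left_mono) (auto simp: level_fun_def)
            also have "\<dots> = (g x / l) powr r" using l g0 by (simp add: powr_divide powr_minus_divide)
            finally have 1: "l powr (- r) * level_fun r m (g x) \<le> (g x / l) powr r" .
            have "l powr (- r) * level_fun r m (g x) \<le> l powr (- m) * g x powr m"
              using l r by (intro mult_mono powr_mono') (auto simp: level_fun_def)
            also have "\<dots> = (g x / l) powr m" using l g0 by (simp add: powr_divide powr_minus_divide)
            finally show ?thesis using 1 by (simp add: level_fun_def)
          qed
          then show "ennreal (l powr (- r)) * ennreal (level_fun r m (g x / 1)) \<le> ennreal (level_fun r m (g x / l))"
            by (simp add: ennreal_leI flip: ennreal_mult)
        qed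
        finally show ?thesis .
      qed
      define S where "S j = {k. N (\<kappa> powr real_of_int k) \<le> ennreal (\<rho> powr - real j)}" for j :: nat
      have "\<exists>k. k \<in> S j \<and> k - 1 \<notin> S j" for j
      proof -
        define X where "X = (i * \<rho> powr real j) powr (1 / p)"
        have X: "X > 0" "X powr p = i * \<rho> powr real j" unfolding X_def using i \<rho> p0 by (simp_all add: powr_powr)
        define hi where "hi = \<lceil>log \<kappa> X\<rceil>"
        have "X = \<kappa> powr log \<kappa> X" using X \<kappa> by simp
        also have "\<dots> \<le> \<kappa> powr real_of_int hi" unfolding hi_def using \<kappa> by (intro powr_mono) auto
        finally have hX: "X \<le> \<kappa> powr real_of_int hi" .
        have "N (\<kappa> powr real_of_int hi) \<le> N X" by (rule Nanti[OF X(1) hX])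
        also have "\<dots> \<le> ennreal (X powr (- p) * i)" using Nup[OF X(1)] i by (simp add: ennreal_mult)
        also have "X powr (- p) * i = \<rho> powr - real j" using X i \<rho> by (simp add: powr_minus_divide)
        finally have 1: "hi \<in> S j" by (simp add: S_def)
        define Y where "Y = min 1 ((n1 * \<rho> powr real j / 2) powr (1 / r))"
        have Y: "Y > 0" "Y \<le> 1" unfolding Y_def using n1 \<rho> by auto
        have "Y powr r \<le> ((n1 * \<rho> powr real j / 2) powr (1 / r)) powr r"
          using Y r by (intro powr_mono2) (auto simp: Y_def)
        also have "\<dots> = n1 * \<rho> powr real j / 2" using n1 r \<rho> by (simp add: powr_powr)
        also have "\<dots> < n1 * \<rho> powr real j" using n1 \<rho> by simp
        finally have "\<rho> powr - real j < Y powr (- r) * n1"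
          using Y n1 \<rho> by (simp add: powr_minus_divide field_simps)
        then have "ennreal (\<rho> powr - real j) < ennreal (Y powr (- r) * n1)" by (intro ennreal_lessI) (use Y n1 in auto)
        also have "\<dots> \<le> N Y" using Nlow[OF Y] n1 by (simp add: ennreal_mult)
        finally have NY: "ennreal (\<rho> powr - real j) < N Y" .
        define lo where "lo = \<lfloor>log \<kappa> Y\<rfloor>"
        have 2: "k \<notin> S j" if "k \<le> lo" for k
        proof -
          have "\<kappa> powr real_of_int k \<le> \<kappa> powr log \<kappa> Y" using that \<kappa> unfolding lo_def by (intro powr_mono) linarith+
          also have "\<dots> = Y" using Y \<kappa> by simp
          finally have "N Y \<le> N (\<kappa> powr real_of_int k)" using \<kappa> by (intro Nanti) auto
          with NY show ?thesis by (auto simp: S_def)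
        qed
        from int_threshold[OF 1 2] obtain k where "k \<in> S j" "k - 1 \<notin> S j" by blast
        then show ?thesis by auto
      qed
      then have "\<forall>j. \<exists>k. k \<in> S j \<and> k - 1 \<notin> S j" ..
      from choice[OF this] obtain k where k': "\<forall>j. k j \<in> S j \<and> k j - 1 \<notin> S j" ..
      define \<beta> where "\<beta> j = \<kappa> powr real_of_int (k j)" for j
      have \<beta>: "\<beta> j > 0" for j using \<kappa> by (simp add: \<beta>_def)
      have NB: "N (\<beta> j) \<le> ennreal (\<rho> powr - real j)" for j
        using k' by (auto simp: S_def \<beta>_def)
      \<comment> \<open>The next lower power of \<open>\<kappa>\<close> is inadmissible, and one
        step loses at most the factor \<open>\<rho>\<close>: thus \<open>N (\<beta> j)\<close> lies
        between \<open>\<rho> powr - real (Suc j)\<close> and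
        \<open>\<rho> powr - real j\<close>.\<close>
      have low: "ennreal (\<rho> powr - real (Suc j)) < N (\<beta> j)" for j
      proof -
        have 1: "ennreal (\<rho> powr - real j) < N (\<kappa> powr real_of_int (k j - 1))"
          using k' by (auto simp: S_def not_le)
        have eq: "\<kappa> powr real_of_int (k j - 1) = \<beta> j / \<kappa>" using \<kappa> by (simp add: \<beta>_def powr_diff)
        have 2: "ennreal (\<kappa> powr (- m)) * N (\<beta> j / \<kappa>) \<le> N (\<beta> j)"
        proof -
          have "ennreal (\<kappa> powr (- m)) * N (\<beta> j / \<kappa>) = (\<integral>\<^sup>+x. ennreal (\<kappa> powr (- m)) * ennreal (level_fun r m (g x / (\<beta> j / \<kappa>))) \<partial>M)"
            unfolding N_def by (rule nn_integral_cmult[symmetric]) measurable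
          also have "\<dots> \<le> N (\<beta> j)" unfolding N_def
          proof (rule nn_integral_mono)
            fix x
            define t where "t = g x / \<beta> j"
            have t: "t \<ge> 0" using g0 \<beta>[of j] by (simp add: t_def)
            have kt: "g x / (\<beta> j / \<kappa>) = \<kappa> * t" by (simp add: t_def)
            have "\<kappa> powr (- m) * level_fun r m (\<kappa> * t) \<le> \<kappa> powr (- m) * (\<kappa> powr m * t powr m)"
              by (intro mult_left_mono) (auto simp: level_fun_def powr_mult)
            also have "\<dots> = t powr m" using \<kappa> by (simp add: powr_minus_divide)
            finally have 1: "\<kappa> powr (- m) * level_fun r m (\<kappa> * t) \<le> t powr m" .
            have "\<kappa> powr (- m) * level_fun r m (\<kappa> * t) \<le> \<kappa> powr (- r) * (\<kappa> powr r * t powr r)"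
              using \<kappa> r by (intro mult_mono powr_mono) (auto simp: level_fun_def powr_mult)
            also have "\<dots> = t powr r" using \<kappa> by (simp add: powr_minus_divide)
            finally have "\<kappa> powr (- m) * level_fun r m (\<kappa> * t) \<le> level_fun r m t" using 1 by (simp add: level_fun_def)
            then show "ennreal (\<kappa> powr (- m)) * ennreal (level_fun r m (g x / (\<beta> j / \<kappa>))) \<le> ennreal (level_fun r m (g x / \<beta> j))"
              unfolding kt t_def[symmetric] by (simp add: ennreal_leI flip: ennreal_mult)
          qed
          finally show ?thesis .
        qed
        have "ennreal (\<rho> powr - real (Suc j)) = ennreal (\<kappa> powr (- m)) * ennreal (\<rho> powr - real j)"
        proof -
          have "\<rho> powr - real (Suc j) = \<rho> powr (-1) * \<rho> powr - real j" unfolding powr_add[symmetric] by simp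
          then show ?thesis unfolding \<kappa>m by (simp only: ennreal_mult powr_ge_zero)
        qed
        also have "\<dots> < ennreal (\<kappa> powr (- m)) * N (\<beta> j / \<kappa>)"
          using 1 \<kappa> unfolding eq by (intro ennreal_mult_strict_left_mono) auto
        finally show ?thesis using 2 by (rule less_le_trans)
      qed
      \<comment> \<open>The ranges of \<open>N (\<beta> j)\<close> for consecutive \<open>j\<close>
        do not overlap, so the exponents increase strictly; this gives the injectivity that the
        geometric summation needs.\<close>
      have "k j < k (Suc j)" for j
      proof (rule ccontr)
        assume "\<not> k j < k (Suc j)"
        then have "\<beta> (Suc j) \<le> \<beta> j" unfolding \<beta>_def using \<kappa> by (intro powr_mono) auto
        then have "N (\<beta> j) \<le> N (\<beta> (Suc j))" by (intro Nanti \<beta>)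
        with NB[of "Suc j"] low[of j] show False by auto
      qed
      then have "strict_mono k" by (simp add: strict_mono_Suc_iff)
      then have inj: "inj k" by (rule strict_mono_imp_inj_on)
      \<comment> \<open>The numbers \<open>\<rho> powr - real j\<close> are traded for the integrals
        \<open>N (\<beta> j)\<close>; exchanging sum and integral reduces the claim to a pointwise
        sum over the levels.\<close>
      have "(\<Sum>j. ennreal (\<rho> powr - real j * \<beta> j powr p)) \<le> (\<Sum>j. ennreal (\<rho> * \<beta> j powr p) * N (\<beta> j))"
      proof (intro suminf_le summableI)
        fix j
        have "ennreal (\<rho> powr - real j * \<beta> j powr p) = ennreal (\<rho> * \<beta> j powr p) * ennreal (\<rho> powr - real (Suc j))"
        proof -
          have "\<rho> powr - real j = \<rho> * \<rho> powr - real (Suc j)"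
          proof -
            have "\<rho> * \<rho> powr - real (Suc j) = \<rho> powr (1 + - real (Suc j))"
              using \<rho> by (intro powr_mult_base) simp
            also have "1 + - real (Suc j) = - real j" by simp
            finally show ?thesis by (rule sym)
          qed
          then have "\<rho> powr - real j * \<beta> j powr p = (\<rho> * \<beta> j powr p) * \<rho> powr - real (Suc j)"
            by (simp only: mult_ac)
          moreover have "ennreal ((\<rho> * \<beta> j powr p) * \<rho> powr - real (Suc j)) = ennreal (\<rho> * \<beta> j powr p) * ennreal (\<rho> powr - real (Suc j))"
            using \<rho> by (intro ennreal_mult) auto
          ultimately show ?thesis by (simp only:)
        qed
        also have "\<dots> \<le> ennreal (\<rho> * \<beta> j powr p) * N (\<beta> j)"
          using low[of j] by (intro mult_left_mono) auto
        finally show "ennreal (\<rho> powr - real j * \<beta> j powr p) \<le> ennreal (\<rho> * \<beta> j powr p) * N (\<beta> j)" .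
      qed
      also have "\<dots> = (\<Sum>j. \<integral>\<^sup>+x. ennreal (\<rho> * (\<beta> j powr p * level_fun r m (g x / \<beta> j))) \<partial>M)"
      proof (intro arg_cong[where f = suminf] ext)
        fix j
        have "ennreal (\<rho> * \<beta> j powr p) * N (\<beta> j) = (\<integral>\<^sup>+x. ennreal (\<rho> * \<beta> j powr p) * ennreal (level_fun r m (g x / \<beta> j)) \<partial>M)"
          unfolding N_def by (rule nn_integral_cmult[symmetric]) measurable
        then show "ennreal (\<rho> * \<beta> j powr p) * N (\<beta> j) = (\<integral>\<^sup>+x. ennreal (\<rho> * (\<beta> j powr p * level_fun r m (g x / \<beta> j))) \<partial>M)"
          using \<rho> by (simp add: mult.assoc flip: ennreal_mult)
      qed
      also have "\<dots> = (\<integral>\<^sup>+x. (\<Sum>j. ennreal (\<rho> * (\<beta> j powr p * level_fun r m (g x / \<beta> j)))) \<partial>M)"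
        by (rule nn_integral_suminf[symmetric]) measurable
      also have "\<dots> \<le> (\<integral>\<^sup>+x. ennreal (\<rho> * D) * ennreal (g x powr p) \<partial>M)"
      proof (intro nn_integral_mono suminf_le_const summableI)
        fix x n
        have "(\<Sum>j<n. \<beta> j powr p * level_fun r m (g x / \<beta> j)) \<le> D * g x powr p"
        proof (cases "g x = 0")
          case True
          then show ?thesis by (simp add: level_fun_def)
        next
          case False
          then have "g x > 0" using g0[of x] by simp
          then show ?thesis unfolding \<beta>_def using D(2)[rule_format, OF inj, of "g x" n] by simp
        qed
        then have "(\<Sum>j<n. \<rho> * (\<beta> j powr p * level_fun r m (g x / \<beta> j))) \<le> \<rho> * D * g x powr p"
          using \<rho> by (simp add: mult.assoc flip: sum_distrib_left)
        moreover have "(\<Sum>j<n. ennreal (\<rho> * (\<beta> j powr p * level_fun r m (g x / \<beta> j)))) =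
           ennreal (\<Sum>j<n. \<rho> * (\<beta> j powr p * level_fun r m (g x / \<beta> j)))"
          using \<rho> by (intro sum_ennreal) auto
        ultimately show "(\<Sum>j<n. ennreal (\<rho> * (\<beta> j powr p * level_fun r m (g x / \<beta> j)))) \<le> ennreal (\<rho> * D) * ennreal (g x powr p)"
          using \<rho> D(1) by (simp add: ennreal_leI flip: ennreal_mult)
      qed
      also have "\<dots> = ennreal (\<rho> * D) * I" unfolding I_def by (rule nn_integral_cmult) measurable
      finally have "(\<Sum>j. ennreal (\<rho> powr - real j * \<beta> j powr p)) \<le> ennreal (\<rho> * D) * I + ennreal \<epsilon>"
        by (rule order_trans) simp
      then show ?thesis using \<beta> NB unfolding I_def N_def by (intro exI[of _ \<beta>]) simp
    qed
  qed
qed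

section \<open>Powers of extended nonnegative reals\<close>

lemma ennreal_powr_ennreal: "t \<ge> 0 \<Longrightarrow> ennreal_powr (ennreal t) r = ennreal (t powr r)"
  by (simp add: ennreal_powr_def)

lemma ennreal_powr_top [simp]: "ennreal_powr top r = top"
  by (simp add: ennreal_powr_def)

lemma ennreal_powr_0 [simp]: "ennreal_powr 0 r = 0"
  by (simp add: ennreal_powr_def)

lemma ennreal_powr_mono: "0 \<le> r \<Longrightarrow> x \<le> y \<Longrightarrow> ennreal_powr x r \<le> ennreal_powr y r"
  by (cases x; cases y) (auto simp: ennreal_powr_ennreal top_unique intro!: ennreal_leI powr_mono2)

lemma ennreal_powr_mult:
  assumes "0 < r" shows "ennreal_powr (x * y) r = ennreal_powr x r * ennreal_powr y r"
proof (cases x)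
  case (real s)
  show ?thesis
  proof (cases y)
    case (real t)
    then show ?thesis using \<open>x = ennreal s\<close> \<open>0 \<le> s\<close>
      by (simp add: ennreal_powr_ennreal powr_mult flip: ennreal_mult)
  next
    case top
    then show ?thesis using \<open>x = ennreal s\<close> \<open>0 \<le> s\<close>
      by (cases "s = 0") (auto simp: ennreal_powr_ennreal ennreal_mult_top)
  qed
next
  case top
  note x = top
  show ?thesis
  proof (cases y)
    case (real t)
    then show ?thesis using x by (cases "t = 0") (auto simp: ennreal_powr_ennreal ennreal_top_mult)
  qed (simp add: x)
qed

lemma ennreal_powr_powr: "ennreal_powr (ennreal_powr x r) s = ennreal_powr x (r * s)"
  by (cases x) (auto simp: ennreal_powr_ennreal powr_powr)

lemma ennreal_powr_1 [simp]: "ennreal_powr x 1 = x"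
  by (cases x) (auto simp: ennreal_powr_ennreal)

lemma ennreal_powr_measurable [measurable]: "(\<lambda>x. ennreal_powr x r) \<in> borel_measurable borel"
  unfolding ennreal_powr_def by measurable

lemma ennreal_powr_cancel: "0 < r \<Longrightarrow> ennreal_powr (ennreal_powr x r) (1 / r) = x"
  by (simp add: ennreal_powr_powr)

lemma ennreal_powr_cancel': "0 < r \<Longrightarrow> ennreal_powr (ennreal_powr x (1 / r)) r = x"
  by (simp add: ennreal_powr_powr)

lemma lq_norm_powr: "0 < q \<Longrightarrow> ennreal_powr (lq_norm (ereal q) c) q = (\<Sum>j. ennreal_powr (c j) q)"
  by (simp add: lq_norm_def ennreal_powr_cancel')

lemma Lp_norm_powr: "0 < p \<Longrightarrow> ennreal_powr (Lp_norm (ereal p) g) p = (\<integral>\<^sup>+x. ennreal_powr (g x) p \<partial>lborel)"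
  by (simp add: Lp_norm_def ennreal_powr_cancel')

lemma le_lq_norm:
  assumes "0 < q" shows "c j \<le> lq_norm q c"
proof (cases "q = \<infinity>")
  case True
  then show ?thesis by (simp add: lq_norm_def SUP_upper)
next
  case False
  then obtain r where r: "q = ereal r" "r > 0" using assms by (cases q) auto
  have "ennreal_powr (c j) r \<le> (\<Sum>j. ennreal_powr (c j) r)" by (rule ennreal_le_suminf)
  then have "ennreal_powr (ennreal_powr (c j) r) (1 / r) \<le> ennreal_powr (\<Sum>j. ennreal_powr (c j) r) (1 / r)"
    using r by (intro ennreal_powr_mono) auto
  then show ?thesis using r by (simp add: lq_norm_def ennreal_powr_cancel)
qed

section \<open>The embedding of Lizorkin--Triebel into Besov spaces\<close>

text \<open>\<open>g\<close> is the maximum over finitely many blocks, hence real-valued and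
  measurable, and lies below the inner quasi-norm for every \<open>q\<close>. In the block estimate
  with exponent \<open>r = p / 2\<close> the level \<open>\<beta> j\<close> supplies the constant
  part; the excess has an integral of order 2^(-j|a|), relative to that part, which cancels the
  dilation factor.\<close>

lemma maximal_level_bound:
  fixes a :: "real^'n::finite" and \<psi> :: "real^'n \<Rightarrow> complex"
  assumes a: "anisotropy a" and \<psi>: "cutoff a \<psi>" and p: "0 < p" "p < m" and q: "0 < (q::ereal)"
  shows "\<exists>C>0. \<forall>f\<in>tempered_distributions. triebel_norm a \<psi> s (ereal p) q f < \<infinity> \<longrightarrow> (\<forall>n. \<forall>\<epsilon>>0. \<exists>\<beta>::nat \<Rightarrow> real.
    (\<forall>j. \<beta> j > 0) \<and>
    (\<forall>j<n. \<forall>x. 2 powr (real j * s) * norm (freq_block a \<psi> j f x) \<le> C * \<beta> j) \<and>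
    (\<forall>j<n. (\<integral>\<^sup>+x. ennreal (level_fun (p / 2) m (2 powr (real j * s) * norm (freq_block a \<psi> j f x) / \<beta> j)) \<partial>lborel)
       \<le> ennreal (2 powr (- (real j * aniso_size a)))) \<and>
    (\<Sum>j. ennreal (2 powr (- (real j * aniso_size a)) * \<beta> j powr p))
       \<le> ennreal C * ennreal_powr (triebel_norm a \<psi> s (ereal p) q f) p + ennreal \<epsilon>)"
proof -
  define d where "d = aniso_size a"
  have d: "d > 0" unfolding d_def by (rule aniso_size_pos[OF a])
  define \<rho> where "\<rho> = 2 powr d"
  have \<rho>: "\<rho> > 1" unfolding \<rho>_def using d by (intro gr_one_powr) auto
  have \<rho>j: "\<rho> powr x = 2 powr (x * d)" for x by (simp add: \<rho>_def powr_powr mult.commute)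
  define r where "r = p / 2"
  have r: "0 < r" "r < p" "p < m" using p by (auto simp: r_def)
  obtain C1 where C1: "C1 > 0" "\<forall>f\<in>tempered_distributions. \<forall>j x \<mu>. \<forall>h\<in>borel_measurable borel.
      (\<forall>y. ennreal (norm (freq_block a \<psi> j f y) powr r) \<le> \<mu> + h y) \<longrightarrow>
      ennreal (norm (freq_block a \<psi> j f x) powr r)
        \<le> ennreal C1 * (\<mu> + ennreal (2 powr (real j * aniso_size a)) * (\<integral>\<^sup>+y. h y \<partial>lborel))"
    using block_estimate[OF a \<psi> r(1)] by (elim exE conjE)
  obtain C2 where C2: "C2 > 0" "\<forall>g\<in>borel_measurable (lborel :: (real^'n) measure). (\<forall>x. g x \<ge> 0) \<longrightarrow> (\<integral>\<^sup>+x. ennreal (g x powr p) \<partial>lborel) < \<infinity> \<longrightarrow> (\<forall>\<epsilon>>0.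
    \<exists>\<beta>::nat \<Rightarrow> real. (\<forall>j. \<beta> j > 0) \<and>
      (\<forall>j. (\<integral>\<^sup>+x. ennreal (level_fun r m (g x / \<beta> j)) \<partial>lborel) \<le> ennreal (\<rho> powr - real j)) \<and>
      (\<Sum>j. ennreal (\<rho> powr - real j * \<beta> j powr p)) \<le> ennreal C2 * (\<integral>\<^sup>+x. ennreal (g x powr p) \<partial>lborel) + ennreal \<epsilon>)"
    using level_sequence[OF r \<rho>, of "lborel :: (real^'n) measure"] by (elim exE conjE)
  define C where "C = max ((2 * C1) powr (1 / r)) C2"
  have C: "C > 0" using C2 by (simp add: C_def)
  show ?thesis
  proof (intro exI[of _ C] conjI ballI impI allI C)
    fix f :: "'n distr" and n :: nat and \<epsilon> :: real
    assume f: "f \<in> tempered_distributions" and fin: "triebel_norm a \<psi> s (ereal p) q f < \<infinity>" and \<epsilon>: "\<epsilon> > 0"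
    define b where "b j x = 2 powr (real j * s) * norm (freq_block a \<psi> j f x)" for j x
    have b0: "b j x \<ge> 0" for j x by (simp add: b_def)
    have [measurable]: "freq_block a \<psi> j f \<in> borel_measurable borel" for j
      by (intro borel_measurable_continuous_onI freq_block_continuous_growth[OF a \<psi> f])
    have bm [measurable]: "b j \<in> borel_measurable borel" for j unfolding b_def by measurable
    define g where "g x = Max ((\<lambda>j. b j x) ` {..n})" for x
    have gm [measurable]: "g \<in> borel_measurable borel" unfolding g_def by (intro borel_measurable_Max bm) simp
    have bg: "b j x \<le> g x" if "j \<le> n" for j x unfolding g_def using that by (intro Max_ge) auto
    have g0: "g x \<ge> 0" for x using bg[of 0 x] b0[of 0 x] by simp
    define T where "T = ennreal_powr (triebel_norm a \<psi> s (ereal p) q f) p"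
    have gT: "(\<integral>\<^sup>+x. ennreal (g x powr p) \<partial>lborel) \<le> T"
    proof -
      let ?G = "\<lambda>x. lq_norm q (\<lambda>j. ennreal (2 powr (real j * s)) * ennreal (norm (freq_block a \<psi> j f x)))"
      have "(\<integral>\<^sup>+x. ennreal (g x powr p) \<partial>lborel) \<le> (\<integral>\<^sup>+x. ennreal_powr (?G x) p \<partial>lborel)"
      proof (rule nn_integral_mono)
        fix x
        have "g x \<in> (\<lambda>j. b j x) ` {..n}" unfolding g_def by (intro Max_in) auto
        then obtain j where j: "g x = b j x" by auto
        have "ennreal (g x) = ennreal (2 powr (real j * s)) * ennreal (norm (freq_block a \<psi> j f x))"
          unfolding j b_def by (intro ennreal_mult) auto
        also have "\<dots> \<le> ?G x" by (rule le_lq_norm[OF q])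
        finally have "ennreal_powr (ennreal (g x)) p \<le> ennreal_powr (?G x) p" using p by (intro ennreal_powr_mono) auto
        then show "ennreal (g x powr p) \<le> ennreal_powr (?G x) p" by (simp add: ennreal_powr_ennreal g0)
      qed
      also have "\<dots> = T" unfolding T_def triebel_norm_def by (rule Lp_norm_powr[OF p(1), symmetric])
      finally show ?thesis .
    qed
    have "T < \<infinity>" unfolding T_def using fin by (cases "triebel_norm a \<psi> s (ereal p) q f") (auto simp: ennreal_powr_ennreal)
    then have "(\<integral>\<^sup>+x. ennreal (g x powr p) \<partial>lborel) < \<infinity>" using gT by (rule le_less_trans[rotated])
    then have "\<exists>\<beta>::nat \<Rightarrow> real. (\<forall>j. \<beta> j > 0) \<and>
      (\<forall>j. (\<integral>\<^sup>+x. ennreal (level_fun r m (g x / \<beta> j)) \<partial>lborel) \<le> ennreal (\<rho> powr - real j)) \<and>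
      (\<Sum>j. ennreal (\<rho> powr - real j * \<beta> j powr p)) \<le> ennreal C2 * (\<integral>\<^sup>+x. ennreal (g x powr p) \<partial>lborel) + ennreal \<epsilon>"
    proof -
      have gl: "g \<in> borel_measurable lborel" using gm by simp
      have g0': "\<forall>x. g x \<ge> 0" using g0 by simp
      note C2(2)[THEN bspec, OF gl, THEN mp, OF g0', THEN mp, OF \<open>(\<integral>\<^sup>+x. ennreal (g x powr p) \<partial>lborel) < \<infinity>\<close>, THEN spec, of \<epsilon>, THEN mp, OF \<epsilon>]
      then show ?thesis .
    qed
    then obtain \<beta> :: "nat \<Rightarrow> real" where \<beta>': "\<forall>j. \<beta> j > 0" and
      N': "\<forall>j. (\<integral>\<^sup>+x. ennreal (level_fun r m (g x / \<beta> j)) \<partial>lborel) \<le> ennreal (\<rho> powr - real j)" and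
      S: "(\<Sum>j. ennreal (\<rho> powr - real j * \<beta> j powr p)) \<le> ennreal C2 * (\<integral>\<^sup>+x. ennreal (g x powr p) \<partial>lborel) + ennreal \<epsilon>"
      by (elim exE conjE)
    note \<beta> = \<beta>'[rule_format] and N = N'[rule_format]
    have sup: "b j x \<le> C * \<beta> j" if j: "j < n" for j x
    proof -
      define c where "c = 2 powr (- (real j * s) * r) * \<beta> j powr r"
      have c0: "c \<ge> 0" by (simp add: c_def)
      have ub: "norm (freq_block a \<psi> j f y) powr r = 2 powr (- (real j * s) * r) * b j y powr r" for y
        unfolding b_def powr_mult powr_powr by (simp flip: mult.assoc powr_add)
      have "ennreal (norm (freq_block a \<psi> j f y) powr r) \<le> ennreal c + ennreal c * ennreal (level_fun r m (g y / \<beta> j))" for y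
      proof -
        \<comment> \<open>Where the block is below its level the first term suffices; above it the
          ratio is at least 1, where \<open>level_fun\<close> is the power \<open>r\<close>.\<close>
        have "b j y powr r \<le> \<beta> j powr r + \<beta> j powr r * level_fun r m (g y / \<beta> j)"
        proof (cases "b j y \<le> \<beta> j")
          case True
          then have "b j y powr r \<le> \<beta> j powr r" using r b0 by (intro powr_mono2) auto
          then show ?thesis by (simp add: add_increasing2)
        next
          case False
          then have t: "1 \<le> b j y / \<beta> j" "b j y / \<beta> j \<le> g y / \<beta> j"
            using \<beta>[of j] bg[of j y] j by (auto simp: divide_right_mono less_imp_le)
          have "(b j y / \<beta> j) powr r \<le> level_fun r m (b j y / \<beta> j)"
            using t r by (simp add: level_fun_def powr_mono)
          also have "\<dots> \<le> level_fun r m (g y / \<beta> j)" using t r by (intro level_fun_mono) auto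
          finally have "\<beta> j powr r * (b j y / \<beta> j) powr r \<le> \<beta> j powr r * level_fun r m (g y / \<beta> j)"
            by (intro mult_left_mono) auto
          moreover have "\<beta> j powr r * (b j y / \<beta> j) powr r = b j y powr r"
            unfolding powr_mult[symmetric] using \<beta>[of j] by simp
          ultimately show ?thesis by (simp add: add_increasing)
        qed
        then have "2 powr (- (real j * s) * r) * b j y powr r \<le> 2 powr (- (real j * s) * r) * (\<beta> j powr r + \<beta> j powr r * level_fun r m (g y / \<beta> j))"
          by (intro mult_left_mono) auto
        also have "\<dots> = c + c * level_fun r m (g y / \<beta> j)" by (simp add: c_def distrib_left mult.assoc)
        finally show ?thesis unfolding ub using c0 by (simp add: ennreal_leI flip: ennreal_plus ennreal_mult)
      qed
      then have "ennreal (norm (freq_block a \<psi> j f x) powr r) \<le> ennreal C1 * (ennreal c + ennreal (2 powr (real j * aniso_size a)) *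
          (\<integral>\<^sup>+y. ennreal c * ennreal (level_fun r m (g y / \<beta> j)) \<partial>lborel))"
        by (intro C1(2)[THEN bspec, OF f, THEN spec, of j, THEN spec, of x, THEN spec, of "ennreal c", THEN bspec,
            of "\<lambda>y. ennreal c * ennreal (level_fun r m (g y / \<beta> j))", THEN mp] allI) measurable
      also have "(\<integral>\<^sup>+y. ennreal c * ennreal (level_fun r m (g y / \<beta> j)) \<partial>lborel) = ennreal c * (\<integral>\<^sup>+y. ennreal (level_fun r m (g y / \<beta> j)) \<partial>lborel)"
        by (rule nn_integral_cmult) measurable
      also have "ennreal C1 * (ennreal c + ennreal (2 powr (real j * aniso_size a)) * (ennreal c * (\<integral>\<^sup>+y. ennreal (level_fun r m (g y / \<beta> j)) \<partial>lborel)))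
        \<le> ennreal C1 * (ennreal c + ennreal (2 powr (real j * aniso_size a)) * (ennreal c * ennreal (\<rho> powr - real j)))"
        by (intro mult_left_mono add_left_mono N) auto
      also have "ennreal (2 powr (real j * aniso_size a)) * (ennreal c * ennreal (\<rho> powr - real j)) = ennreal c"
      proof -
        have "2 powr (real j * aniso_size a) * (c * \<rho> powr - real j) = c"
          by (simp add: \<rho>j d_def mult.left_commute flip: powr_add)
        then show ?thesis using c0 by (simp flip: ennreal_mult)
      qed
      also have "ennreal C1 * (ennreal c + ennreal c) = ennreal (2 * C1 * c)"
        using C1(1) c0 by (simp add: mult_ac flip: ennreal_plus ennreal_mult)
      finally have "norm (freq_block a \<psi> j f x) powr r \<le> 2 * C1 * c"
        using C1(1) c0 by (subst (asm) ennreal_le_iff) auto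
      then have "2 powr (- (real j * s) * r) * b j x powr r \<le> 2 powr (- (real j * s) * r) * (2 * C1 * \<beta> j powr r)"
        unfolding ub c_def by (simp only: mult_ac)
      then have "b j x powr r \<le> 2 * C1 * \<beta> j powr r" by (rule mult_left_le_imp_le) simp
      then have "(b j x powr r) powr (1 / r) \<le> (2 * C1 * \<beta> j powr r) powr (1 / r)" using r by (intro powr_mono2) auto
      also have "\<dots> = (2 * C1) powr (1 / r) * (\<beta> j powr r) powr (1 / r)" by (rule powr_mult)
      finally have "b j x \<le> (2 * C1) powr (1 / r) * \<beta> j" using r b0[of j x] \<beta>[of j] by (simp add: powr_powr)
      also have "\<dots> \<le> C * \<beta> j" using \<beta>[of j] by (intro mult_right_mono) (auto simp: C_def)
      finally show ?thesis .
    qed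
    have bint: "(\<integral>\<^sup>+x. ennreal (level_fun r m (b j x / \<beta> j)) \<partial>lborel) \<le> ennreal (2 powr (- (real j * aniso_size a)))" if "j < n" for j
    proof -
      have "(\<integral>\<^sup>+x. ennreal (level_fun r m (b j x / \<beta> j)) \<partial>lborel) \<le> (\<integral>\<^sup>+x. ennreal (level_fun r m (g x / \<beta> j)) \<partial>lborel)"
        using r b0 bg that \<beta>[of j] by (intro nn_integral_mono ennreal_leI level_fun_mono divide_right_mono divide_nonneg_pos) auto
      also have "\<dots> \<le> ennreal (2 powr (- (real j * aniso_size a)))" using N[of j] by (simp add: \<rho>j d_def)
      finally show ?thesis .
    qed
    have "ennreal C2 * (\<integral>\<^sup>+x. ennreal (g x powr p) \<partial>lborel) \<le> ennreal C * T"
      by (intro mult_mono gT ennreal_leI) (auto simp: C_def)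
    then have "(\<Sum>j. ennreal (\<rho> powr - real j * \<beta> j powr p)) \<le> ennreal C * T + ennreal \<epsilon>"
      using S by (meson add_right_mono order_trans)
    then have S': "(\<Sum>j. ennreal (2 powr (- (real j * aniso_size a)) * \<beta> j powr p)) \<le> ennreal C * T + ennreal \<epsilon>"
      by (simp add: \<rho>j d_def)
    show "\<exists>\<beta>::nat \<Rightarrow> real. (\<forall>j. \<beta> j > 0) \<and>
      (\<forall>j<n. \<forall>x. 2 powr (real j * s) * norm (freq_block a \<psi> j f x) \<le> C * \<beta> j) \<and>
      (\<forall>j<n. (\<integral>\<^sup>+x. ennreal (level_fun (p / 2) m (2 powr (real j * s) * norm (freq_block a \<psi> j f x) / \<beta> j)) \<partial>lborel)
         \<le> ennreal (2 powr (- (real j * aniso_size a)))) \<and>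
      (\<Sum>j. ennreal (2 powr (- (real j * aniso_size a)) * \<beta> j powr p))
         \<le> ennreal C * ennreal_powr (triebel_norm a \<psi> s (ereal p) q f) p + ennreal \<epsilon>"
      using \<beta>' sup bint S' unfolding b_def r_def T_def by (intro exI[of _ \<beta>] conjI) auto
  qed
qed

text \<open>The ratio \<open>t\<close> of a block to its level is at most \<open>D\<close>, so
  \<open>t powr m \<le> D powr m * level_fun (p / 2) m t\<close>: the integral of the
  \<open>m\<close>-th power is reduced to that of \<open>level_fun\<close>, at most 2^(-j|a|). The
  exponent identity then leaves the factor 2^(-j|a|/p) in front of \<open>\<beta> j\<close>,
  matching the sum that controls the levels.\<close>

lemma triebel_besov_bound:
  fixes a :: "real^'n::finite" and \<psi> :: "real^'n \<Rightarrow> complex"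
  assumes a: "anisotropy a" and \<psi>: "cutoff a \<psi>" and p: "0 < p" "ereal p < p1" and q: "0 < (q::ereal)"
    and s: "ereal s - ereal (aniso_size a) / ereal p = ereal s1 - ereal (aniso_size a) / p1"
  shows "\<exists>C. \<forall>f\<in>tempered_distributions. triebel_norm a \<psi> s (ereal p) q f < \<infinity> \<longrightarrow>
    besov_norm a \<psi> s1 p1 (ereal p) f \<le> ennreal C * triebel_norm a \<psi> s (ereal p) q f"
proof -
  define d where "d = aniso_size a"
  have d: "d > 0" unfolding d_def by (rule aniso_size_pos[OF a])
  \<comment> \<open>For \<open>p1 = \<infinity>\<close> only the sup bound on the blocks enters, and
    any exponent above \<open>p\<close> serves for the levels; \<open>e\<close> below stands for the
    reciprocal of \<open>p1\<close>.\<close>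
  define m where "m = (if p1 = \<infinity> then p + 1 else real_of_ereal p1)"
  have m: "p < m" and pm: "p1 \<noteq> \<infinity> \<Longrightarrow> p1 = ereal m" using p by (cases p1; simp add: m_def)+
  have m0: "m > 0" using m p by simp
  define e where "e = (if p1 = \<infinity> then 0 else 1 / m)"
  have s1: "s1 = s - d / p + d * e"
    using s p m0 pm by (cases "p1 = \<infinity>") (auto simp: e_def d_def)
  obtain C where C: "C > 0" and key': "\<forall>f\<in>tempered_distributions. triebel_norm a \<psi> s (ereal p) q f < \<infinity> \<longrightarrow> (\<forall>n. \<forall>\<epsilon>>0. \<exists>\<beta>::nat \<Rightarrow> real.
    (\<forall>j. \<beta> j > 0) \<and>
    (\<forall>j<n. \<forall>x. 2 powr (real j * s) * norm (freq_block a \<psi> j f x) \<le> C * \<beta> j) \<and>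
    (\<forall>j<n. (\<integral>\<^sup>+x. ennreal (level_fun (p / 2) m (2 powr (real j * s) * norm (freq_block a \<psi> j f x) / \<beta> j)) \<partial>lborel)
       \<le> ennreal (2 powr (- (real j * aniso_size a)))) \<and>
    (\<Sum>j. ennreal (2 powr (- (real j * aniso_size a)) * \<beta> j powr p))
       \<le> ennreal C * ennreal_powr (triebel_norm a \<psi> s (ereal p) q f) p + ennreal \<epsilon>)"
    using maximal_level_bound[OF a \<psi> p(1) m q, of s] by (elim exE conjE)
  \<comment> \<open>The constant is raised to at least 1 so that \<open>D powr m \<ge> 1\<close>
    also covers ratios \<open>t \<le> 1\<close>.\<close>
  define D where "D = max 1 C"
  have D: "D \<ge> 1" "C \<le> D" by (auto simp: D_def)
  define K where "K = D powr p * C"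
  have K: "K > 0" using D C by (simp add: K_def)
  show ?thesis
  proof (intro exI[of _ "K powr (1 / p)"] ballI impI)
    fix f :: "'n distr"
    assume f: "f \<in> tempered_distributions" and fin: "triebel_norm a \<psi> s (ereal p) q f < \<infinity>"
    define T where "T = ennreal_powr (triebel_norm a \<psi> s (ereal p) q f) p"
    have [measurable]: "freq_block a \<psi> j f \<in> borel_measurable borel" for j
      by (intro borel_measurable_continuous_onI freq_block_continuous_growth[OF a \<psi> f])
    define c where "c j = ennreal (2 powr (real j * s1)) * Lp_norm p1 (\<lambda>x. ennreal (norm (freq_block a \<psi> j f x)))" for j
    have "(\<Sum>j. ennreal_powr (c j) p) \<le> ennreal K * T"
    proof (rule suminf_le_const[OF summableI], rule ennreal_le_epsilon)
      fix n and \<epsilon>' :: real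
      assume \<epsilon>': "\<epsilon>' > 0"
      \<comment> \<open>The levels depend on \<open>n\<close> and \<open>\<epsilon>\<close>, but the
        bound on the partial sum does not depend on \<open>n\<close>; the scaling anticipates the
        factor \<open>D powr p\<close>.\<close>
      define \<epsilon> where "\<epsilon> = \<epsilon>' / D powr p"
      have \<epsilon>: "\<epsilon> > 0" using \<epsilon>' D by (simp add: \<epsilon>_def)
      obtain \<beta> :: "nat \<Rightarrow> real" where \<beta>': "\<forall>j. \<beta> j > 0" and
        sup': "\<forall>j<n. \<forall>x. 2 powr (real j * s) * norm (freq_block a \<psi> j f x) \<le> C * \<beta> j" and
        int': "\<forall>j<n. (\<integral>\<^sup>+x. ennreal (level_fun (p / 2) m (2 powr (real j * s) * norm (freq_block a \<psi> j f x) / \<beta> j)) \<partial>lborel)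
          \<le> ennreal (2 powr (- (real j * aniso_size a)))" and
        S: "(\<Sum>j. ennreal (2 powr (- (real j * aniso_size a)) * \<beta> j powr p)) \<le> ennreal C * T + ennreal \<epsilon>"
        using key'[rule_format, OF f fin \<epsilon>, of n] unfolding T_def by (elim exE conjE)
      note \<beta> = \<beta>'[rule_format] and int = int'[rule_format]
      have sup: "norm (freq_block a \<psi> j f x) \<le> 2 powr (- (real j * s)) * (D * \<beta> j)" if "j < n" for j x
      proof -
        have "2 powr (real j * s) * norm (freq_block a \<psi> j f x) \<le> C * \<beta> j" using sup' that by simp
        also have "\<dots> \<le> D * \<beta> j" using D \<beta>[of j] by (intro mult_right_mono) auto
        finally have "2 powr (- (real j * s)) * (2 powr (real j * s) * norm (freq_block a \<psi> j f x)) \<le> 2 powr (- (real j * s)) * (D * \<beta> j)"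
          by (intro mult_left_mono) auto
        then show ?thesis by (simp flip: mult.assoc powr_add)
      qed
      have cj: "c j \<le> ennreal (D * (2 powr (- (real j * d / p)) * \<beta> j))" if j: "j < n" for j
      proof -
        have "Lp_norm p1 (\<lambda>x. ennreal (norm (freq_block a \<psi> j f x))) \<le> ennreal (2 powr (- (real j * s)) * (D * \<beta> j) * 2 powr (- (real j * d * e)))"
        proof (cases "p1 = \<infinity>")
          case True
          have "esssup lborel (\<lambda>x. ennreal (norm (freq_block a \<psi> j f x))) \<le> ennreal (2 powr (- (real j * s)) * (D * \<beta> j))"
            using sup[OF j] by (intro esssup_I AE_I2 ennreal_leI) auto
          then show ?thesis using True by (simp add: Lp_norm_def e_def)
        next
          case False
          have pt: "norm (freq_block a \<psi> j f x) powr m \<le> (2 powr (- (real j * s)) * (D * \<beta> j)) powr m *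
             level_fun (p / 2) m (2 powr (real j * s) * norm (freq_block a \<psi> j f x) / \<beta> j)" for x
          proof -
            define t where "t = 2 powr (real j * s) * norm (freq_block a \<psi> j f x) / \<beta> j"
            have t0: "t \<ge> 0" using \<beta>[of j] by (simp add: t_def)
            have nt: "norm (freq_block a \<psi> j f x) = 2 powr (- (real j * s)) * \<beta> j * t"
              using \<beta>[of j] by (simp add: t_def flip: mult.assoc powr_add)
            have "2 powr (- (real j * s)) * \<beta> j * t \<le> 2 powr (- (real j * s)) * \<beta> j * D"
              using sup[OF j, of x] unfolding nt by (simp only: mult_ac)
            then have tD: "t \<le> D" by (rule mult_left_le_imp_le) (simp add: \<beta>)
            have "t powr m \<le> D powr m * level_fun (p / 2) m t"
            proof (cases "t \<le> 1")
              case True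
              then have "t powr m \<le> t powr (p / 2)" using t0 m p by (intro powr_mono') auto
              then have "level_fun (p / 2) m t = t powr m" by (simp add: level_fun_def)
              moreover have "1 \<le> D powr m" using D m0 by (intro ge_one_powr_ge_zero) auto
              ultimately show ?thesis by (simp add: mult_le_cancel_right1)
            next
              case False
              then have "1 \<le> t powr (p / 2)" "1 \<le> t powr m" using p m0 by (auto intro: ge_one_powr_ge_zero)
              then have "1 \<le> level_fun (p / 2) m t" by (simp add: level_fun_def)
              then have "D powr m * 1 \<le> D powr m * level_fun (p / 2) m t" by (intro mult_left_mono) auto
              moreover have "t powr m \<le> D powr m" using t0 tD m0 by (intro powr_mono2) auto
              ultimately show ?thesis by simp
            qed
            then have "(2 powr (- (real j * s)) * \<beta> j) powr m * t powr m \<le> (2 powr (- (real j * s)) * \<beta> j) powr m * (D powr m * level_fun (p / 2) m t)"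
              by (intro mult_left_mono) auto
            then show ?thesis unfolding t_def[symmetric] unfolding nt powr_mult by (simp only: mult_ac)
          qed
          define B where "B = 2 powr (- (real j * s)) * (D * \<beta> j)"
          have B: "B > 0" using D \<beta>[of j] by (simp add: B_def)
          have "(\<integral>\<^sup>+x. ennreal_powr (ennreal (norm (freq_block a \<psi> j f x))) m \<partial>lborel) \<le>
            (\<integral>\<^sup>+x. ennreal (B powr m) * ennreal (level_fun (p / 2) m (2 powr (real j * s) * norm (freq_block a \<psi> j f x) / \<beta> j)) \<partial>lborel)"
            using pt unfolding B_def[symmetric]
            by (intro nn_integral_mono) (simp add: ennreal_powr_ennreal ennreal_leI flip: ennreal_mult)
          also have "\<dots> = ennreal (B powr m) * (\<integral>\<^sup>+x. ennreal (level_fun (p / 2) m (2 powr (real j * s) * norm (freq_block a \<psi> j f x) / \<beta> j)) \<partial>lborel)"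
            by (rule nn_integral_cmult) measurable
          also have "\<dots> \<le> ennreal (B powr m) * ennreal (2 powr (- (real j * aniso_size a)))"
            by (intro mult_left_mono int j) simp
          also have "\<dots> = ennreal (B powr m * 2 powr (- (real j * d)))" by (simp add: d_def ennreal_mult)
          finally have "ennreal_powr (\<integral>\<^sup>+x. ennreal_powr (ennreal (norm (freq_block a \<psi> j f x))) m \<partial>lborel) (1 / m)
            \<le> ennreal_powr (ennreal (B powr m * 2 powr (- (real j * d)))) (1 / m)" using m0 by (intro ennreal_powr_mono) auto
          also have "\<dots> = ennreal (B * 2 powr (- (real j * d * e)))"
            using B m0 False by (simp add: ennreal_powr_ennreal powr_mult powr_powr e_def)
          finally show ?thesis unfolding B_def pm[OF False] by (simp add: Lp_norm_def)
        qed
        then have "c j \<le> ennreal (2 powr (real j * s1)) * ennreal (2 powr (- (real j * s)) * (D * \<beta> j) * 2 powr (- (real j * d * e)))"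
          unfolding c_def by (intro mult_left_mono) auto
        also have "\<dots> = ennreal (2 powr (real j * s1) * (2 powr (- (real j * s)) * (D * \<beta> j) * 2 powr (- (real j * d * e))))"
          using D \<beta>[of j] by (intro ennreal_mult[symmetric]) auto
        also have "2 powr (real j * s1) * (2 powr (- (real j * s)) * (D * \<beta> j) * 2 powr (- (real j * d * e))) = D * (2 powr (- (real j * d / p)) * \<beta> j)"
        proof -
          have "real j * s1 + (- (real j * s)) + - (real j * d * e) = - (real j * d / p)" unfolding s1 by (simp add: algebra_simps)
          then have "2 powr (real j * s1) * 2 powr (- (real j * s)) * 2 powr (- (real j * d * e)) = 2 powr (- (real j * d / p))"
            by (simp only: powr_add[symmetric])
          then show ?thesis by (metis mult.assoc mult.commute)
        qed
        finally show ?thesis .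
      qed
      have "(\<Sum>j<n. ennreal_powr (c j) p) \<le> (\<Sum>j<n. ennreal (D powr p) * ennreal (2 powr (- (real j * aniso_size a)) * \<beta> j powr p))"
      proof (rule sum_mono)
        fix j assume "j \<in> {..<n}"
        then have "ennreal_powr (c j) p \<le> ennreal_powr (ennreal (D * (2 powr (- (real j * d / p)) * \<beta> j))) p"
          using p by (intro ennreal_powr_mono cj) auto
        also have "\<dots> = ennreal (D powr p * (2 powr (- (real j * aniso_size a)) * \<beta> j powr p))"
          using D \<beta>[of j] p by (simp add: ennreal_powr_ennreal powr_mult powr_powr d_def)
        also have "\<dots> = ennreal (D powr p) * ennreal (2 powr (- (real j * aniso_size a)) * \<beta> j powr p)"
          by (intro ennreal_mult) auto
        finally show "ennreal_powr (c j) p \<le> ennreal (D powr p) * ennreal (2 powr (- (real j * aniso_size a)) * \<beta> j powr p)" .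
      qed
      also have "\<dots> = ennreal (D powr p) * (\<Sum>j<n. ennreal (2 powr (- (real j * aniso_size a)) * \<beta> j powr p))"
        by (simp only: sum_distrib_left)
      also have "\<dots> \<le> ennreal (D powr p) * (\<Sum>j. ennreal (2 powr (- (real j * aniso_size a)) * \<beta> j powr p))"
        by (intro mult_left_mono sum_le_suminf summableI) auto
      also have "\<dots> \<le> ennreal (D powr p) * (ennreal C * T + ennreal \<epsilon>)" by (intro mult_left_mono S) simp
      also have "\<dots> = ennreal K * T + ennreal \<epsilon>'"
        using C D \<epsilon>' by (simp add: K_def \<epsilon>_def distrib_left ennreal_mult flip: mult.assoc)
          (simp flip: ennreal_mult)
      finally show "(\<Sum>j<n. ennreal_powr (c j) p) \<le> ennreal K * T + ennreal \<epsilon>'" .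
    qed
    then have "ennreal_powr (\<Sum>j. ennreal_powr (c j) p) (1 / p) \<le> ennreal_powr (ennreal K * T) (1 / p)"
      using p by (intro ennreal_powr_mono) auto
    also have "\<dots> = ennreal (K powr (1 / p)) * triebel_norm a \<psi> s (ereal p) q f"
      using p K by (simp add: ennreal_powr_mult ennreal_powr_ennreal T_def ennreal_powr_cancel)
    finally show "besov_norm a \<psi> s1 p1 (ereal p) f \<le> ennreal (K powr (1 / p)) * triebel_norm a \<psi> s (ereal p) q f"
      by (simp add: besov_norm_def lq_norm_def c_def)
  qed
qed

section \<open>The embedding of Besov into Lizorkin--Triebel spaces\<close>

lemma add_power_le:
  fixes a x :: real assumes "a \<ge> 0" "x \<ge> 0"
  shows "(a + x) ^ Suc R \<le> a ^ Suc R + real (Suc R) * (x * (a + x) ^ R)"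
proof (induction R)
  case (Suc R)
  have "(a + x) ^ Suc (Suc R) = a * (a + x) ^ Suc R + x * (a + x) ^ Suc R" by (simp add: algebra_simps)
  also have "a * (a + x) ^ Suc R \<le> a * (a ^ Suc R + real (Suc R) * (x * (a + x) ^ R))"
    using assms by (intro mult_left_mono Suc.IH)
  also have "\<dots> = a ^ Suc (Suc R) + real (Suc R) * (x * (a * (a + x) ^ R))" by (simp add: algebra_simps)
  also have "a * (a + x) ^ R \<le> (a + x) * (a + x) ^ R" using assms by (intro mult_right_mono) auto
  then have "a ^ Suc (Suc R) + real (Suc R) * (x * (a * (a + x) ^ R)) \<le> a ^ Suc (Suc R) + real (Suc R) * (x * (a + x) ^ Suc R)"
    using assms by (intro add_left_mono mult_left_mono) auto
  finally show ?case by (simp add: algebra_simps)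
qed simp

text \<open>Telescoping in the partial sums: each increment of the power \<open>Suc R\<close> is at
  most \<open>Suc R\<close> times the new term times the \<open>R\<close>-th power of the new
  partial sum. The term of largest index is thereby singled out without a multinomial
  expansion.\<close>

lemma sum_power_le:
  fixes x :: "nat \<Rightarrow> real" assumes "\<And>i. x i \<ge> 0"
  shows "(\<Sum>i<n. x i) ^ Suc R \<le> real (Suc R) * (\<Sum>j<n. x j * (\<Sum>i\<le>j. x i) ^ R)"
proof (induction n)
  case (Suc n)
  have "(\<Sum>i<Suc n. x i) ^ Suc R \<le> (\<Sum>i<n. x i) ^ Suc R + real (Suc R) * (x n * ((\<Sum>i<n. x i) + x n) ^ R)"
    using add_power_le[of "\<Sum>i<n. x i" "x n" R] assms by (simp add: sum_nonneg)
  also have "(\<Sum>i<n. x i) + x n = (\<Sum>i\<le>n. x i)" by (simp add: lessThan_Suc_atMost[symmetric])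
  finally show ?case using Suc.IH by (simp add: distrib_left)
qed simp

text \<open>Every term is at most \<open>\<sigma> ^ (j - k)\<close> times the largest weighted term
  \<open>M\<close>, so the sum is at most a geometric series times \<open>M\<close>, and the power
  of \<open>M\<close> is one summand of the right-hand side. Mixed products never appear; the price
  is weights growing with \<open>j - k\<close>, as slowly as desired for \<open>\<sigma>\<close>
  near 1.\<close>

lemma sum_power_geometric_le:
  fixes y :: "nat \<Rightarrow> real" assumes y: "\<And>i. y i \<ge> 0" and \<sigma>: "0 < \<sigma>" "\<sigma> < 1"
  shows "(\<Sum>k\<le>j. y k) ^ R \<le> (1 / (1 - \<sigma>)) ^ R * (\<Sum>k\<le>j. (1 / \<sigma> ^ (j - k)) ^ R * y k ^ R)"
proof -
  define M where "M = Max ((\<lambda>k. (1 / \<sigma> ^ (j - k)) * y k) ` {..j})"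
  have "M \<in> (\<lambda>k. (1 / \<sigma> ^ (j - k)) * y k) ` {..j}" unfolding M_def by (intro Max_in) auto
  then obtain k0 where k0: "k0 \<le> j" "M = (1 / \<sigma> ^ (j - k0)) * y k0" by auto
  have M0: "M \<ge> 0" using k0 y \<sigma> by simp
  have le: "y k \<le> \<sigma> ^ (j - k) * M" if "k \<le> j" for k
  proof -
    have "(1 / \<sigma> ^ (j - k)) * y k \<le> M" unfolding M_def using that by (intro Max_ge) auto
    then show ?thesis using \<sigma> by (simp add: field_simps)
  qed
  have "(\<Sum>k\<le>j. y k) \<le> (\<Sum>k\<le>j. \<sigma> ^ (j - k) * M)" by (intro sum_mono le) auto
  also have "\<dots> = (\<Sum>k<Suc j. \<sigma> ^ (Suc j - Suc k)) * M" by (simp add: sum_distrib_right lessThan_Suc_atMost)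
  also have "(\<Sum>k<Suc j. \<sigma> ^ (Suc j - Suc k)) = (\<Sum>k<Suc j. \<sigma> ^ k)" by (rule sum.nat_diff_reindex)
  also have "(\<Sum>k<Suc j. \<sigma> ^ k) * M \<le> 1 / (1 - \<sigma>) * M"
  proof (intro mult_right_mono M0)
    have "(\<Sum>k<Suc j. \<sigma> ^ k) \<le> (\<Sum>k. \<sigma> ^ k)" using \<sigma> by (intro sum_le_suminf summable_geometric) auto
    also have "\<dots> = 1 / (1 - \<sigma>)" using \<sigma> by (intro suminf_geometric) auto
    finally show "(\<Sum>k<Suc j. \<sigma> ^ k) \<le> 1 / (1 - \<sigma>)" .
  qed
  finally have "(\<Sum>k\<le>j. y k) ^ R \<le> (1 / (1 - \<sigma>) * M) ^ R" using y by (intro power_mono sum_nonneg) auto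
  also have "\<dots> = (1 / (1 - \<sigma>)) ^ R * ((1 / \<sigma> ^ (j - k0)) ^ R * y k0 ^ R)" unfolding k0(2) by (simp only: power_mult_distrib)
  also have "(1 / \<sigma> ^ (j - k0)) ^ R * y k0 ^ R \<le> (\<Sum>k\<le>j. (1 / \<sigma> ^ (j - k)) ^ R * y k ^ R)"
    using y \<sigma> k0(1) by (intro member_le_sum[of k0 "{..j}" "\<lambda>k. (1 / \<sigma> ^ (j - k)) ^ R * y k ^ R"]) auto
  then have "(1 / (1 - \<sigma>)) ^ R * ((1 / \<sigma> ^ (j - k0)) ^ R * y k0 ^ R) \<le> (1 / (1 - \<sigma>)) ^ R * (\<Sum>k\<le>j. (1 / \<sigma> ^ (j - k)) ^ R * y k ^ R)"
    using \<sigma> by (intro mult_left_mono) auto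
  finally show ?thesis .
qed

lemma sum_geometric_convolution_le:
  fixes w :: "nat \<Rightarrow> real" assumes w: "\<And>i. w i \<ge> 0" and \<theta>: "0 < \<theta>" "\<theta> < 1"
  shows "(\<Sum>j<n. \<Sum>k\<le>j. \<theta> ^ (j - k) * (w j + w k)) \<le> 2 / (1 - \<theta>) * (\<Sum>j<n. w j)"
proof -
  have geo: "(\<Sum>k<m. \<theta> ^ k) \<le> 1 / (1 - \<theta>)" for m
  proof -
    have "(\<Sum>k<m. \<theta> ^ k) \<le> (\<Sum>k. \<theta> ^ k)" using \<theta> by (intro sum_le_suminf summable_geometric) auto
    also have "\<dots> = 1 / (1 - \<theta>)" using \<theta> by (intro suminf_geometric) auto
    finally show ?thesis .
  qed
  have 1: "(\<Sum>j<n. \<Sum>k\<le>j. \<theta> ^ (j - k) * w j) \<le> (\<Sum>j<n. 1 / (1 - \<theta>) * w j)"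
  proof (rule sum_mono)
    fix j
    have "(\<Sum>k\<le>j. \<theta> ^ (j - k) * w j) = (\<Sum>k<Suc j. \<theta> ^ (Suc j - Suc k)) * w j"
      by (simp add: sum_distrib_right lessThan_Suc_atMost)
    also have "(\<Sum>k<Suc j. \<theta> ^ (Suc j - Suc k)) = (\<Sum>k<Suc j. \<theta> ^ k)" by (rule sum.nat_diff_reindex)
    also have "(\<Sum>k<Suc j. \<theta> ^ k) * w j \<le> 1 / (1 - \<theta>) * w j" by (intro mult_right_mono geo w)
    finally show "(\<Sum>k\<le>j. \<theta> ^ (j - k) * w j) \<le> 1 / (1 - \<theta>) * w j" .
  qed
  have "(\<Sum>j<n. \<Sum>k\<le>j. \<theta> ^ (j - k) * w k) = (\<Sum>j<n. \<Sum>k<n. if k \<le> j then \<theta> ^ (j - k) * w k else 0)"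
  proof (rule sum.cong[OF refl])
    fix j assume "j \<in> {..<n}"
    then have "{..<n} \<inter> {k. k \<le> j} = {..j}" by auto
    then show "(\<Sum>k\<le>j. \<theta> ^ (j - k) * w k) = (\<Sum>k<n. if k \<le> j then \<theta> ^ (j - k) * w k else 0)"
      by (simp add: sum.inter_restrict[symmetric] sum.If_cases)
  qed
  also have "\<dots> = (\<Sum>k<n. \<Sum>j<n. if k \<le> j then \<theta> ^ (j - k) * w k else 0)" by (rule sum.swap)
  also have "\<dots> \<le> (\<Sum>k<n. 1 / (1 - \<theta>) * w k)"
  proof (rule sum_mono)
    fix k assume "k \<in> {..<n}"
    have "{..<n} \<inter> {j. k \<le> j} = {k..<n}" by auto
    then have "(\<Sum>j<n. if k \<le> j then \<theta> ^ (j - k) * w k else 0) = (\<Sum>j\<in>{k..<n}. \<theta> ^ (j - k) * w k)"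
      by (simp add: sum.If_cases)
    also have "\<dots> = (\<Sum>i<n - k. \<theta> ^ i) * w k"
      by (subst sum.atLeastLessThan_shift_0) (simp add: o_def sum_distrib_right atLeast0LessThan)
    also have "\<dots> \<le> 1 / (1 - \<theta>) * w k" by (intro mult_right_mono geo w)
    finally show "(\<Sum>j<n. if k \<le> j then \<theta> ^ (j - k) * w k else 0) \<le> 1 / (1 - \<theta>) * w k" .
  qed
  finally have 2: "(\<Sum>j<n. \<Sum>k\<le>j. \<theta> ^ (j - k) * w k) \<le> (\<Sum>k<n. 1 / (1 - \<theta>) * w k)" .
  have "(\<Sum>j<n. \<Sum>k\<le>j. \<theta> ^ (j - k) * (w j + w k)) = (\<Sum>j<n. \<Sum>k\<le>j. \<theta> ^ (j - k) * w j) + (\<Sum>j<n. \<Sum>k\<le>j. \<theta> ^ (j - k) * w k)"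
    by (simp add: distrib_left sum.distrib)
  also have "\<dots> \<le> (\<Sum>j<n. 1 / (1 - \<theta>) * w j) + (\<Sum>k<n. 1 / (1 - \<theta>) * w k)" using 1 2 by (rule add_mono)
  also have "\<dots> = 2 / (1 - \<theta>) * (\<Sum>j<n. w j)" by (simp add: sum_divide_distrib[symmetric])
  finally show ?thesis .
qed

text \<open>Split according to whether \<open>u\<close> exceeds a level \<open>l\<close>. Above it,
  \<open>u powr e\<close> is traded for \<open>u powr p0\<close>, as \<open>e \<le> p0\<close>, and
  \<open>v\<close> enters through its sup bound; below it, \<open>u\<close> is replaced by
  \<open>l\<close> and part of the power of \<open>v\<close> by its sup bound, leaving
  \<open>v powr p0\<close>, as \<open>e \<le> p - p0\<close>. For \<open>k \<le> j\<close> the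
  outcome decays in \<open>j - k\<close>, because \<open>p0 < p\<close>.\<close>

lemma pair_integral_le:
  fixes M :: "'a measure" and u v :: "'a \<Rightarrow> real"
  assumes um [measurable]: "u \<in> borel_measurable M" and vm [measurable]: "v \<in> borel_measurable M"
    and u0: "\<And>x. u x \<ge> 0" and v0: "\<And>x. v x \<ge> 0" and A: "A \<ge> 0" and B: "B \<ge> 0" and D: "D \<ge> 1" and \<rho>: "\<rho> > (1::real)"
    and e: "0 < e" "e \<le> p0" "e \<le> p - p0" and p0: "0 < p0" "p0 < p"
    and ub: "\<And>x. u x \<le> D * (\<rho> powr (j / p) * A)" and vb: "\<And>x. v x \<le> D * (\<rho> powr (k / p) * B)"
    and ui: "(\<integral>\<^sup>+x. ennreal (u x powr p0) \<partial>M) \<le> ennreal (\<rho> powr (- (j * (1 - p0 / p))) * A powr p0)"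
    and vi: "(\<integral>\<^sup>+x. ennreal (v x powr p0) \<partial>M) \<le> ennreal (\<rho> powr (- (k * (1 - p0 / p))) * B powr p0)"
  shows "(\<integral>\<^sup>+x. ennreal (u x powr e * v x powr (p - e)) \<partial>M)
    \<le> ennreal (2 * D powr p * (\<rho> powr (- ((j - k) * (e * (1 / p0 - 1 / p)))) * (A powr e * B powr (p - e))))"
\<comment> \<open>The levels \<open>l\<close> and \<open>V\<close> are multiples of \<open>A\<close>
  and \<open>B\<close> and have to be positive, so vanishing constants are set aside; there the
  product is 0 by the sup bounds.\<close>
proof (cases "A = 0 \<or> B = 0")
  case True
  have "u x powr e * v x powr (p - e) = 0" for x
    using True
  proof
    assume "A = 0" then have "u x = 0" using ub[of x] u0[of x] by simp
    then show ?thesis by simp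
  next
    assume "B = 0" then have "v x = 0" using vb[of x] v0[of x] by simp
    then show ?thesis by simp
  qed
  then have "(\<integral>\<^sup>+x. ennreal (u x powr e * v x powr (p - e)) \<partial>M) = (\<integral>\<^sup>+x. 0 \<partial>M)" by (simp only: ennreal_0)
  then show ?thesis by simp
next
  case False
  then have AB: "A > 0" "B > 0" using A B by auto
  \<comment> \<open>This exponent balances the two parts: it solves the linear equation that makes
    both exponents of \<open>\<rho>\<close>, computed in \<open>e1\<close> and \<open>e2\<close>,
    coincide.\<close>
  define y where "y = k / p0 - j * (1 / p0 - 1 / p)"
  define l where "l = \<rho> powr y * A"
  have l: "l > 0" using AB \<rho> by (simp add: l_def)
  define V where "V = \<rho> powr (k / p) * B"
  have V: "V > 0" using AB \<rho> by (simp add: V_def)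
  define E where "E = \<rho> powr (- ((j - k) * (e * (1 / p0 - 1 / p)))) * (A powr e * B powr (p - e))"
  have E0: "E \<ge> 0" by (simp add: E_def)
  have pt: "u x powr e * v x powr (p - e) \<le> (l powr (e - p0) * (D * V) powr (p - e)) * u x powr p0
     + (l powr e * (D * V) powr (p - e - p0)) * v x powr p0" for x
  proof -
    have u: "u x powr e \<le> l powr (e - p0) * u x powr p0 + l powr e"
    proof (cases "u x \<le> l")
      case True
      then have "u x powr e \<le> l powr e" using u0 e by (intro powr_mono2) auto
      then show ?thesis by (simp add: add_increasing)
    next
      case False
      then have "u x > 0" using l by simp
      have "u x powr e = u x powr (e - p0) * u x powr p0" using \<open>u x > 0\<close> by (simp flip: powr_add)
      also have "\<dots> \<le> l powr (e - p0) * u x powr p0"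
        using False l e by (intro mult_right_mono powr_mono2') auto
      finally show ?thesis by (simp add: add_increasing2)
    qed
    have vV: "v x \<le> D * V" using vb[of x] by (simp add: V_def)
    have v1: "v x powr (p - e) \<le> (D * V) powr (p - e)" using v0 vV e p0 by (intro powr_mono2) auto
    have v2: "v x powr (p - e) \<le> (D * V) powr (p - e - p0) * v x powr p0"
    proof (cases "v x = 0")
      case False
      then have "v x > 0" using v0[of x] by simp
      then have "v x powr (p - e) = v x powr (p - e - p0) * v x powr p0" by (simp flip: powr_add)
      also have "\<dots> \<le> (D * V) powr (p - e - p0) * v x powr p0"
        using v0 vV e by (intro mult_right_mono powr_mono2) auto
      finally show ?thesis .
    qed simp
    have "u x powr e * v x powr (p - e) \<le> (l powr (e - p0) * u x powr p0 + l powr e) * v x powr (p - e)"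
      by (intro mult_right_mono u) simp
    also have "\<dots> = (l powr (e - p0) * u x powr p0) * v x powr (p - e) + l powr e * v x powr (p - e)" by (simp add: distrib_right)
    also have "\<dots> \<le> (l powr (e - p0) * u x powr p0) * (D * V) powr (p - e) + l powr e * ((D * V) powr (p - e - p0) * v x powr p0)"
      by (intro add_mono mult_left_mono v1 v2) auto
    finally show ?thesis by (simp only: mult_ac)
  qed
  have e1: "y * (e - p0) + k / p * (p - e) + - (j * (1 - p0 / p)) = - ((j - k) * (e * (1 / p0 - 1 / p)))"
    unfolding y_def using p0 by (simp add: field_simps)
  have e2: "y * e + k / p * (p - e - p0) + - (k * (1 - p0 / p)) = - ((j - k) * (e * (1 / p0 - 1 / p)))"
    unfolding y_def using p0 by (simp add: field_simps)
  have Dp: "D powr z \<le> D powr p" if "z \<le> p" for z using D that by (intro powr_mono) auto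
  have 1: "(l powr (e - p0) * (D * V) powr (p - e)) * (\<rho> powr (- (j * (1 - p0 / p))) * A powr p0) \<le> D powr p * E"
  proof -
    have "(l powr (e - p0) * (D * V) powr (p - e)) * (\<rho> powr (- (j * (1 - p0 / p))) * A powr p0) =
       D powr (p - e) * ((\<rho> powr (y * (e - p0)) * \<rho> powr (k / p * (p - e)) * \<rho> powr (- (j * (1 - p0 / p)))) * ((A powr (e - p0) * A powr p0) * B powr (p - e)))"
      unfolding l_def V_def powr_mult powr_powr by (simp only: mult_ac)
    also have "\<dots> = D powr (p - e) * E"
      unfolding powr_add[symmetric] e1 E_def by simp
    also have "\<dots> \<le> D powr p * E" using e by (intro mult_right_mono Dp E0) auto
    finally show ?thesis .
  qed
  have 2: "(l powr e * (D * V) powr (p - e - p0)) * (\<rho> powr (- (k * (1 - p0 / p))) * B powr p0) \<le> D powr p * E"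
  proof -
    have "(l powr e * (D * V) powr (p - e - p0)) * (\<rho> powr (- (k * (1 - p0 / p))) * B powr p0) =
       D powr (p - e - p0) * ((\<rho> powr (y * e) * \<rho> powr (k / p * (p - e - p0)) * \<rho> powr (- (k * (1 - p0 / p)))) * (A powr e * (B powr (p - e - p0) * B powr p0)))"
      unfolding l_def V_def powr_mult powr_powr by (simp only: mult_ac)
    also have "\<dots> = D powr (p - e - p0) * E"
      unfolding powr_add[symmetric] e2 E_def by simp
    also have "\<dots> \<le> D powr p * E" using e p0 by (intro mult_right_mono Dp E0) auto
    finally show ?thesis .
  qed
  define a1 where "a1 = l powr (e - p0) * (D * V) powr (p - e)"
  define a2 where "a2 = l powr e * (D * V) powr (p - e - p0)"
  have a0: "a1 \<ge> 0" "a2 \<ge> 0" by (auto simp: a1_def a2_def)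
  have "(\<integral>\<^sup>+x. ennreal (u x powr e * v x powr (p - e)) \<partial>M) \<le>
    (\<integral>\<^sup>+x. ennreal a1 * ennreal (u x powr p0) + ennreal a2 * ennreal (v x powr p0) \<partial>M)"
  proof (rule nn_integral_mono)
    fix x
    have "ennreal (u x powr e * v x powr (p - e)) \<le> ennreal (a1 * u x powr p0 + a2 * v x powr p0)"
      unfolding a1_def a2_def by (intro ennreal_leI pt)
    also have "\<dots> = ennreal a1 * ennreal (u x powr p0) + ennreal a2 * ennreal (v x powr p0)"
      using a0 by (simp add: ennreal_plus ennreal_mult)
    finally show "ennreal (u x powr e * v x powr (p - e)) \<le> ennreal a1 * ennreal (u x powr p0) + ennreal a2 * ennreal (v x powr p0)" .
  qed
  also have "\<dots> = ennreal a1 * (\<integral>\<^sup>+x. ennreal (u x powr p0) \<partial>M) + ennreal a2 * (\<integral>\<^sup>+x. ennreal (v x powr p0) \<partial>M)"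
    by (simp add: nn_integral_add nn_integral_cmult)
  also have "\<dots> \<le> ennreal a1 * ennreal (\<rho> powr (- (j * (1 - p0 / p))) * A powr p0) + ennreal a2 * ennreal (\<rho> powr (- (k * (1 - p0 / p))) * B powr p0)"
    by (intro add_mono mult_left_mono ui vi) auto
  also have "\<dots> = ennreal (a1 * (\<rho> powr (- (j * (1 - p0 / p))) * A powr p0) + a2 * (\<rho> powr (- (k * (1 - p0 / p))) * B powr p0))"
    using a0 by (simp add: ennreal_plus ennreal_mult)
  also have "\<dots> \<le> ennreal (D powr p * E + D powr p * E)"
    using 1 2 unfolding a1_def a2_def by (intro ennreal_leI add_mono)
  also have "D powr p * E + D powr p * E = 2 * D powr p * E" by simp
  finally show ?thesis unfolding E_def .
qed

text \<open>Since \<open>e * (R + 1) = p\<close>, the expanded power has total degree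
  \<open>p\<close>: degree \<open>e\<close> at the largest index \<open>j\<close> and degree
  \<open>p - e\<close> at an index \<open>k \<le> j\<close>. The integral of each product decays
  like \<open>\<theta> ^ (2 * (j - k))\<close>, the expansion costs
  \<open>1 / \<theta> ^ (j - k)\<close>, and a summable factor \<open>\<theta> ^ (j - k)\<close>
  survives.\<close>

lemma power_sum_integral_le:
  fixes M :: "'a measure"
  assumes D: "D \<ge> 1" and \<rho>: "\<rho> > (1::real)" and p0: "0 < p0" "p0 < p" and R: "R \<ge> 1"
    and e: "e = p / real (Suc R)" "e \<le> p0" "e \<le> p - p0"
  shows "\<exists>C>0. \<forall>b \<alpha> n. (\<forall>j. b j \<in> borel_measurable M) \<longrightarrow> (\<forall>j x. b j x \<ge> (0::real)) \<longrightarrow> (\<forall>j. \<alpha> j \<ge> 0) \<longrightarrow>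
    (\<forall>j x. b j x \<le> D * (\<rho> powr (real j / p) * \<alpha> j)) \<longrightarrow>
    (\<forall>j. (\<integral>\<^sup>+x. ennreal (b j x powr p0) \<partial>M) \<le> ennreal (\<rho> powr (- (real j * (1 - p0 / p))) * \<alpha> j powr p0)) \<longrightarrow>
    (\<integral>\<^sup>+x. ennreal ((\<Sum>j<n. b j x powr e) ^ Suc R) \<partial>M) \<le> ennreal (C * (\<Sum>j<n. \<alpha> j powr p))"
proof -
  define \<delta> where "\<delta> = e * (1 / p0 - 1 / p)"
  have e0: "0 < e" using e p0 by simp
  have R0: "real R > 0" using R by simp
  have eR: "e * real R = p - e" using e(1) by (simp add: field_simps)
  have \<delta>: "\<delta> > 0" unfolding \<delta>_def using e0 p0 by (intro mult_pos_pos) (auto simp: field_simps)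
  \<comment> \<open>Chosen so that \<open>\<sigma> ^ R = \<theta>\<close>, the square root of the
    decay rate: half of the decay pays for the expansion.\<close>
  define \<sigma> where "\<sigma> = \<rho> powr (- (\<delta> / 2 / real R))"
  have \<sigma>: "0 < \<sigma>" "\<sigma> < 1" unfolding \<sigma>_def using \<rho> \<delta> R0 by (auto intro!: powr_less_one)
  define \<theta> where "\<theta> = \<rho> powr (- (\<delta> / 2))"
  have \<theta>: "0 < \<theta>" "\<theta> < 1" unfolding \<theta>_def using \<rho> \<delta> by (auto intro!: powr_less_one)
  have \<sigma>\<theta>: "\<sigma> ^ R = \<theta>" unfolding \<sigma>_def \<theta>_def using \<rho> R0 by (simp add: powr_powr flip: powr_realpow)
  define Q where "Q = real (Suc R) * (1 / (1 - \<sigma>)) ^ R"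
  have Q: "Q > 0" unfolding Q_def using \<sigma> by (intro mult_pos_pos zero_less_power) auto
  define C where "C = Q * (2 * D powr p) * (2 / (1 - \<theta>))"
  have C: "C > 0" unfolding C_def using Q D \<theta> by simp
  show ?thesis
  proof (intro exI[of _ C] conjI allI impI C)
    fix b :: "nat \<Rightarrow> 'a \<Rightarrow> real" and \<alpha> :: "nat \<Rightarrow> real" and n
    assume bm': "\<forall>j. b j \<in> borel_measurable M" and b0': "\<forall>j x. b j x \<ge> 0" and \<alpha>0': "\<forall>j. \<alpha> j \<ge> 0"
      and bb: "\<forall>j x. b j x \<le> D * (\<rho> powr (real j / p) * \<alpha> j)"
      and bi: "\<forall>j. (\<integral>\<^sup>+x. ennreal (b j x powr p0) \<partial>M) \<le> ennreal (\<rho> powr (- (real j * (1 - p0 / p))) * \<alpha> j powr p0)"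
    note bm [measurable] = bm'[rule_format] and b0 = b0'[rule_format] and \<alpha>0 = \<alpha>0'[rule_format]
    have pt: "(\<Sum>j<n. b j x powr e) ^ Suc R \<le> Q * (\<Sum>j<n. \<Sum>k\<le>j. (1 / \<theta> ^ (j - k)) * (b j x powr e * b k x powr (p - e)))" for x
    proof -
      have "(\<Sum>j<n. b j x powr e) ^ Suc R \<le> real (Suc R) * (\<Sum>j<n. b j x powr e * (\<Sum>i\<le>j. b i x powr e) ^ R)"
        by (rule sum_power_le) simp
      also have "\<dots> \<le> real (Suc R) * (\<Sum>j<n. b j x powr e * ((1 / (1 - \<sigma>)) ^ R * (\<Sum>k\<le>j. (1 / \<sigma> ^ (j - k)) ^ R * (b k x powr e) ^ R)))"
        by (intro mult_left_mono sum_mono sum_power_geometric_le \<sigma>) auto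
      also have "\<dots> = Q * (\<Sum>j<n. \<Sum>k\<le>j. (1 / \<sigma> ^ (j - k)) ^ R * (b j x powr e * (b k x powr e) ^ R))"
        by (simp add: Q_def sum_distrib_left mult_ac)
      also have "(\<lambda>k. (b k x powr e) ^ R) = (\<lambda>k. b k x powr (p - e))"
      proof
        fix k
        show "(b k x powr e) ^ R = b k x powr (p - e)"
        proof (cases "b k x = 0")
          case True
          then show ?thesis using R by simp
        next
          case False
          then have "b k x powr e > 0" by simp
          then have "(b k x powr e) ^ R = (b k x powr e) powr real R" by (rule powr_realpow[symmetric])
          then show ?thesis by (simp add: powr_powr eR)
        qed
      qed
      also have "(\<lambda>i. (1 / \<sigma> ^ i) ^ R) = (\<lambda>i. 1 / \<theta> ^ i)"
        unfolding \<sigma>\<theta>[symmetric] by (rule ext) (simp add: power_one_over power_mult[symmetric] mult.commute)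
      finally show ?thesis .
    qed
    have "(\<integral>\<^sup>+x. ennreal ((\<Sum>j<n. b j x powr e) ^ Suc R) \<partial>M) \<le>
      (\<integral>\<^sup>+x. ennreal Q * (\<Sum>j<n. \<Sum>k\<le>j. ennreal (1 / \<theta> ^ (j - k)) * ennreal (b j x powr e * b k x powr (p - e))) \<partial>M)"
    proof (rule nn_integral_mono)
      fix x
      have "(\<Sum>j<n. \<Sum>k\<le>j. ennreal (1 / \<theta> ^ (j - k)) * ennreal (b j x powr e * b k x powr (p - e))) =
        (\<Sum>j<n. \<Sum>k\<le>j. ennreal ((1 / \<theta> ^ (j - k)) * (b j x powr e * b k x powr (p - e))))"
        using \<theta> by (intro sum.cong refl ennreal_mult[symmetric]) auto
      also have "\<dots> = ennreal (\<Sum>j<n. \<Sum>k\<le>j. (1 / \<theta> ^ (j - k)) * (b j x powr e * b k x powr (p - e)))"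
        using \<theta> by (subst sum_ennreal, simp)+ (auto intro: sum_nonneg)
      finally have "ennreal Q * (\<Sum>j<n. \<Sum>k\<le>j. ennreal (1 / \<theta> ^ (j - k)) * ennreal (b j x powr e * b k x powr (p - e))) =
        ennreal (Q * (\<Sum>j<n. \<Sum>k\<le>j. (1 / \<theta> ^ (j - k)) * (b j x powr e * b k x powr (p - e))))"
        using Q \<theta> by (simp add: ennreal_mult sum_nonneg)
      then show "ennreal ((\<Sum>j<n. b j x powr e) ^ Suc R) \<le> ennreal Q * (\<Sum>j<n. \<Sum>k\<le>j. ennreal (1 / \<theta> ^ (j - k)) * ennreal (b j x powr e * b k x powr (p - e)))"
        using pt[of x] by (simp add: ennreal_leI del: power_Suc)
    qed
    also have "\<dots> = ennreal Q * (\<Sum>j<n. \<Sum>k\<le>j. ennreal (1 / \<theta> ^ (j - k)) * (\<integral>\<^sup>+x. ennreal (b j x powr e * b k x powr (p - e)) \<partial>M))"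
      by (simp add: nn_integral_cmult nn_integral_sum)
    also have "\<dots> \<le> ennreal Q * (\<Sum>j<n. \<Sum>k\<le>j. ennreal (1 / \<theta> ^ (j - k)) * ennreal (2 * D powr p * (\<rho> powr (- ((real j - real k) * \<delta>)) * (\<alpha> j powr e * \<alpha> k powr (p - e)))))"
      unfolding \<delta>_def
      by (intro mult_left_mono sum_mono pair_integral_le bm b0 \<alpha>0 D \<rho> e0 e p0 bb[rule_format] bi[rule_format]) auto
    also have "\<dots> \<le> ennreal Q * (\<Sum>j<n. \<Sum>k\<le>j. ennreal (2 * D powr p * (\<theta> ^ (j - k) * (\<alpha> j powr p + \<alpha> k powr p))))"
    proof (intro mult_left_mono sum_mono)
      fix j k :: nat assume "k \<in> {..j}"
      then have jk: "real j - real k = real (j - k)" by (simp add: of_nat_diff)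
      have "\<rho> powr (- (real (j - k) * \<delta>)) = \<theta> ^ (j - k) * \<theta> ^ (j - k)"
        unfolding \<theta>_def using \<rho> by (simp add: powr_realpow[symmetric] powr_powr powr_add[symmetric] field_simps)
      then have r: "1 / \<theta> ^ (j - k) * \<rho> powr (- ((real j - real k) * \<delta>)) = \<theta> ^ (j - k)"
        unfolding jk using \<theta> by simp
      have young: "\<alpha> j powr e * \<alpha> k powr (p - e) \<le> \<alpha> j powr p + \<alpha> k powr p"
      proof -
        define m where "m = max (\<alpha> j) (\<alpha> k)"
        have "\<alpha> j powr e * \<alpha> k powr (p - e) \<le> m powr e * m powr (p - e)"
          using \<alpha>0 e0 e p0 by (intro mult_mono powr_mono2) (auto simp: m_def)
        also have "\<dots> = m powr p" by (simp flip: powr_add)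
        also have "\<dots> \<le> \<alpha> j powr p + \<alpha> k powr p" by (simp add: m_def max_def)
        finally show ?thesis .
      qed
      have "ennreal (1 / \<theta> ^ (j - k)) * ennreal (2 * D powr p * (\<rho> powr (- ((real j - real k) * \<delta>)) * (\<alpha> j powr e * \<alpha> k powr (p - e))))
        = ennreal ((1 / \<theta> ^ (j - k)) * (2 * D powr p * (\<rho> powr (- ((real j - real k) * \<delta>)) * (\<alpha> j powr e * \<alpha> k powr (p - e)))))"
        using \<theta> by (intro ennreal_mult[symmetric]) auto
      also have "(1 / \<theta> ^ (j - k)) * (2 * D powr p * (\<rho> powr (- ((real j - real k) * \<delta>)) * (\<alpha> j powr e * \<alpha> k powr (p - e))))
        = 2 * D powr p * ((1 / \<theta> ^ (j - k) * \<rho> powr (- ((real j - real k) * \<delta>))) * (\<alpha> j powr e * \<alpha> k powr (p - e)))"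
        by (simp only: mult_ac)
      also have "\<dots> \<le> 2 * D powr p * (\<theta> ^ (j - k) * (\<alpha> j powr p + \<alpha> k powr p))"
        unfolding r using \<theta> by (intro mult_left_mono young) auto
      finally show "ennreal (1 / \<theta> ^ (j - k)) * ennreal (2 * D powr p * (\<rho> powr (- ((real j - real k) * \<delta>)) * (\<alpha> j powr e * \<alpha> k powr (p - e))))
        \<le> ennreal (2 * D powr p * (\<theta> ^ (j - k) * (\<alpha> j powr p + \<alpha> k powr p)))" by (simp add: ennreal_leI)
    qed simp
    also have "(\<Sum>j<n. \<Sum>k\<le>j. ennreal (2 * D powr p * (\<theta> ^ (j - k) * (\<alpha> j powr p + \<alpha> k powr p))))
      = ennreal (2 * D powr p * (\<Sum>j<n. \<Sum>k\<le>j. \<theta> ^ (j - k) * (\<alpha> j powr p + \<alpha> k powr p)))"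
      using \<theta> unfolding sum_distrib_left by (subst sum_ennreal, simp)+ (auto intro: sum_nonneg)
    also have "ennreal Q * \<dots> \<le> ennreal Q * ennreal (2 * D powr p * (2 / (1 - \<theta>) * (\<Sum>j<n. \<alpha> j powr p)))"
      by (intro mult_left_mono ennreal_leI sum_geometric_convolution_le \<theta>) auto
    also have "\<dots> = ennreal (C * (\<Sum>j<n. \<alpha> j powr p))"
    proof -
      have "0 \<le> 2 * D powr p * (2 / (1 - \<theta>) * (\<Sum>j<n. \<alpha> j powr p))"
        using \<theta> by (intro mult_nonneg_nonneg sum_nonneg divide_nonneg_nonneg) auto
      then have "ennreal Q * ennreal (2 * D powr p * (2 / (1 - \<theta>) * (\<Sum>j<n. \<alpha> j powr p))) = ennreal (Q * (2 * D powr p * (2 / (1 - \<theta>) * (\<Sum>j<n. \<alpha> j powr p))))"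
        using Q by (intro ennreal_mult[symmetric]) auto
      then show ?thesis by (simp add: C_def mult_ac)
    qed
    finally show "(\<integral>\<^sup>+x. ennreal ((\<Sum>j<n. b j x powr e) ^ Suc R) \<partial>M) \<le> ennreal (C * (\<Sum>j<n. \<alpha> j powr p))" .
  qed
qed

section \<open>Monotonicity in the summability exponent and the quasi-norm estimate\<close>

lemma ennreal_powr_add: "0 < r \<Longrightarrow> 0 < s \<Longrightarrow> ennreal_powr x (r + s) = ennreal_powr x r * ennreal_powr x s"
  by (cases x) (auto simp: ennreal_powr_ennreal powr_add ennreal_mult)

text \<open>Each \<open>c j\<close> is at most \<open>T\<close>, the right-hand side. Splitting the
  power \<open>r\<close> into \<open>e\<close> and \<open>r - e\<close> and bounding the second
  factor by \<open>T\<close> makes the sum of the \<open>r\<close>-th powers at most the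
  \<open>r\<close>-th power of \<open>T\<close>.\<close>

lemma lq_norm_antimono:
  assumes "0 < e" "ereal e \<le> q" shows "lq_norm q c \<le> lq_norm (ereal e) c"
proof -
  define T where "T = lq_norm (ereal e) c"
  have le: "c j \<le> T" for j unfolding T_def using assms(1) by (intro le_lq_norm) simp
  show ?thesis
  proof (cases "q = \<infinity>")
    case True
    then show ?thesis using le by (simp add: lq_norm_def[of \<infinity>] SUP_le_iff flip: T_def)
  next
    case False
    then obtain r where r: "q = ereal r" "e \<le> r" using assms by (cases q) auto
    show ?thesis
    proof (cases "e = r")
      case True
      then show ?thesis using r by simp
    next
      case ne: False
      then have re: "0 < r - e" "0 < r" using r assms by auto
      have split: "ennreal_powr x r = ennreal_powr x e * ennreal_powr x (r - e)" for x
        using ennreal_powr_add[OF assms(1) re(1), of x] by simp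
      have "(\<Sum>j. ennreal_powr (c j) r) \<le> (\<Sum>j. ennreal_powr (c j) e * ennreal_powr T (r - e))"
        unfolding split using re le by (intro suminf_le summableI mult_left_mono ennreal_powr_mono) auto
      also have "\<dots> = (\<Sum>j. ennreal_powr (c j) e) * ennreal_powr T (r - e)" by (rule ennreal_suminf_multc)
      also have "(\<Sum>j. ennreal_powr (c j) e) = ennreal_powr T e" unfolding T_def by (rule lq_norm_powr[OF assms(1), symmetric])
      also have "ennreal_powr T e * ennreal_powr T (r - e) = ennreal_powr T r" by (rule split[symmetric])
      finally have "ennreal_powr (\<Sum>j. ennreal_powr (c j) r) (1 / r) \<le> ennreal_powr (ennreal_powr T r) (1 / r)"
        using re by (intro ennreal_powr_mono) auto
      then show ?thesis using re by (simp add: r(1) lq_norm_def[of "ereal r"] ennreal_powr_cancel T_def)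
    qed
  qed
qed

text \<open>With \<open>\<alpha> j\<close> the weighted \<open>p0\<close>-norm from the Besov
  quasi-norm, the exponent identity gives both inputs of the summation: the integral of
  \<open>b j x powr p0\<close> equals
  \<open>\<rho> powr (- (real j * (1 - p0 / p))) * \<alpha> j powr p0\<close>, and the block
  estimate with \<open>\<mu> = 0\<close> bounds \<open>b j\<close> by
  \<open>\<rho> powr (real j / p) * \<alpha> j\<close> up to a constant.\<close>

lemma besov_triebel_bound:
  fixes a :: "real^'n::finite" and \<psi> :: "real^'n \<Rightarrow> complex"
  assumes a: "anisotropy a" and \<psi>: "cutoff a \<psi>" and p: "0 < p0" "p0 < p" and q: "0 < (q::ereal)"
    and s: "s0 - aniso_size a / p0 = s - aniso_size a / p"
  shows "\<exists>C. \<forall>f\<in>tempered_distributions. besov_norm a \<psi> s0 (ereal p0) (ereal p) f < \<infinity> \<longrightarrow>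
    triebel_norm a \<psi> s (ereal p) q f \<le> ennreal C * besov_norm a \<psi> s0 (ereal p0) (ereal p) f"
proof -
  define d where "d = aniso_size a"
  have d: "d > 0" unfolding d_def by (rule aniso_size_pos[OF a])
  define \<rho> where "\<rho> = 2 powr d"
  have \<rho>: "\<rho> > 1" unfolding \<rho>_def using d by (intro gr_one_powr) auto
  have \<rho>j: "\<rho> powr x = 2 powr (x * d)" for x by (simp add: \<rho>_def powr_powr mult.commute)
  define qr where "qr = (if q = \<infinity> then 1 else real_of_ereal q)"
  have qr: "qr > 0" "ereal qr \<le> q" using q by (cases q; simp add: qr_def)+
  \<comment> \<open>The bounds that \<open>e\<close> must respect: at most \<open>q\<close> for the
    passage to a smaller summability exponent, at most \<open>p0\<close> and \<open>p - p0\<close>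
    for the splitting of the products. \<open>qr\<close> is a positive real number not above
    \<open>q\<close>, also when \<open>q = \<infinity>\<close>.\<close>
  define e1 where "e1 = min qr (min p0 (p - p0))"
  have e1: "e1 > 0" using qr p by (simp add: e1_def)
  obtain N :: nat where N: "p / e1 \<le> real N" using real_arch_simple by blast
  \<comment> \<open>The successor ensures \<open>R \<ge> 1\<close>, so that the factor of degree
    \<open>p - e\<close> does not degenerate.\<close>
  define R where "R = Suc N"
  define e where "e = p / real (Suc R)"
  have p': "p > 0" using p by simp
  have "e \<le> e1"
  proof -
    have "p / e1 \<le> real (Suc R)" using N by (simp add: R_def)
    then show ?thesis using e1 by (simp add: e_def field_simps)
  qed
  then have e: "0 < e" "e \<le> p0" "e \<le> p - p0" "ereal e \<le> q"
    using p' qr(2) by (auto simp: e1_def e_def intro: order_trans[of _ "ereal qr"])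
  have eS: "p / e = real (Suc R)" using p' by (simp add: e_def)
  obtain C1 where C1: "C1 > 0" "\<forall>f\<in>tempered_distributions. \<forall>j x \<mu>. \<forall>h\<in>borel_measurable borel.
      (\<forall>y. ennreal (norm (freq_block a \<psi> j f y) powr p0) \<le> \<mu> + h y) \<longrightarrow>
      ennreal (norm (freq_block a \<psi> j f x) powr p0)
        \<le> ennreal C1 * (\<mu> + ennreal (2 powr (real j * aniso_size a)) * (\<integral>\<^sup>+y. h y \<partial>lborel))"
    using block_estimate[OF a \<psi> p(1)] by (elim exE conjE)
  define D where "D = max 1 (C1 powr (1 / p0))"
  have D: "D \<ge> 1" by (simp add: D_def)
  obtain C where C: "C > 0" "\<forall>b \<alpha> n. (\<forall>j. b j \<in> borel_measurable (lborel :: (real^'n) measure)) \<longrightarrow> (\<forall>j x. b j x \<ge> (0::real)) \<longrightarrow> (\<forall>j. \<alpha> j \<ge> 0) \<longrightarrow>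
    (\<forall>j x. b j x \<le> D * (\<rho> powr (real j / p) * \<alpha> j)) \<longrightarrow>
    (\<forall>j. (\<integral>\<^sup>+x. ennreal (b j x powr p0) \<partial>lborel) \<le> ennreal (\<rho> powr (- (real j * (1 - p0 / p))) * \<alpha> j powr p0)) \<longrightarrow>
    (\<integral>\<^sup>+x. ennreal ((\<Sum>j<n. b j x powr e) ^ Suc R) \<partial>lborel) \<le> ennreal (C * (\<Sum>j<n. \<alpha> j powr p))"
    using power_sum_integral_le[OF D \<rho> p _ e_def e(2,3), of "lborel :: (real^'n) measure"] by (auto simp: R_def)
  show ?thesis
  proof (intro exI[of _ "C powr (1 / p)"] ballI impI)
    fix f :: "'n distr"
    assume f: "f \<in> tempered_distributions" and fin: "besov_norm a \<psi> s0 (ereal p0) (ereal p) f < \<infinity>"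
    have [measurable]: "freq_block a \<psi> j f \<in> borel_measurable borel" for j
      by (intro borel_measurable_continuous_onI freq_block_continuous_growth[OF a \<psi> f])
    define c where "c j = ennreal (2 powr (real j * s0)) * Lp_norm (ereal p0) (\<lambda>x. ennreal (norm (freq_block a \<psi> j f x)))" for j
    define B where "B = besov_norm a \<psi> s0 (ereal p0) (ereal p) f"
    have cB: "(\<Sum>j. ennreal_powr (c j) p) = ennreal_powr B p"
      unfolding B_def besov_norm_def c_def by (rule lq_norm_powr[OF p', symmetric])
    have "c j < top" for j
    proof -
      have "c j \<le> B" unfolding B_def besov_norm_def c_def using p' by (intro le_lq_norm) simp
      then show ?thesis using fin unfolding B_def by (auto intro: le_less_trans)
    qed
    then have "c j = ennreal (enn2real (c j))" for j by simp
    define \<alpha> where "\<alpha> j = enn2real (c j)" for j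
    have c\<alpha>: "c j = ennreal (\<alpha> j)" for j unfolding \<alpha>_def by fact
    have \<alpha>0: "\<alpha> j \<ge> 0" for j by (simp add: \<alpha>_def)
    define b where "b j x = 2 powr (real j * s) * norm (freq_block a \<psi> j f x)" for j x
    have b0: "b j x \<ge> 0" for j x by (simp add: b_def)
    have bm [measurable]: "b j \<in> borel_measurable borel" for j unfolding b_def by measurable
    define I where "I j = (\<integral>\<^sup>+x. ennreal (norm (freq_block a \<psi> j f x) powr p0) \<partial>lborel)" for j
    have cI: "ennreal (\<alpha> j powr p0) = ennreal (2 powr (real j * s0 * p0)) * I j" for j
    proof -
      have "ennreal (\<alpha> j powr p0) = ennreal_powr (c j) p0" by (simp add: c\<alpha> ennreal_powr_ennreal \<alpha>0)
      also have "\<dots> = ennreal_powr (ennreal (2 powr (real j * s0))) p0 * ennreal_powr (Lp_norm (ereal p0) (\<lambda>x. ennreal (norm (freq_block a \<psi> j f x)))) p0"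
        unfolding c_def by (rule ennreal_powr_mult[OF p(1)])
      also have "\<dots> = ennreal (2 powr (real j * s0 * p0)) * I j"
        unfolding Lp_norm_powr[OF p(1)] I_def by (simp add: ennreal_powr_ennreal powr_powr)
      finally show ?thesis .
    qed
    \<comment> \<open>The weights 2^(js) and 2^(j s0), raised to the power \<open>p0\<close>, differ
      by the power of 2^|a| dictated by the exponent identity.\<close>
    have exp1: "real j * s * p0 = real j * s0 * p0 + - (real j * (1 - p0 / p)) * d" for j
    proof -
      have "s = s0 - d / p0 + d / p" using s by (simp add: d_def)
      then have "s * p0 = s0 * p0 - (1 - p0 / p) * d" using p by (simp add: field_simps)
      then have "real j * (s * p0) = real j * (s0 * p0 - (1 - p0 / p) * d)" by simp
      then show ?thesis by (simp add: algebra_simps)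
    qed
    have bI: "(\<integral>\<^sup>+x. ennreal (b j x powr p0) \<partial>lborel) = ennreal (\<rho> powr (- (real j * (1 - p0 / p))) * \<alpha> j powr p0)" for j
    proof -
      have "(\<integral>\<^sup>+x. ennreal (b j x powr p0) \<partial>lborel) = (\<integral>\<^sup>+x. ennreal (2 powr (real j * s * p0)) * ennreal (norm (freq_block a \<psi> j f x) powr p0) \<partial>lborel)"
        unfolding b_def powr_mult powr_powr by (simp add: ennreal_mult)
      also have "\<dots> = ennreal (2 powr (real j * s * p0)) * I j"
        unfolding I_def by (rule nn_integral_cmult) measurable
      also have "\<dots> = ennreal (\<rho> powr (- (real j * (1 - p0 / p)))) * (ennreal (2 powr (real j * s0 * p0)) * I j)"
        unfolding exp1 \<rho>j powr_add by (simp add: ennreal_mult mult_ac)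
      also have "\<dots> = ennreal (\<rho> powr (- (real j * (1 - p0 / p))) * \<alpha> j powr p0)"
        unfolding cI[symmetric] by (rule ennreal_mult[symmetric]) auto
      finally show ?thesis .
    qed
    have bs: "b j x \<le> D * (\<rho> powr (real j / p) * \<alpha> j)" for j x
    proof -
      have hm: "(\<lambda>y. ennreal (norm (freq_block a \<psi> j f y) powr p0)) \<in> borel_measurable borel" by measurable
      have "ennreal (norm (freq_block a \<psi> j f x) powr p0) \<le> ennreal C1 * (0 + ennreal (2 powr (real j * aniso_size a)) * I j)"
        unfolding I_def
        by (intro C1(2)[THEN bspec, OF f, THEN spec, of j, THEN spec, of x, THEN spec, of 0, THEN bspec,
            of "\<lambda>y. ennreal (norm (freq_block a \<psi> j f y) powr p0)", THEN mp] allI) (use hm in simp_all)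
      then have "ennreal (2 powr (real j * s * p0)) * ennreal (norm (freq_block a \<psi> j f x) powr p0) \<le>
         ennreal (2 powr (real j * s * p0)) * (ennreal C1 * (0 + ennreal (2 powr (real j * aniso_size a)) * I j))"
        by (rule mult_left_mono) simp
      also have "\<dots> = ennreal C1 * ennreal (\<rho> powr real j) * (ennreal (2 powr (real j * s * p0)) * I j)"
        by (simp add: \<rho>j d_def mult_ac)
      also have "ennreal (2 powr (real j * s * p0)) * I j = ennreal (\<rho> powr (- (real j * (1 - p0 / p)))) * (ennreal (2 powr (real j * s0 * p0)) * I j)"
        unfolding exp1 \<rho>j powr_add by (simp add: ennreal_mult mult_ac)
      also have "\<dots> = ennreal (\<rho> powr (- (real j * (1 - p0 / p))) * \<alpha> j powr p0)"
        unfolding cI[symmetric] by (rule ennreal_mult[symmetric]) auto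
      also have "ennreal C1 * ennreal (\<rho> powr real j) * \<dots> = ennreal (C1 * \<rho> powr real j * (\<rho> powr (- (real j * (1 - p0 / p))) * \<alpha> j powr p0))"
        using C1(1) by (simp add: ennreal_mult)
      also have "ennreal (2 powr (real j * s * p0)) * ennreal (norm (freq_block a \<psi> j f x) powr p0) = ennreal (b j x powr p0)"
        unfolding b_def powr_mult powr_powr by (simp add: ennreal_mult)
      finally have "b j x powr p0 \<le> C1 * \<rho> powr real j * (\<rho> powr (- (real j * (1 - p0 / p))) * \<alpha> j powr p0)"
        using C1(1) by (subst (asm) ennreal_le_iff) auto
      also have "\<dots> = C1 * ((\<rho> powr (real j / p) * \<alpha> j) powr p0)"
      proof -
        have "real j + - (real j * (1 - p0 / p)) = real j / p * p0" by (simp add: field_simps)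
        then have "\<rho> powr real j * \<rho> powr (- (real j * (1 - p0 / p))) = \<rho> powr (real j / p * p0)" by (simp only: powr_add[symmetric])
        then show ?thesis by (simp add: powr_mult powr_powr)
      qed
      finally have "(b j x powr p0) powr (1 / p0) \<le> (C1 * ((\<rho> powr (real j / p) * \<alpha> j) powr p0)) powr (1 / p0)"
        using p by (intro powr_mono2) auto
      also have "\<dots> = C1 powr (1 / p0) * ((\<rho> powr (real j / p) * \<alpha> j) powr p0) powr (1 / p0)" by (rule powr_mult)
      finally have "b j x \<le> C1 powr (1 / p0) * (\<rho> powr (real j / p) * \<alpha> j)"
        using p b0[of j x] \<alpha>0[of j] by (simp add: powr_powr)
      also have "\<dots> \<le> D * (\<rho> powr (real j / p) * \<alpha> j)"
        using \<alpha>0[of j] by (intro mult_right_mono) (auto simp: D_def)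
      finally show ?thesis .
    qed
    have fin_sum: "(\<integral>\<^sup>+x. ennreal_powr (\<Sum>j<n. ennreal (b j x powr e)) (p / e) \<partial>lborel) \<le> ennreal C * ennreal_powr B p" for n
    proof -
      have eq: "ennreal_powr (\<Sum>j<n. ennreal (b j x powr e)) (p / e) = ennreal ((\<Sum>j<n. b j x powr e) ^ Suc R)" for x
      proof -
        have s0: "(\<Sum>j<n. b j x powr e) \<ge> 0" by (intro sum_nonneg) simp
        have "(\<Sum>j<n. ennreal (b j x powr e)) = ennreal (\<Sum>j<n. b j x powr e)" by (rule sum_ennreal) simp
        then have "ennreal_powr (\<Sum>j<n. ennreal (b j x powr e)) (p / e) = ennreal ((\<Sum>j<n. b j x powr e) powr real (Suc R))"
          unfolding eS by (simp only: ennreal_powr_ennreal[OF s0])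
        also have "(\<Sum>j<n. b j x powr e) powr real (Suc R) = (\<Sum>j<n. b j x powr e) ^ Suc R"
          using s0 by (intro powr_realpow') auto
        finally show ?thesis .
      qed
      have "(\<integral>\<^sup>+x. ennreal ((\<Sum>j<n. b j x powr e) ^ Suc R) \<partial>lborel) \<le> ennreal (C * (\<Sum>j<n. \<alpha> j powr p))"
        using bm by (intro C(2)[THEN spec, of b, THEN spec, of \<alpha>, THEN spec, of n, THEN mp, THEN mp, THEN mp, THEN mp, THEN mp] allI b0 \<alpha>0 bs)
          (simp_all add: bI)
      also have "\<dots> = ennreal C * (\<Sum>j<n. ennreal_powr (c j) p)"
      proof -
        have "(\<Sum>j<n. ennreal_powr (c j) p) = (\<Sum>j<n. ennreal (\<alpha> j powr p))" by (simp add: c\<alpha> ennreal_powr_ennreal \<alpha>0)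
        also have "\<dots> = ennreal (\<Sum>j<n. \<alpha> j powr p)" by (rule sum_ennreal) simp
        finally show ?thesis using C(1) by (simp add: ennreal_mult sum_nonneg)
      qed
      also have "\<dots> \<le> ennreal C * (\<Sum>j. ennreal_powr (c j) p)"
        by (intro mult_left_mono sum_le_suminf summableI) auto
      finally show ?thesis unfolding eq cB .
    qed
    \<comment> \<open>Partial sums are raised to the power \<open>p / e = R + 1\<close> before
      passing to the limit: these functions increase in \<open>n\<close>, so monotone convergence
      transfers the uniform bound to the full series.\<close>
    let ?F = "\<lambda>n x. ennreal_powr (\<Sum>j<n. ennreal (b j x powr e)) (p / e)"
    have "ennreal_powr (triebel_norm a \<psi> s (ereal p) q f) p = (\<integral>\<^sup>+x. ennreal_powr (lq_norm q (\<lambda>j. ennreal (b j x))) p \<partial>lborel)"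
      unfolding triebel_norm_def Lp_norm_powr[OF p'] b_def by (simp add: ennreal_mult)
    also have "\<dots> \<le> (\<integral>\<^sup>+x. (SUP n. ?F n x) \<partial>lborel)"
    proof (rule nn_integral_mono)
      fix x
      define U where "U = (SUP n. ?F n x)"
      have "(\<Sum>j. ennreal_powr (ennreal (b j x)) e) \<le> ennreal_powr U (e / p)"
      proof (rule suminf_le_const[OF summableI])
        fix n
        have "?F n x \<le> U" unfolding U_def by (rule SUP_upper) simp
        then have "ennreal_powr (?F n x) (e / p) \<le> ennreal_powr U (e / p)"
          using e p' by (intro ennreal_powr_mono) auto
        then show "(\<Sum>j<n. ennreal_powr (ennreal (b j x)) e) \<le> ennreal_powr U (e / p)"
          using e p' by (simp add: ennreal_powr_powr ennreal_powr_ennreal b0)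
      qed
      then have "ennreal_powr (\<Sum>j. ennreal_powr (ennreal (b j x)) e) (p / e) \<le> ennreal_powr (ennreal_powr U (e / p)) (p / e)"
        using e p' by (intro ennreal_powr_mono) auto
      also have "\<dots> = U" using e p' by (simp add: ennreal_powr_powr)
      also have "ennreal_powr (\<Sum>j. ennreal_powr (ennreal (b j x)) e) (p / e) = ennreal_powr (lq_norm (ereal e) (\<lambda>j. ennreal (b j x))) p"
        unfolding lq_norm_powr[OF e(1), symmetric] using e by (simp add: ennreal_powr_powr)
      finally have "ennreal_powr (lq_norm (ereal e) (\<lambda>j. ennreal (b j x))) p \<le> U" .
      moreover have "ennreal_powr (lq_norm q (\<lambda>j. ennreal (b j x))) p \<le> ennreal_powr (lq_norm (ereal e) (\<lambda>j. ennreal (b j x))) p"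
        using p' by (intro ennreal_powr_mono lq_norm_antimono e) auto
      ultimately show "ennreal_powr (lq_norm q (\<lambda>j. ennreal (b j x))) p \<le> (SUP n. ?F n x)"
        unfolding U_def by (rule order_trans[rotated])
    qed
    also have "\<dots> = (SUP n. \<integral>\<^sup>+x. ?F n x \<partial>lborel)"
    proof (rule nn_integral_monotone_convergence_SUP)
      show "incseq ?F"
        using e p' by (intro incseq_SucI le_funI ennreal_powr_mono) (auto intro: add_increasing2)
      show "?F n \<in> borel_measurable lborel" for n by measurable
    qed
    also have "\<dots> \<le> ennreal C * ennreal_powr B p" by (intro SUP_least fin_sum)
    finally have "ennreal_powr (ennreal_powr (triebel_norm a \<psi> s (ereal p) q f) p) (1 / p) \<le> ennreal_powr (ennreal C * ennreal_powr B p) (1 / p)"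
      using p' by (intro ennreal_powr_mono) auto
    then show "triebel_norm a \<psi> s (ereal p) q f \<le> ennreal (C powr (1 / p)) * besov_norm a \<psi> s0 (ereal p0) (ereal p) f"
      using p' C(1) by (simp add: ennreal_powr_mult ennreal_powr_ennreal ennreal_powr_cancel B_def)
  qed
qed

theorem proposition7:
  fixes a :: "real^'n::finite" and \<psi> :: "real^'n \<Rightarrow> complex"
    and p0 p p1 q :: ereal and s0 s s1 :: real
  assumes "anisotropy a" and "cutoff a \<psi>"
    and "0 < p0" and "p0 < p" and "p < p1" and "p1 \<le> \<infinity>"
    and "s1 < s" and "s < s0"
    and "0 < q" and "q \<le> \<infinity>"
    and "ereal s0 - ereal (aniso_size a) / p0 = ereal s - ereal (aniso_size a) / p"
    and "ereal s - ereal (aniso_size a) / p = ereal s1 - ereal (aniso_size a) / p1"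
  shows "continuously_embedded
           (besov_space a \<psi> s0 p0 p) (besov_norm a \<psi> s0 p0 p)
           (triebel_space a \<psi> s p q) (triebel_norm a \<psi> s p q)
       \<and> continuously_embedded
           (triebel_space a \<psi> s p q) (triebel_norm a \<psi> s p q)
           (besov_space a \<psi> s1 p1 p) (besov_norm a \<psi> s1 p1 p)"
proof -
  \<comment> \<open>\<open>p0\<close> and \<open>p\<close> lie strictly below other exponents, so
    both are finite; only \<open>p1\<close> and \<open>q\<close> may be
    \<open>\<infinity>\<close>.\<close>
  obtain r0 where r0: "p0 = ereal r0" "0 < r0" using assms(3,4) by (cases p0) auto
  obtain r where r: "p = ereal r" "r0 < r" using assms(4,5) r0 by (cases p) auto
  have finite_bound: "y < \<infinity>" if "y \<le> ennreal C * x" "x < \<infinity>" for x y :: ennreal and C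
  proof -
    have "ennreal C * x < \<infinity>" using that(2) by (simp add: ennreal_mult_less_top)
    with that(1) show ?thesis by (rule le_less_trans)
  qed
  have "s0 - aniso_size a / r0 = s - aniso_size a / r"
    using assms(11) r r0 by simp
  from besov_triebel_bound[OF assms(1,2) r0(2) r(2) assms(9) this]
  obtain C where C: "\<And>f. f \<in> besov_space a \<psi> s0 p0 p \<Longrightarrow> triebel_norm a \<psi> s p q f \<le> ennreal C * besov_norm a \<psi> s0 p0 p f"
    unfolding besov_space_def r0(1) r(1) by auto
  have "0 < r" "ereal r < p1" using r r0 assms(5) by auto
  from triebel_besov_bound[OF assms(1,2) this assms(9) assms(12)[unfolded r(1)]]
  obtain K where K: "\<And>f. f \<in> triebel_space a \<psi> s p q \<Longrightarrow> besov_norm a \<psi> s1 p1 p f \<le> ennreal K * triebel_norm a \<psi> s p q f"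
    unfolding triebel_space_def r(1) by auto
  show ?thesis
    unfolding continuously_embedded_def
  proof (intro conjI exI ballI)
    show "besov_space a \<psi> s0 p0 p \<subseteq> triebel_space a \<psi> s p q"
      using finite_bound[OF C] by (auto simp: besov_space_def triebel_space_def)
    show "triebel_space a \<psi> s p q \<subseteq> besov_space a \<psi> s1 p1 p"
      using finite_bound[OF K] by (auto simp: besov_space_def triebel_space_def)
  qed (use C K in auto)
qed

end
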